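(* Let $\rho_{ABC}$ be a state on finite-dimensional systems $A,B,C$, with $d_B=\dim\mathcal{H}_B$. Define $\Delta(\rho)=\inf D(\rho\|\mu)$, the infimum over all finite-dimensional systems $\widehat A\supseteq A$, $\widehat B\supseteq B$, $\widehat C\supseteq C$ (isometric embeddings, $\rho$ regarded as a state on $\widehat A\widehat B\widehat C$) and all quantum Markov states $\mu$ on $\widehat A\widehat B\widehat C$. Then this infimum is attained at a Markov state on $A\widehat{B}C$ (with $A$, $C$ unenlarged) for some embedding $B\hookrightarrow\widehat B$ whose decomposition is $\widehat{B}=\bigoplus_{j=1}^{k}b_j^L\otimes b_j^R$ with $k\le d_B^2$ and $\dim b_j^L,\dim b_j^R\le d_B$ for all $j$. In particular the infimum is a minimum, and for fixed dimensions $d_A,d_B,d_C$, $\Delta$ is a continuous function of $\rho$.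
   Context: A quantum Markov state on a tripartite system $XYZ$ is a state $\mu_{XYZ}$ for which there exist an orthogonal direct sum decomposition $\mathcal H_Y=\bigoplus_j b_j^L\otimes b_j^R$, a probability distribution $(p_j)$ and states $\mu^{(j)}_{Xb_j^L}$, $\mu^{(j)}_{b_j^RZ}$ such that $\mu_{XYZ}=\bigoplus_j p_j\,\mu^{(j)}_{Xb_j^L}\otimes\mu^{(j)}_{b_j^RZ}$. $D(\rho\|\mu)=\operatorname{tr}\rho(\log\rho-\log\mu)$ is the quantum relative entropy. *)

theory Defs
  imports Complex_Main "HOL-Library.Extended_Real" "Jordan_Normal_Form.Matrix"
begin

text \<open>Finite-dimensional quantum systems: the Hilbert space of a system of dimension n is
  identified with complex column vectors of length n; operators are complex n x n matrices.
  Composite systems are modelled by the Kronecker product (standard index ordering).\<close>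

definition adj :: "complex mat \<Rightarrow> complex mat" where
  "adj M = mat (dim_col M) (dim_row M) (\<lambda>(i,j). cnj (M $$ (j,i)))"

definition kron :: "complex mat \<Rightarrow> complex mat \<Rightarrow> complex mat" where
  "kron A B = mat (dim_row A * dim_row B) (dim_col A * dim_col B)
     (\<lambda>(i,j). A $$ (i div dim_row B, j div dim_col B) * B $$ (i mod dim_row B, j mod dim_col B))"

definition mtrace :: "complex mat \<Rightarrow> complex" where
  "mtrace M = (\<Sum>i<dim_row M. M $$ (i,i))"

definition psd :: "nat \<Rightarrow> complex mat \<Rightarrow> bool" where
  "psd n M \<longleftrightarrow> M \<in> carrier_mat n n \<and> adj M = M \<and>
     (\<forall>v \<in> carrier_vec n. 0 \<le> Re (\<Sum>i<n. cnj (v $ i) * (M *\<^sub>v v) $ i))"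

definition density :: "nat \<Rightarrow> complex mat \<Rightarrow> bool" where
  "density n \<rho> \<longleftrightarrow> psd n \<rho> \<and> mtrace \<rho> = 1"

definition isometry :: "nat \<Rightarrow> nat \<Rightarrow> complex mat \<Rightarrow> bool" where
  "isometry m n V \<longleftrightarrow> V \<in> carrier_mat n m \<and> adj V * V = 1\<^sub>m m"

definition unitary_m :: "nat \<Rightarrow> complex mat \<Rightarrow> bool" where
  "unitary_m n U \<longleftrightarrow> isometry n n U"

definition rdiag :: "nat \<Rightarrow> (nat \<Rightarrow> real) \<Rightarrow> complex mat" where
  "rdiag n d = mat n n (\<lambda>(i,j). if i = j then complex_of_real (d i) else 0)"

text \<open>Functional calculus for Hermitian matrices via a spectral decomposition
  (the result does not depend on the chosen decomposition).\<close>
definition mat_fun :: "(real \<Rightarrow> real) \<Rightarrow> complex mat \<Rightarrow> complex mat" where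
  "mat_fun f M = (SOME N. \<exists>U d. unitary_m (dim_row M) U \<and>
       M = U * rdiag (dim_row M) d * adj U \<and> N = U * rdiag (dim_row M) (f \<circ> d) * adj U)"

definition mlog :: "complex mat \<Rightarrow> complex mat" where
  "mlog M = mat_fun (\<lambda>x. if x > 0 then ln x else 0) M"

definition rel_entropy :: "complex mat \<Rightarrow> complex mat \<Rightarrow> ereal" where
  "rel_entropy \<rho> \<sigma> =
     (if (\<forall>v \<in> carrier_vec (dim_row \<rho>). \<sigma> *\<^sub>v v = 0\<^sub>v (dim_row \<rho>) \<longrightarrow> \<rho> *\<^sub>v v = 0\<^sub>v (dim_row \<rho>))
      then ereal (Re (mtrace (\<rho> * (mlog \<rho> - mlog \<sigma>))))
      else \<infinity>)"

definition msum :: "nat \<Rightarrow> nat \<Rightarrow> (nat \<Rightarrow> complex mat) \<Rightarrow> complex mat" where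
  "msum n k F = mat n n (\<lambda>ij. \<Sum>j<k. F j $$ ij)"

text \<open>Explicit Markov decomposition of a state mu on XYZ (dimensions dX, dY, dZ):
  H_Y = (+)_{j<k} b_j^L (x) b_j^R, where block j has dim b_j^L = l j, dim b_j^R = r j and
  is embedded into H_Y by the isometry W j (ranges mutually orthogonal and spanning H_Y);
  mu = (+)_j p_j sigma_j (x) tau_j with sigma_j a state on X b_j^L and tau_j on b_j^R Z.\<close>
definition markov_decomp ::
  "nat \<Rightarrow> nat \<Rightarrow> nat \<Rightarrow> nat \<Rightarrow> (nat \<Rightarrow> nat) \<Rightarrow> (nat \<Rightarrow> nat) \<Rightarrow> (nat \<Rightarrow> complex mat)
   \<Rightarrow> (nat \<Rightarrow> real) \<Rightarrow> (nat \<Rightarrow> complex mat) \<Rightarrow> (nat \<Rightarrow> complex mat) \<Rightarrow> complex mat \<Rightarrow> bool" where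
  "markov_decomp dX dY dZ k l r W p \<sigma> \<tau> \<mu> \<longleftrightarrow>
     (\<forall>j<k. isometry (l j * r j) dY (W j)) \<and>
     (\<forall>i<k. \<forall>j<k. i \<noteq> j \<longrightarrow> adj (W i) * W j = 0\<^sub>m (l i * r i) (l j * r j)) \<and>
     msum dY k (\<lambda>j. W j * adj (W j)) = 1\<^sub>m dY \<and>
     (\<forall>j<k. 0 \<le> p j) \<and> (\<Sum>j<k. p j) = 1 \<and>
     (\<forall>j<k. density (dX * l j) (\<sigma> j) \<and> density (r j * dZ) (\<tau> j)) \<and>
     \<mu> = msum (dX * dY * dZ) k (\<lambda>j.
           let E = kron (kron (1\<^sub>m dX) (W j)) (1\<^sub>m dZ)
           in complex_of_real (p j) \<cdot>\<^sub>m (E * kron (\<sigma> j) (\<tau> j) * adj E))"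

definition markov_state :: "nat \<Rightarrow> nat \<Rightarrow> nat \<Rightarrow> complex mat \<Rightarrow> bool" where
  "markov_state dX dY dZ \<mu> \<longleftrightarrow> (\<exists>k l r W p \<sigma> \<tau>. markov_decomp dX dY dZ k l r W p \<sigma> \<tau> \<mu>)"

definition embed3 :: "complex mat \<Rightarrow> complex mat \<Rightarrow> complex mat \<Rightarrow> complex mat \<Rightarrow> complex mat" where
  "embed3 VA VB VC \<rho> = (let V = kron (kron VA VB) VC in V * \<rho> * adj V)"

definition Delta :: "nat \<Rightarrow> nat \<Rightarrow> nat \<Rightarrow> complex mat \<Rightarrow> ereal" where
  "Delta dA dB dC \<rho> = Inf {rel_entropy (embed3 VA VB VC \<rho>) \<mu> | dA' dB' dC' VA VB VC \<mu>.
      isometry dA dA' VA \<and> isometry dB dB' VB \<and> isometry dC dC' VC \<and> markov_state dA' dB' dC' \<mu>}"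

end

theory Submission
  imports Defs "HOL-Analysis.Weierstrass_Theorems" "Jordan_Normal_Form.Spectral_Radius"
begin

text \<open>Let \<open>S(M) = - tr M log M\<close>. For a Markov state with block isometries \<open>W\<^sub>j\<close> and an embedding
  \<open>V\<close> of \<open>B\<close>, put \<open>V\<^sub>j = W\<^sub>j\<^sup>* V\<close> and let \<open>X\<^sub>j\<close> be the compression of the state \<open>\<rho>\<close> by \<open>V\<^sub>j\<close>,
  of trace \<open>q\<^sub>j\<close>. Gibbs' inequality, applied to the block weights and to the two factors of each
  block, bounds the relative entropy from below by \<open>- S(\<rho>)\<close> plus the sum of the costs
  \<open>S(X\<^sub>A\<^sub>L) + S(X\<^sub>R\<^sub>C) + q log q\<close> of the blocks, with equality when the Markov state is built from the
  marginals of the \<open>X\<^sub>j\<close>. Isometries on \<open>A\<close> and \<open>C\<close> do not change the costs, so only the family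
  \<open>(V\<^sub>j)\<close>, subject to \<open>\<Sum> V\<^sub>j\<^sup>* V\<^sub>j = 1\<close>, remains to be optimised.

  If \<open>dim R > d\<^sub>B\<close>, there is a traceless Hermitian \<open>N \<noteq> 0\<close> on \<open>R\<close> with \<open>V\<^sup>* (1 \<otimes> N) V = 0\<close>. Moving from
  the identity along \<open>N\<close> in both directions until \<open>1 + t N\<close> is singular gives two smaller versions
  of the block with the same \<open>V\<^sup>* V\<close>. Both marginal entropies are concave along this segment (the
  spectrum of \<open>Q G G\<^sup>* Q\<^sup>*\<close> is that of \<open>G\<^sup>* Q\<^sup>* Q G\<close> up to zeros), so one of the two is at least as cheap.
  The same argument on the weights of the blocks, as in Choi's theorem and Caratheodory's theorem,
  leaves at most \<open>d\<^sub>B\<^sup>2\<close> blocks. The remaining families form a compact set on which the cost is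
  jointly continuous with \<open>\<rho>\<close>; continuity of \<open>S\<close> follows from polynomial approximation of
  \<open>- x log x\<close>, because the traces of powers are continuous.\<close>

unbundle no vec_syntax
hide_type (open) Finite_Cartesian_Product.vec
hide_const (open) Finite_Cartesian_Product.mat Finite_Cartesian_Product.vec Finite_Cartesian_Product.row

section \<open>Matrices, Kronecker products and partial traces\<close>

text \<open>The obstacle is that neither the number of blocks nor their dimensions are bounded, so
  compactness is available only after both have been cut down without raising the cost. Both bounds
  are dimension counts. A traceless \<open>N\<close> with vanishing compression solves
  \<open>d * d + 1\<close> linear equations in \<open>r * r\<close> unknowns, and
  \<open>d * d + 1\<close> is less than the square of \<open>d + 1\<close>; so a factor can shrink
  while its dimension exceeds \<open>d\<close>. The effects \<open>adj V * V\<close> of the blocks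
  lie in the real space of Hermitian matrices of size \<open>d\<close>, whose dimension is
  \<open>d * d\<close>; so more than \<open>d * d\<close> of them are dependent. Concavity in the
  weights rests on a sign: scaling a block adds an entropy term for each of the two marginals and
  removes it once, so one positive copy remains. Small or missing blocks are padded by isometries or
  zero operators, which gives all candidates one common shape. Entropies are compared only through
  traces of positive powers; this covers matrices of different sizes and continuity alike, without
  following individual eigenvalues.\<close>

lemma sum_prod_nat:
  "(\<Sum>k<m*n. f k) = (\<Sum>i<m. \<Sum>j<n. f (i*n+j))" for f :: "nat \<Rightarrow> 'a::comm_monoid_add"
proof (induction m)
  case (Suc m)
  have "{..<Suc m * n} = {..<m*n} \<union> {m*n..<m*n+n}" by auto
  moreover have "sum f {m*n..<m*n+n} = (\<Sum>j<n. f (m*n+j))"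
    using sum.shift_bounds_nat_ivl[of f 0 "m*n" n] by (simp add: add.commute lessThan_atLeast0)
  ultimately show ?case using Suc by (simp add: sum.union_disjoint ivl_disj_int)
qed simp

lemma index_mult_sum:
  assumes "i < dim_row A" "j < dim_col B" "dim_col A = dim_row B"
  shows "(A * B) $$ (i,j) = (\<Sum>k<dim_col A. A $$ (i,k) * B $$ (k,j))"
  using assms by (simp add: scalar_prod_def lessThan_atLeast0)

text \<open>The hypotheses are equations between dimensions, so the simplifier can discharge them
  and use the law as a rewrite rule. Right-nested products are the normal form in most calculations
  below.\<close>

lemma mult_assoc_dim:
  fixes A B C :: "'a::semiring_0 mat"
  shows "dim_col A = dim_row B \<Longrightarrow> dim_col B = dim_row C \<Longrightarrow> A * B * C = A * (B * C)"
  by (rule assoc_mult_mat[of A "dim_row A" "dim_row B" B "dim_row C" C "dim_col C"]) auto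

lemma add_mult_dim:
  fixes A B C :: "'a::semiring_0 mat"
  shows "dim_row A = dim_row B \<Longrightarrow> dim_col A = dim_col B \<Longrightarrow> dim_col B = dim_row C \<Longrightarrow>
    (A + B) * C = A * C + B * C"
  by (rule add_mult_distrib_mat[of A "dim_row B" "dim_row C" B C "dim_col C"]) auto

lemma mult_add_dim:
  fixes A B C :: "'a::semiring_0 mat"
  shows "dim_row A = dim_row B \<Longrightarrow> dim_col A = dim_col B \<Longrightarrow> dim_col C = dim_row B \<Longrightarrow>
    C * (A + B) = C * A + C * B"
  by (rule mult_add_distrib_mat[of C "dim_row C" "dim_row B" A "dim_col B" B]) auto

lemma mult_smult_dim:
  fixes A B :: "'a::comm_semiring_0 mat"
  shows "dim_col A = dim_row B \<Longrightarrow> A * (c \<cdot>\<^sub>m B) = c \<cdot>\<^sub>m (A * B)"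
  by (rule mult_smult_distrib[of A "dim_row A" "dim_row B" B "dim_col B"]) auto

lemma smult_mult_dim:
  fixes A B :: "'a::comm_semiring_0 mat"
  shows "dim_col A = dim_row B \<Longrightarrow> (c \<cdot>\<^sub>m A) * B = c \<cdot>\<^sub>m (A * B)"
  by (rule mult_smult_assoc_mat[of A "dim_row A" "dim_row B" B "dim_col B"]) auto

lemma adj_dim [simp]: "dim_row (adj M) = dim_col M" "dim_col (adj M) = dim_row M"
  by (auto simp: adj_def)

lemma adj_carrier [simp]: "adj M \<in> carrier_mat n m \<longleftrightarrow> M \<in> carrier_mat m n"
  by (auto intro!: carrier_matI)

lemma adj_index [simp]: "i < dim_col M \<Longrightarrow> j < dim_row M \<Longrightarrow> adj M $$ (i,j) = cnj (M $$ (j,i))"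
  by (simp add: adj_def)

lemma adj_adj [simp]: "adj (adj M) = M"
  by (rule eq_matI) auto

lemma adj_mult: "dim_col A = dim_row B \<Longrightarrow> adj (A * B) = adj B * adj A"
  by (rule eq_matI) (auto simp: index_mult_sum mult.commute simp del: index_mult_mat(1))

lemma adj_one [simp]: "adj (1\<^sub>m n) = 1\<^sub>m n"
  by (rule eq_matI) auto

lemma adj_zero [simp]: "adj (0\<^sub>m n m) = 0\<^sub>m m n"
  by (rule eq_matI) auto

lemma adj_smult: "adj (c \<cdot>\<^sub>m M) = cnj c \<cdot>\<^sub>m adj M"
  by (rule eq_matI) auto

lemma adj_add: "dim_row A = dim_row B \<Longrightarrow> dim_col A = dim_col B \<Longrightarrow> adj (A + B) = adj A + adj B"
  by (rule eq_matI) auto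

lemma kron_dim [simp]:
  "dim_row (kron A B) = dim_row A * dim_row B" "dim_col (kron A B) = dim_col A * dim_col B"
  by (auto simp: kron_def)

lemma kron_index: "i < dim_row A * dim_row B \<Longrightarrow> j < dim_col A * dim_col B \<Longrightarrow>
   kron A B $$ (i,j) = A $$ (i div dim_row B, j div dim_col B) * B $$ (i mod dim_row B, j mod dim_col B)"
  by (simp add: kron_def)

lemma less_mult_div_mod:
  fixes i m n :: nat
  assumes "i < m * n" shows "i div n < m" "i mod n < n"
  using assms by (auto simp: less_mult_imp_div_less intro!: mod_less_divisor gr0I)

lemma pair_index_less: fixes i j m n :: nat assumes "i < m" "j < n" shows "i * n + j < m * n"
proof -
  have "i * n + j < Suc i * n" using assms by simp
  also have "\<dots> \<le> m * n" using assms by (intro mult_le_mono1) simp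
  finally show ?thesis .
qed

lemma div_mod_pair: fixes a b n :: nat assumes "b < n" shows "(a * n + b) div n = a" "(a * n + b) mod n = b"
  using assms by simp_all

lemma kron_index_pair: "i < dim_row A \<Longrightarrow> k < dim_row B \<Longrightarrow> j < dim_col A \<Longrightarrow> l < dim_col B \<Longrightarrow>
   kron A B $$ (i * dim_row B + k, j * dim_col B + l) = A $$ (i,j) * B $$ (k,l)"
  by (simp add: kron_index pair_index_less)

lemma mat_eq_pairI:
  assumes "A \<in> carrier_mat (a*b) (c*d)" "B \<in> carrier_mat (a*b) (c*d)"
    and "\<And>i k j l. i < a \<Longrightarrow> k < b \<Longrightarrow> j < c \<Longrightarrow> l < d \<Longrightarrow>
      A $$ (i*b+k, j*d+l) = B $$ (i*b+k, j*d+l)"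
  shows "A = B"
proof (rule eq_matI)
  fix i j assume "i < dim_row B" "j < dim_col B"
  then have ij: "i < a*b" "j < c*d" using assms(1,2) by auto
  show "A $$ (i,j) = B $$ (i,j)"
    using assms(3)[OF less_mult_div_mod[OF ij(1)] less_mult_div_mod[OF ij(2)]] by simp
qed (use assms(1,2) in auto)

text \<open>The inner index of the product runs over pairs, and the double sum splits into a product
  of two sums.\<close>

lemma kron_mult:
  assumes "dim_col A = dim_row C" "dim_col B = dim_row D"
  shows "kron A B * kron C D = kron (A * C) (B * D)"
proof (rule mat_eq_pairI[of _ "dim_row A" "dim_row B" "dim_col C" "dim_col D"])
  fix i k j l assume h: "i < dim_row A" "k < dim_row B" "j < dim_col C" "l < dim_col D"
  have "(kron A B * kron C D) $$ (i * dim_row B + k, j * dim_col D + l) =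
     (\<Sum>e<dim_col A. \<Sum>f<dim_col B. kron A B $$ (i * dim_row B + k, e * dim_col B + f) *
        kron C D $$ (e * dim_col B + f, j * dim_col D + l))"
    using h assms by (simp add: index_mult_sum pair_index_less sum_prod_nat del: index_mult_mat(1))
  also have "\<dots> = (\<Sum>e<dim_col A. \<Sum>f<dim_col B. (A $$ (i,e) * C $$ (e,j)) * (B $$ (k,f) * D $$ (f,l)))"
  proof (intro sum.cong refl)
    fix e f assume "e \<in> {..<dim_col A}" "f \<in> {..<dim_col B}"
    then show "kron A B $$ (i * dim_row B + k, e * dim_col B + f) *
        kron C D $$ (e * dim_col B + f, j * dim_col D + l) = (A $$ (i,e) * C $$ (e,j)) * (B $$ (k,f) * D $$ (f,l))"
      using h assms kron_index_pair[of i A k B e f] kron_index_pair[of e C f D j l] by simp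
  qed
  also have "\<dots> = (A * C) $$ (i,j) * (B * D) $$ (k,l)"
    using h assms by (simp add: index_mult_sum sum_product del: index_mult_mat(1))
  also have "\<dots> = kron (A * C) (B * D) $$ (i * dim_row B + k, j * dim_col D + l)"
    using h kron_index_pair[of i "A*C" k "B*D" j l] by simp
  finally show "(kron A B * kron C D) $$ (i * dim_row B + k, j * dim_col D + l) =
      kron (A * C) (B * D) $$ (i * dim_row B + k, j * dim_col D + l)" .
qed (auto intro!: carrier_matI)

lemma kron_one [simp]: "kron (1\<^sub>m m) (1\<^sub>m n) = 1\<^sub>m (m * n)"
proof (rule mat_eq_pairI[of _ m n m n])
  fix i k j l assume h: "i < m" "k < n" "j < m" "l < n"
  have "(i * n + k = j * n + l) = (i = j \<and> k = l)"
    by (metis h(2,4) add_cancel_right_left div_mult_self3 div_less nat_arith.rule0 mod_less mod_mult_self3 nat_neq_iff not_less_zero)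
  then show "kron (1\<^sub>m m) (1\<^sub>m n) $$ (i * n + k, j * n + l) = 1\<^sub>m (m * n) $$ (i * n + k, j * n + l)"
    using h kron_index_pair[of i "1\<^sub>m m" k "1\<^sub>m n :: complex mat" j l] by (auto simp: pair_index_less)
qed (auto intro!: carrier_matI)

lemma adj_kron: "adj (kron A B) = kron (adj A) (adj B)"
proof (rule mat_eq_pairI[of _ "dim_col A" "dim_col B" "dim_row A" "dim_row B"])
  fix i k j l assume h: "i < dim_col A" "k < dim_col B" "j < dim_row A" "l < dim_row B"
  have "adj (kron A B) $$ (i * dim_col B + k, j * dim_row B + l)
      = cnj (kron A B $$ (j * dim_row B + l, i * dim_col B + k))"
    by (rule adj_index) (simp_all add: h pair_index_less)
  also have "\<dots> = adj A $$ (i,j) * adj B $$ (k,l)"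
    unfolding kron_index_pair[OF h(3,4,1,2)] using h by simp
  also have "\<dots> = kron (adj A) (adj B) $$ (i * dim_col B + k, j * dim_row B + l)"
    using kron_index_pair[of i "adj A" k "adj B" j l, unfolded adj_dim, OF h] by (rule sym)
  finally show "adj (kron A B) $$ (i * dim_col B + k, j * dim_row B + l) =
      kron (adj A) (adj B) $$ (i * dim_col B + k, j * dim_row B + l)" .
qed (auto intro!: carrier_matI)

text \<open>The three mixed-radix digits of an index on a threefold product do not depend on the
  bracketing; this is the content of \<open>kron_assoc\<close>.\<close>

lemma div_mod_triple:
  fixes i b c :: nat assumes "0 < c"
  shows "i div (b * c) = i div c div b" "i mod (b * c) div c = i div c mod b" "i mod (b * c) mod c = i mod c"
proof -
  show "i div (b * c) = i div c div b" by (metis div_mult2_eq mult.commute)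
  have "i mod (b * c) = c * (i div c mod b) + i mod c" by (metis mod_mult2_eq mult.commute)
  then show "i mod (b * c) div c = i div c mod b" "i mod (b * c) mod c = i mod c"
    using assms by auto
qed

lemma kron_assoc: "kron (kron A B) C = kron A (kron B C)"
proof (rule eq_matI)
  fix i j assume "i < dim_row (kron A (kron B C))" "j < dim_col (kron A (kron B C))"
  then have ij: "i < dim_row A * (dim_row B * dim_row C)" "j < dim_col A * (dim_col B * dim_col C)"
    by (auto simp: algebra_simps)
  then have ij': "i < dim_row A * dim_row B * dim_row C" "j < dim_col A * dim_col B * dim_col C"
    by (auto simp: mult.assoc)
  have pos: "0 < dim_row C" "0 < dim_col C" using ij by (auto intro: gr0I)
  show "kron (kron A B) C $$ (i,j) = kron A (kron B C) $$ (i,j)"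
    using ij ij' less_mult_div_mod[OF ij'(1)] less_mult_div_mod[OF ij'(2)]
      less_mult_div_mod[OF ij(1)] less_mult_div_mod[OF ij(2)]
    by (simp add: kron_index div_mod_triple[OF pos(1)] div_mod_triple[OF pos(2)])
qed (auto simp: mult.assoc)

lemma kron_add_left: "dim_row A = dim_row B \<Longrightarrow> dim_col A = dim_col B \<Longrightarrow>
  kron (A + B) C = kron A C + kron B C"
  by (rule eq_matI) (auto simp: kron_index less_mult_div_mod algebra_simps)

lemma kron_add_right: "dim_row A = dim_row B \<Longrightarrow> dim_col A = dim_col B \<Longrightarrow>
  kron C (A + B) = kron C A + kron C B"
  by (rule eq_matI) (auto simp: kron_index less_mult_div_mod(1) less_mult_div_mod(2)[of _ "dim_row C"]
      less_mult_div_mod(2)[of _ "dim_col C"] algebra_simps)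

lemma kron_smult_left: "kron (c \<cdot>\<^sub>m A) C = c \<cdot>\<^sub>m kron A C"
  by (rule eq_matI) (auto simp: kron_index less_mult_div_mod)

lemma kron_smult_right: "kron C (c \<cdot>\<^sub>m A) = c \<cdot>\<^sub>m kron C A"
  by (rule eq_matI) (auto simp: kron_index less_mult_div_mod(1) less_mult_div_mod(2)[of _ "dim_row C"]
      less_mult_div_mod(2)[of _ "dim_col C"])

lemma mtrace_mult: "dim_col A = dim_row B \<Longrightarrow> dim_col B = dim_row A \<Longrightarrow>
   mtrace (A * B) = (\<Sum>i<dim_row A. \<Sum>k<dim_col A. A $$ (i,k) * B $$ (k,i))"
  by (auto simp: mtrace_def index_mult_sum simp del: index_mult_mat(1) intro!: sum.cong)

lemma mtrace_comm: "dim_col A = dim_row B \<Longrightarrow> dim_col B = dim_row A \<Longrightarrow>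
   mtrace (A * B) = mtrace (B * A)"
  by (simp add: mtrace_mult mult.commute sum.swap[of _ "{..<dim_row A}"])

lemma mtrace_add: "A \<in> carrier_mat n n \<Longrightarrow> B \<in> carrier_mat n n \<Longrightarrow> mtrace (A + B) = mtrace A + mtrace B"
  by (auto simp: mtrace_def sum.distrib)

lemma mtrace_minus: "A \<in> carrier_mat n n \<Longrightarrow> B \<in> carrier_mat n n \<Longrightarrow> mtrace (A - B) = mtrace A - mtrace B"
  by (auto simp: mtrace_def sum_subtractf)

lemma mtrace_smult: "A \<in> carrier_mat n n \<Longrightarrow> mtrace (c \<cdot>\<^sub>m A) = c * mtrace A"
  by (auto simp: mtrace_def sum_distrib_left)

section \<open>Trace pairing and partial traces\<close>

definition unit_mat :: "nat \<Rightarrow> nat \<Rightarrow> nat \<Rightarrow> complex mat" where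
  "unit_mat n i j = mat n n (\<lambda>(a,b). if a = i \<and> b = j then 1 else 0)"

lemma unit_mat_dim [simp]: "dim_row (unit_mat n i j) = n" "dim_col (unit_mat n i j) = n"
  by (auto simp: unit_mat_def)

lemma mtrace_mult_unit:
  assumes "M \<in> carrier_mat n n" "i < n" "j < n" shows "mtrace (M * unit_mat n j i) = M $$ (i,j)"
proof -
  have "mtrace (M * unit_mat n j i) = (\<Sum>a<n. \<Sum>b<n. M $$ (a,b) * (if b = j \<and> a = i then 1 else 0))"
    using assms by (simp add: mtrace_mult unit_mat_def)
  also have "\<dots> = (\<Sum>a<n. \<Sum>b<n. if b = j then (if a = i then M $$ (a,b) else 0) else 0)"
    by (intro sum.cong) auto
  also have "\<dots> = M $$ (i,j)" using assms by simp
  finally show ?thesis .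
qed

text \<open>Matrix units detect every entry, so the trace pairing is nondegenerate. Identities
  between partial traces can therefore be proved by duality.\<close>

lemma mat_eq_by_trace:
  assumes "M \<in> carrier_mat m m" "M' \<in> carrier_mat m m"
    and "\<And>A. A \<in> carrier_mat m m \<Longrightarrow> mtrace (M * A) = mtrace (M' * A)"
  shows "M = M'"
proof (rule eq_matI)
  fix i j assume "i < dim_row M'" "j < dim_col M'"
  then have ij: "i < m" "j < m" using assms(2) by auto
  have "unit_mat m j i \<in> carrier_mat m m" by (auto intro!: carrier_matI)
  from assms(3)[OF this] show "M $$ (i,j) = M' $$ (i,j)"
    unfolding mtrace_mult_unit[OF assms(1) ij] mtrace_mult_unit[OF assms(2) ij] .
qed (use assms(1,2) in auto)

text \<open>\<open>ptrR\<close> traces out the right factor, so it is a matrix on the left one; \<open>ptrL\<close> is its mirror image.\<close>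

definition ptrR :: "nat \<Rightarrow> nat \<Rightarrow> complex mat \<Rightarrow> complex mat" where
  "ptrR m n X = mat m m (\<lambda>(i,j). \<Sum>k<n. X $$ (i*n+k, j*n+k))"

definition ptrL :: "nat \<Rightarrow> nat \<Rightarrow> complex mat \<Rightarrow> complex mat" where
  "ptrL m n X = mat n n (\<lambda>(i,j). \<Sum>k<m. X $$ (k*n+i, k*n+j))"

lemma ptr_dim [simp]: "dim_row (ptrR m n X) = m" "dim_col (ptrR m n X) = m"
  "dim_row (ptrL m n X) = n" "dim_col (ptrL m n X) = n"
  by (auto simp: ptrR_def ptrL_def)

lemma ptr_carrier [simp]: "ptrR m n X \<in> carrier_mat m m" "ptrL m n X \<in> carrier_mat n n"
  by (auto intro!: carrier_matI)

text \<open>The characteristic property of the partial trace, as the adjoint of tensoring with the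
  identity; the sandwich rules follow from it by cyclicity.\<close>

lemma mtrace_ptrR_mult:
  assumes X: "X \<in> carrier_mat (m*n) (m*n)" and A: "A \<in> carrier_mat m m"
  shows "mtrace (ptrR m n X * A) = mtrace (X * kron A (1\<^sub>m n))"
proof -
  have "mtrace (X * kron A (1\<^sub>m n)) =
    (\<Sum>i<m. \<Sum>k<n. \<Sum>j<m. \<Sum>l<n. X $$ (i*n+k, j*n+l) * (A $$ (j,i) * 1\<^sub>m n $$ (l,k)))"
    using X A kron_index_pair[of _ A _ "1\<^sub>m n"]
    by (auto simp: mtrace_mult sum_prod_nat intro!: sum.cong)
  also have "\<dots> = (\<Sum>i<m. \<Sum>k<n. \<Sum>j<m. \<Sum>l<n. if l = k then X $$ (i*n+k, j*n+l) * A $$ (j,i) else 0)"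
    by (intro sum.cong) auto
  also have "\<dots> = (\<Sum>i<m. \<Sum>k<n. \<Sum>j<m. X $$ (i*n+k, j*n+k) * A $$ (j,i))"
    by simp
  also have "\<dots> = (\<Sum>i<m. \<Sum>j<m. \<Sum>k<n. X $$ (i*n+k, j*n+k) * A $$ (j,i))"
    by (intro sum.cong refl sum.swap)
  also have "\<dots> = mtrace (ptrR m n X * A)"
    using A by (auto simp: mtrace_mult ptrR_def sum_distrib_right intro!: sum.cong)
  finally show ?thesis by simp
qed

lemma mtrace_ptrL_mult:
  assumes X: "X \<in> carrier_mat (m*n) (m*n)" and A: "A \<in> carrier_mat n n"
  shows "mtrace (ptrL m n X * A) = mtrace (X * kron (1\<^sub>m m) A)"
proof -
  have "mtrace (X * kron (1\<^sub>m m) A) =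
    (\<Sum>i<m. \<Sum>k<n. \<Sum>j<m. \<Sum>l<n. X $$ (i*n+k, j*n+l) * (1\<^sub>m m $$ (j,i) * A $$ (l,k)))"
    using X A kron_index_pair[of _ "1\<^sub>m m" _ A]
    by (auto simp: mtrace_mult sum_prod_nat intro!: sum.cong)
  also have "\<dots> = (\<Sum>i<m. \<Sum>k<n. \<Sum>j<m. if j = i then \<Sum>l<n. X $$ (i*n+k, j*n+l) * A $$ (l,k) else 0)"
    by (intro sum.cong) auto
  also have "\<dots> = (\<Sum>i<m. \<Sum>k<n. \<Sum>l<n. X $$ (i*n+k, i*n+l) * A $$ (l,k))"
    by simp
  also have "\<dots> = (\<Sum>k<n. \<Sum>i<m. \<Sum>l<n. X $$ (i*n+k, i*n+l) * A $$ (l,k))"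
    by (rule sum.swap)
  also have "\<dots> = (\<Sum>k<n. \<Sum>l<n. \<Sum>i<m. X $$ (i*n+k, i*n+l) * A $$ (l,k))"
    by (intro sum.cong refl sum.swap)
  also have "\<dots> = mtrace (ptrL m n X * A)"
    using A by (auto simp: mtrace_mult ptrL_def sum_distrib_right intro!: sum.cong)
  finally show ?thesis by simp
qed

lemma mtrace_ptr:
  assumes X: "X \<in> carrier_mat (m*n) (m*n)"
  shows "mtrace (ptrR m n X) = mtrace X" "mtrace (ptrL m n X) = mtrace X"
  using mtrace_ptrR_mult[OF X, of "1\<^sub>m m"] mtrace_ptrL_mult[OF X, of "1\<^sub>m n"] X by auto

text \<open>By duality and cyclicity, an operator on the factor that is traced out survives only
  through \<open>adj T * T\<close>; an isometry there disappears.\<close>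

lemma ptrR_sandwich:
  assumes X: "X \<in> carrier_mat (m*n) (m*n)" and S: "S \<in> carrier_mat m' m" and T: "T \<in> carrier_mat n' n"
  shows "ptrR m' n' (kron S T * X * adj (kron S T)) =
    S * ptrR m n (X * kron (1\<^sub>m m) (adj T * T)) * adj S"
proof (rule mat_eq_by_trace[of _ m'])
  fix A :: "complex mat" assume A: "A \<in> carrier_mat m' m'"
  note d [simp] = carrier_matD[OF X] carrier_matD[OF S] carrier_matD[OF T] carrier_matD[OF A]
  have "mtrace (ptrR m' n' (kron S T * X * adj (kron S T)) * A) =
    mtrace (kron S T * X * adj (kron S T) * kron A (1\<^sub>m n'))"
    using A by (intro mtrace_ptrR_mult) (auto intro!: carrier_matI)
  also have "\<dots> = mtrace (kron S T * (X * adj (kron S T) * kron A (1\<^sub>m n')))"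
    by (simp add: mult_assoc_dim)
  also have "\<dots> = mtrace ((X * adj (kron S T) * kron A (1\<^sub>m n')) * kron S T)"
    by (intro mtrace_comm) auto
  also have "(X * adj (kron S T) * kron A (1\<^sub>m n')) * kron S T = X * kron (adj S * A * S) (adj T * T)"
    by (simp add: mult_assoc_dim adj_kron kron_mult)
  also have "\<dots> = X * kron (1\<^sub>m m) (adj T * T) * kron (adj S * A * S) (1\<^sub>m n)"
    by (simp add: mult_assoc_dim kron_mult)
  also have "mtrace \<dots> = mtrace (ptrR m n (X * kron (1\<^sub>m m) (adj T * T)) * (adj S * A * S))"
    by (intro mtrace_ptrR_mult[symmetric]) (auto intro!: carrier_matI)
  also have "\<dots> = mtrace ((ptrR m n (X * kron (1\<^sub>m m) (adj T * T)) * (adj S * A)) * S)"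
    by (simp add: mult_assoc_dim)
  also have "\<dots> = mtrace (S * (ptrR m n (X * kron (1\<^sub>m m) (adj T * T)) * (adj S * A)))"
    by (intro mtrace_comm) auto
  also have "\<dots> = mtrace (S * ptrR m n (X * kron (1\<^sub>m m) (adj T * T)) * adj S * A)"
    by (simp add: mult_assoc_dim)
  finally show "mtrace (ptrR m' n' (kron S T * X * adj (kron S T)) * A) = \<dots>" .
qed (use S in \<open>auto intro!: carrier_matI\<close>)

lemma ptrL_sandwich:
  assumes X: "X \<in> carrier_mat (m*n) (m*n)" and S: "S \<in> carrier_mat m' m" and T: "T \<in> carrier_mat n' n"
  shows "ptrL m' n' (kron S T * X * adj (kron S T)) =
    T * ptrL m n (X * kron (adj S * S) (1\<^sub>m n)) * adj T"
proof (rule mat_eq_by_trace[of _ n'])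
  fix A :: "complex mat" assume A: "A \<in> carrier_mat n' n'"
  note d [simp] = carrier_matD[OF X] carrier_matD[OF S] carrier_matD[OF T] carrier_matD[OF A]
  have "mtrace (ptrL m' n' (kron S T * X * adj (kron S T)) * A) =
    mtrace (kron S T * X * adj (kron S T) * kron (1\<^sub>m m') A)"
    using A by (intro mtrace_ptrL_mult) (auto intro!: carrier_matI)
  also have "\<dots> = mtrace (kron S T * (X * adj (kron S T) * kron (1\<^sub>m m') A))"
    by (simp add: mult_assoc_dim)
  also have "\<dots> = mtrace ((X * adj (kron S T) * kron (1\<^sub>m m') A) * kron S T)"
    by (intro mtrace_comm) auto
  also have "(X * adj (kron S T) * kron (1\<^sub>m m') A) * kron S T = X * kron (adj S * S) (adj T * A * T)"
    by (simp add: mult_assoc_dim adj_kron kron_mult)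
  also have "\<dots> = X * kron (adj S * S) (1\<^sub>m n) * kron (1\<^sub>m m) (adj T * A * T)"
    by (simp add: mult_assoc_dim kron_mult)
  also have "mtrace \<dots> = mtrace (ptrL m n (X * kron (adj S * S) (1\<^sub>m n)) * (adj T * A * T))"
    by (intro mtrace_ptrL_mult[symmetric]) (auto intro!: carrier_matI)
  also have "\<dots> = mtrace ((ptrL m n (X * kron (adj S * S) (1\<^sub>m n)) * (adj T * A)) * T)"
    by (simp add: mult_assoc_dim)
  also have "\<dots> = mtrace (T * (ptrL m n (X * kron (adj S * S) (1\<^sub>m n)) * (adj T * A)))"
    by (intro mtrace_comm) auto
  also have "\<dots> = mtrace (T * ptrL m n (X * kron (adj S * S) (1\<^sub>m n)) * adj T * A)"
    by (simp add: mult_assoc_dim)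
  finally show "mtrace (ptrL m' n' (kron S T * X * adj (kron S T)) * A) = \<dots>" .
qed (use T in \<open>auto intro!: carrier_matI\<close>)

lemma ptrR_add:
  assumes "X \<in> carrier_mat (m*n) (m*n)" "Y \<in> carrier_mat (m*n) (m*n)"
  shows "ptrR m n (X + Y) = ptrR m n X + ptrR m n Y"
  using assms by (intro eq_matI) (auto simp: ptrR_def sum.distrib pair_index_less)

lemma ptrL_add:
  assumes "X \<in> carrier_mat (m*n) (m*n)" "Y \<in> carrier_mat (m*n) (m*n)"
  shows "ptrL m n (X + Y) = ptrL m n X + ptrL m n Y"
  using assms by (intro eq_matI) (auto simp: ptrL_def sum.distrib pair_index_less)

lemma ptrR_smult:
  assumes "X \<in> carrier_mat (m*n) (m*n)"
  shows "ptrR m n (c \<cdot>\<^sub>m X) = c \<cdot>\<^sub>m ptrR m n X"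
  using assms by (intro eq_matI) (auto simp: ptrR_def sum_distrib_left pair_index_less)

lemma ptrL_smult:
  assumes "X \<in> carrier_mat (m*n) (m*n)"
  shows "ptrL m n (c \<cdot>\<^sub>m X) = c \<cdot>\<^sub>m ptrL m n X"
  using assms by (intro eq_matI) (auto simp: ptrL_def sum_distrib_left pair_index_less)

section \<open>Spectral theorem and functional calculus\<close>

lemma rdiag_dim [simp]: "dim_row (rdiag n d) = n" "dim_col (rdiag n d) = n"
  by (auto simp: rdiag_def)

lemma rdiag_carrier [simp]: "rdiag n d \<in> carrier_mat n n"
  by (auto intro!: carrier_matI)

lemma rdiag_index: "i < n \<Longrightarrow> j < n \<Longrightarrow> rdiag n d $$ (i,j) = (if i = j then complex_of_real (d i) else 0)"
  by (simp add: rdiag_def)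

lemma mult_rdiag_index:
  "i < dim_row A \<Longrightarrow> j < n \<Longrightarrow> dim_col A = n \<Longrightarrow> (A * rdiag n d) $$ (i,j) = A $$ (i,j) * d j"
  by (simp add: index_mult_sum rdiag_index if_distrib[of "\<lambda>x. _ * x"] del: index_mult_mat(1) cong: if_cong)

lemma rdiag_mult_index:
  "i < n \<Longrightarrow> j < dim_col A \<Longrightarrow> dim_row A = n \<Longrightarrow> (rdiag n d * A) $$ (i,j) = d i * A $$ (i,j)"
  by (simp add: index_mult_sum rdiag_index if_distrib[of "\<lambda>x. x * _"] del: index_mult_mat(1) cong: if_cong)

lemma adj_rdiag [simp]: "adj (rdiag n d) = rdiag n d"
  by (rule eq_matI) (auto simp: rdiag_index)

lemma rdiag_mult_rdiag: "rdiag n d * rdiag n e = rdiag n (\<lambda>i. d i * e i)"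
  by (rule eq_matI) (auto simp: mult_rdiag_index rdiag_index simp del: index_mult_mat(1))

lemma mtrace_rdiag: "mtrace (rdiag n d) = complex_of_real (\<Sum>i<n. d i)"
  by (simp add: mtrace_def rdiag_index)

lemma isometryD:
  assumes "isometry m n V"
  shows "dim_row V = n" "dim_col V = m" "adj V * V = 1\<^sub>m m" "V \<in> carrier_mat n m"
  using assms by (auto simp: isometry_def)

lemma unitaryD:
  assumes "unitary_m n U"
  shows "dim_row U = n" "dim_col U = n" "adj U * U = 1\<^sub>m n" "U * adj U = 1\<^sub>m n"
proof -
  have U: "U \<in> carrier_mat n n" "adj U * U = 1\<^sub>m n"
    using assms by (auto simp: unitary_m_def isometry_def)
  then show "dim_row U = n" "dim_col U = n" "adj U * U = 1\<^sub>m n" by auto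
  show "U * adj U = 1\<^sub>m n"
    using mat_mult_left_right_inverse[of "adj U" n U] U by simp
qed

lemma mult_adj_cancel:
  assumes "adj V * V = 1\<^sub>m m" "dim_col V = m" "dim_row X = m"
  shows "adj V * (V * X) = X"
  by (subst mult_assoc_dim[symmetric]) (use assms in auto)

lemma mult_adj_cancel':
  assumes "U * adj U = 1\<^sub>m n" "dim_row U = n" "dim_row X = n"
  shows "U * (adj U * X) = X"
  by (subst mult_assoc_dim[symmetric]) (use assms in auto)

lemma unitary_m_mult:
  assumes "unitary_m n U" "unitary_m n V" shows "unitary_m n (U * V)"
  using unitaryD[OF assms(1)] unitaryD[OF assms(2)]
  by (auto simp: unitary_m_def isometry_def adj_mult mult_assoc_dim mult_adj_cancel intro!: carrier_matI)

section \<open>Spectral theorem by induction on the dimension\<close>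

definition scalar_block :: "complex \<Rightarrow> complex mat \<Rightarrow> complex mat" where
  "scalar_block a X = mat (Suc (dim_row X)) (Suc (dim_col X))
     (\<lambda>(i,j). if i = 0 \<and> j = 0 then a else if i = 0 \<or> j = 0 then 0 else X $$ (i - 1, j - 1))"

lemma scalar_block_dim [simp]:
  "dim_row (scalar_block a X) = Suc (dim_row X)" "dim_col (scalar_block a X) = Suc (dim_col X)"
  by (auto simp: scalar_block_def)

lemma scalar_block_index [simp]:
  "scalar_block a X $$ (0, 0) = a"
  "j < dim_col X \<Longrightarrow> scalar_block a X $$ (0, Suc j) = 0"
  "i < dim_row X \<Longrightarrow> scalar_block a X $$ (Suc i, 0) = 0"
  "i < dim_row X \<Longrightarrow> j < dim_col X \<Longrightarrow> scalar_block a X $$ (Suc i, Suc j) = X $$ (i,j)"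
  by (auto simp: scalar_block_def)

lemma mat_eq_SucI:
  assumes "dim_row A = Suc m" "dim_col A = Suc n" "dim_row B = Suc m" "dim_col B = Suc n"
    and "A $$ (0,0) = B $$ (0,0)"
    and "\<And>j. j < n \<Longrightarrow> A $$ (0, Suc j) = B $$ (0, Suc j)"
    and "\<And>i. i < m \<Longrightarrow> A $$ (Suc i, 0) = B $$ (Suc i, 0)"
    and "\<And>i j. i < m \<Longrightarrow> j < n \<Longrightarrow> A $$ (Suc i, Suc j) = B $$ (Suc i, Suc j)"
  shows "A = B"
proof (rule eq_matI)
  fix i j assume "i < dim_row B" "j < dim_col B"
  then show "A $$ (i,j) = B $$ (i,j)"
    using assms(3-8) by (cases i; cases j) auto
qed (use assms(1-4) in auto)

lemma scalar_block_mult: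
  "dim_col X = dim_row Y \<Longrightarrow> scalar_block a X * scalar_block b Y = scalar_block (a * b) (X * Y)"
  by (rule mat_eq_SucI[of _ "dim_row X" "dim_col Y"])
    (auto simp: index_mult_sum sum.lessThan_Suc_shift simp del: index_mult_mat(1) sum.lessThan_Suc)

lemma adj_scalar_block: "adj (scalar_block a X) = scalar_block (cnj a) (adj X)"
  by (rule mat_eq_SucI[of _ "dim_col X" "dim_row X"]) auto

lemma scalar_block_one: "scalar_block 1 (1\<^sub>m n) = 1\<^sub>m (Suc n)"
  by (rule mat_eq_SucI[of _ n n]) auto

lemma rdiag_Suc: "rdiag (Suc n) d = scalar_block (d 0) (rdiag n (\<lambda>i. d (Suc i)))"
  by (rule mat_eq_SucI[of _ n n]) (auto simp: rdiag_index)

text \<open>The reflection that maps the first basis vector to \<open>- v\<close>; since the first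
  coordinate of \<open>v\<close> is real and nonnegative, the denominator cannot vanish.\<close>

lemma householder:
  fixes v :: "nat \<Rightarrow> complex" and r :: real
  assumes norm: "(\<Sum>i<Suc n. cnj (v i) * v i) = 1" and v0: "v 0 = complex_of_real r" "0 \<le> r"
  obtains H where "unitary_m (Suc n) H" "adj H = H" "\<And>i. i < Suc n \<Longrightarrow> H $$ (i,0) = - v i"
proof -
  define w where "w i = v i + (if i = 0 then 1 else 0)" for i
  define e where "e = 1 / (1 + complex_of_real r)"
  define H where "H = mat (Suc n) (Suc n) (\<lambda>(i,j). (if i = j then 1 else 0) - w i * cnj (w j) * e)"
  have r1: "1 + complex_of_real r \<noteq> 0"
    using v0(2) of_real_eq_0_iff[of "1 + r", where 'a=complex] by auto
  then have e: "e * (1 + complex_of_real r) = 1" by (simp add: e_def)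
  have [simp]: "cnj e = e" by (simp add: e_def)
  have ww: "(\<Sum>k<Suc n. cnj (w k) * w k) = 2 * (1 + complex_of_real r)"
    using norm v0 by (simp add: sum.lessThan_Suc_shift w_def algebra_simps del: sum.lessThan_Suc)
  have adjH: "adj H = H"
    by (rule eq_matI) (auto simp: H_def mult.commute)
  have HH: "H * H = 1\<^sub>m (Suc n)"
  proof (rule eq_matI)
    fix i j assume ij: "i < dim_row (1\<^sub>m (Suc n))" "j < dim_col (1\<^sub>m (Suc n))"
    let ?\<delta> = "\<lambda>a b::nat. (if a = b then 1 else 0) :: complex"
    have "(H * H) $$ (i,j) = (\<Sum>k<Suc n. (?\<delta> i k - w i * cnj (w k) * e) * (?\<delta> k j - w k * cnj (w j) * e))"
      using ij by (subst index_mult_sum) (auto simp: H_def simp del: sum.lessThan_Suc intro!: sum.cong)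
    also have "\<dots> = (\<Sum>k<Suc n. ?\<delta> i k * ?\<delta> k j - ?\<delta> i k * (w k * cnj (w j) * e)
        - ?\<delta> k j * (w i * cnj (w k) * e) + (w i * cnj (w j) * e * e) * (cnj (w k) * w k))"
      by (intro sum.cong refl) (simp add: algebra_simps)
    also have "\<dots> = (\<Sum>k<Suc n. ?\<delta> i k * ?\<delta> k j) - (\<Sum>k<Suc n. ?\<delta> i k * (w k * cnj (w j) * e))
        - (\<Sum>k<Suc n. ?\<delta> k j * (w i * cnj (w k) * e)) + (w i * cnj (w j) * e * e) * (\<Sum>k<Suc n. cnj (w k) * w k)"
      by (simp only: sum.distrib sum_subtractf sum_distrib_left)
    also have "(\<Sum>k<Suc n. ?\<delta> i k * ?\<delta> k j) = ?\<delta> i j"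
      using ij by (simp add: if_distrib[of "\<lambda>x. x * _"] del: sum.lessThan_Suc cong: if_cong)
    also have "(\<Sum>k<Suc n. ?\<delta> i k * (w k * cnj (w j) * e)) = (\<Sum>k<Suc n. if i = k then w k * cnj (w j) * e else 0)"
      by (intro sum.cong) auto
    also have "\<dots> = w i * cnj (w j) * e"
      using ij by (simp del: sum.lessThan_Suc)
    also have "(\<Sum>k<Suc n. ?\<delta> k j * (w i * cnj (w k) * e)) = (\<Sum>k<Suc n. if k = j then w i * cnj (w k) * e else 0)"
      by (intro sum.cong) auto
    also have "\<dots> = w i * cnj (w j) * e"
      using ij by (simp del: sum.lessThan_Suc)
    also have "(w i * cnj (w j) * e * e) * (\<Sum>k<Suc n. cnj (w k) * w k) = 2 * (w i * cnj (w j) * e) * (e * (1 + complex_of_real r))"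
      unfolding ww by (simp add: algebra_simps)
    also have "?\<delta> i j - w i * cnj (w j) * e - w i * cnj (w j) * e
       + 2 * (w i * cnj (w j) * e) * (e * (1 + complex_of_real r)) = ?\<delta> i j"
      unfolding e by simp
    finally show "(H * H) $$ (i,j) = 1\<^sub>m (Suc n) $$ (i,j)" using ij by simp
  qed (auto simp: H_def)
  have "H $$ (i,0) = - v i" if "i < Suc n" for i
  proof -
    have "cnj (w 0) * e = 1" using e v0 by (simp add: w_def algebra_simps)
    then show ?thesis using that by (simp add: H_def mult.assoc) (simp add: w_def)
  qed
  moreover have "unitary_m (Suc n) H"
    unfolding unitary_m_def isometry_def adjH HH by (simp add: H_def)
  ultimately show thesis using that adjH by blast
qed

lemma hermitian_unit_eigenvector:
  assumes M: "M \<in> carrier_mat (Suc n) (Suc n)"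
  obtains v :: "nat \<Rightarrow> complex" and r :: real and c :: complex
  where "(\<Sum>i<Suc n. cnj (v i) * v i) = 1" "v 0 = complex_of_real r" "0 \<le> r"
    "\<And>i. i < Suc n \<Longrightarrow> (\<Sum>k<Suc n. M $$ (i,k) * v k) = c * v i"
proof -
  obtain c where "eigenvalue M c"
    using spectrum_non_empty[OF M] by (auto simp: spectrum_def)
  then obtain u where u: "u \<in> carrier_vec (Suc n)" "u \<noteq> 0\<^sub>v (Suc n)" "M *\<^sub>v u = c \<cdot>\<^sub>v u"
    using M by (auto simp: eigenvalue_def eigenvector_def)
  have Mu: "(\<Sum>k<Suc n. M $$ (i,k) * u $ k) = c * u $ i" if "i < Suc n" for i
    using arg_cong[OF u(3), of "\<lambda>x. x $ i"] that u(1) M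
    by (simp add: scalar_prod_def lessThan_atLeast0 del: sum.lessThan_Suc sum.op_ivl_Suc)
  define s where "s = (\<Sum>i<Suc n. (cmod (u $ i))\<^sup>2)"
  have "\<exists>i<Suc n. u $ i \<noteq> 0" using u(1,2) by (metis eq_vecI carrier_vecD index_zero_vec)
  then obtain i where i: "i < Suc n" "u $ i \<noteq> 0" by blast
  have "(cmod (u $ i))\<^sup>2 \<le> s" unfolding s_def by (rule member_le_sum) (use i in auto)
  then have s: "0 < s" using i by (smt (verit) norm_eq_zero zero_less_power2)
  \<comment> \<open>Multiplying by this phase makes the first coordinate real and nonnegative, as
    the reflection requires; if that coordinate is 0, every phase does.\<close>
  define ph where "ph = (if u $ 0 = 0 then 1 else cnj (u $ 0) / cmod (u $ 0))"
  define a where "a = ph / sqrt s"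
  have u0: "cnj (u $ 0) * u $ 0 = complex_of_real (cmod (u $ 0)) * complex_of_real (cmod (u $ 0))"
    using complex_norm_square[of "u $ 0"] by (simp add: power2_eq_square mult.commute)
  then have ph: "cnj ph * ph = 1"
    by (auto simp: ph_def mult.commute)
  define v where "v k = a * u $ k" for k
  show thesis
  proof (rule that[of v "cmod (u $ 0) / sqrt s" c])
    have "cnj (v k) * v k = complex_of_real ((cmod (u $ k))\<^sup>2 / s)" for k
    proof -
      have "cnj (v k) * v k = (cnj ph * ph) * (cnj (u $ k) * u $ k) / (complex_of_real (sqrt s) * sqrt s)"
        by (simp add: v_def a_def)
      also have "complex_of_real (sqrt s) * sqrt s = s"
        using s by (simp flip: of_real_mult)
      finally show ?thesis
        unfolding ph of_real_divide complex_norm_square by (simp add: mult.commute)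
    qed
    then have "(\<Sum>i<Suc n. cnj (v i) * v i) = complex_of_real (\<Sum>i<Suc n. (cmod (u $ i))\<^sup>2 / s)"
      by (simp only: of_real_sum)
    also have "(\<Sum>i<Suc n. (cmod (u $ i))\<^sup>2 / s) = 1"
      using s by (simp add: s_def flip: sum_divide_distrib)
    finally show "(\<Sum>i<Suc n. cnj (v i) * v i) = 1" by simp
    have "ph * u $ 0 = cmod (u $ 0)"
      using u0 by (auto simp: ph_def)
    then show "v 0 = complex_of_real (cmod (u $ 0) / sqrt s)" by (simp add: v_def a_def)
    show "0 \<le> cmod (u $ 0) / sqrt s" using s by simp
    show "(\<Sum>k<Suc n. M $$ (i,k) * v k) = c * v i" if "i < Suc n" for i
      using Mu[OF that] by (simp add: v_def sum_distrib_left[symmetric] mult.left_commute[of _ a] del: sum.lessThan_Suc)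
  qed
qed

text \<open>Deflation: conjugating by a reflection whose first column is an eigenvector puts the
  eigenvalue \<open>c\<close> in the corner with zeros below it. Hermiticity clears the first row
  too, and the remaining block is smaller and Hermitian.\<close>

lemma spectral:
  assumes "M \<in> carrier_mat n n" "adj M = M"
  obtains U d where "unitary_m n U" "M = U * rdiag n d * adj U"
proof -
  have "\<exists>U d. unitary_m n U \<and> M = U * rdiag n d * adj U"
    using assms
  proof (induction n arbitrary: M)
    case 0
    show ?case
    proof (intro exI conjI)
      show "unitary_m 0 (1\<^sub>m 0)" by (auto simp: unitary_m_def isometry_def)
      show "M = 1\<^sub>m 0 * rdiag 0 (\<lambda>_. 0) * adj (1\<^sub>m 0)"
        by (rule eq_matI) (use carrier_matD[OF 0(1)] in auto)
    qed
  next
    case (Suc n)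
    note dM [simp] = carrier_matD[OF Suc.prems(1)]
    obtain v r c where v: "(\<Sum>i<Suc n. cnj (v i) * v i) = 1" "v 0 = complex_of_real r" "0 \<le> r"
      and Mv: "\<And>i. i < Suc n \<Longrightarrow> (\<Sum>k<Suc n. M $$ (i,k) * v k) = c * v i"
      by (rule hermitian_unit_eigenvector[OF Suc.prems(1)], rule that)
    obtain H where H: "unitary_m (Suc n) H" "adj H = H" and H0: "\<And>i. i < Suc n \<Longrightarrow> H $$ (i,0) = - v i"
      by (rule householder[OF v], rule that)
    have dH [simp]: "dim_row H = Suc n" "dim_col H = Suc n" and HH: "H * H = 1\<^sub>m (Suc n)"
      using unitaryD[OF H(1)] H(2) by auto
    define M' where "M' = H * M * H"
    have dM' [simp]: "dim_row M' = Suc n" "dim_col M' = Suc n" by (auto simp: M'_def)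
    have herm: "adj M' = M'"
      by (simp add: M'_def adj_mult mult_assoc_dim H(2) Suc.prems(2))
    have MH: "(M * H) $$ (k,0) = c * H $$ (k,0)" if "k < Suc n" for k
      using that Mv[OF that] H0
      by (simp add: index_mult_sum sum_negf del: sum.lessThan_Suc index_mult_mat(1))
    have M'0: "M' $$ (i,0) = (if i = 0 then c else 0)" if "i < Suc n" for i
    proof -
      have "M' $$ (i,0) = (H * (M * H)) $$ (i,0)" by (simp add: M'_def mult_assoc_dim)
      also have "\<dots> = (\<Sum>k<Suc n. H $$ (i,k) * (c * H $$ (k,0)))"
        using that MH by (subst index_mult_sum) (auto intro!: sum.cong simp del: sum.lessThan_Suc index_mult_mat(1))
      also have "\<dots> = c * (H * H) $$ (i,0)"
        using that by (subst index_mult_sum) (auto simp: sum_distrib_left mult.left_commute simp del: sum.lessThan_Suc)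
      finally show ?thesis using that by (simp add: HH)
    qed
    have M'0': "M' $$ (0,i) = cnj (M' $$ (i,0))" if "i < Suc n" for i
      using that arg_cong[OF herm, of "\<lambda>X. X $$ (0,i)"] by simp
    \<comment> \<open>Hermiticity makes the corner entry equal to its conjugate;
      \<open>rdiag\<close> admits only real eigenvalues.\<close>
    have c: "c = complex_of_real (Re c)"
      using M'0'[of 0] M'0[of 0] by (simp add: complex_eq_iff)
    define N where "N = mat n n (\<lambda>(i,j). M' $$ (Suc i, Suc j))"
    have "adj N = N"
    proof (rule eq_matI)
      fix i j assume "i < dim_row N" "j < dim_col N"
      then show "adj N $$ (i,j) = N $$ (i,j)"
        using arg_cong[OF herm, of "\<lambda>X. X $$ (Suc i, Suc j)"] by (simp add: N_def)
    qed (auto simp: N_def)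
    with Suc.IH[of N] obtain U d where U: "unitary_m n U" and N: "N = U * rdiag n d * adj U"
      by (auto simp: N_def)
    note dU [simp] = unitaryD(1,2)[OF U]
    have M': "M' = scalar_block c N"
      by (rule mat_eq_SucI[of _ n n]) (use M'0 M'0'[of "Suc _"] in \<open>auto simp: N_def\<close>)
    define P where "P = scalar_block 1 U"
    have dP [simp]: "dim_row P = Suc n" "dim_col P = Suc n" by (auto simp: P_def)
    have P: "unitary_m (Suc n) P"
      using unitaryD[OF U]
      by (auto simp: P_def unitary_m_def isometry_def adj_scalar_block scalar_block_mult scalar_block_one intro!: carrier_matI)
    have "M' = P * rdiag (Suc n) (case_nat (Re c) d) * adj P"
      unfolding M' P_def rdiag_Suc N by (simp add: adj_scalar_block scalar_block_mult flip: c)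
    moreover have "M = H * M' * H"
    proof -
      have "H * (H * (M * (H * H))) = M"
        using mult_adj_cancel[of H "Suc n" M] H(2) HH by (simp add: mult_assoc_dim)
      then show ?thesis by (simp add: M'_def mult_assoc_dim)
    qed
    ultimately have "M = (H * P) * rdiag (Suc n) (case_nat (Re c) d) * adj (H * P)"
      by (simp add: adj_mult H(2) mult_assoc_dim)
    then show ?case using unitary_m_mult[OF H(1) P] by blast
  qed
  then show thesis using that by blast
qed

text \<open>Entrywise, \<open>d i * W $$ (i,j) = W $$ (i,j) * e j\<close>: an entry of
  \<open>W\<close> can be nonzero only where the two eigenvalues agree, and there their images under
  \<open>f\<close> agree too.\<close>

lemma rdiag_intertwine:
  assumes "dim_row W = n" "dim_col W = m" "rdiag n d * W = W * rdiag m e"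
  shows "rdiag n (f \<circ> d) * W = W * rdiag m (f \<circ> e)"
proof (rule eq_matI)
  fix i j assume "i < dim_row (W * rdiag m (f \<circ> e))" "j < dim_col (W * rdiag m (f \<circ> e))"
  then have ij: "i < n" "j < m" using assms by auto
  have "complex_of_real (d i) * W $$ (i,j) = W $$ (i,j) * complex_of_real (e j)"
    using arg_cong[OF assms(3), of "\<lambda>X. X $$ (i,j)"] ij assms(1,2)
    by (simp add: rdiag_mult_index mult_rdiag_index del: index_mult_mat(1))
  then have "W $$ (i,j) = 0 \<or> d i = e j" by (auto simp: mult.commute)
  then show "(rdiag n (f \<circ> d) * W) $$ (i,j) = (W * rdiag m (f \<circ> e)) $$ (i,j)"
    using ij assms(1,2) by (auto simp: rdiag_mult_index mult_rdiag_index simp del: index_mult_mat(1))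
qed (use assms in auto)

text \<open>For unitary \<open>V\<close> this is the uniqueness of the functional calculus.\<close>

lemma diag_intertwine:
  assumes U: "unitary_m n U" and V: "dim_row V = n" "dim_col V = m"
    and eq: "U * rdiag n d * adj U * V = V * rdiag m e"
  shows "U * rdiag n (f \<circ> d) * adj U * V = V * rdiag m (f \<circ> e)"
proof -
  note u [simp] = unitaryD[OF U] V
  have "adj U * (U * rdiag n d * adj U * V) = rdiag n d * (adj U * V)"
    by (simp add: mult_assoc_dim mult_adj_cancel)
  then have "rdiag n d * (adj U * V) = (adj U * V) * rdiag m e"
    unfolding eq by (simp add: mult_assoc_dim)
  then have "rdiag n (f \<circ> d) * (adj U * V) = (adj U * V) * rdiag m (f \<circ> e)"
    by (intro rdiag_intertwine) auto
  then have "U * (rdiag n (f \<circ> d) * (adj U * V)) = U * ((adj U * V) * rdiag m (f \<circ> e))" by simp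
  then show ?thesis by (simp add: mult_assoc_dim mult_adj_cancel')
qed

text \<open>The spectral theorem guarantees a witness for the choice in \<open>mat_fun\<close>, but
  which decomposition was chosen remains unknown; intertwining removes the ambiguity.\<close>

lemma mat_fun_witness:
  assumes "M \<in> carrier_mat n n" "adj M = M"
  obtains U d where "unitary_m n U" "M = U * rdiag n d * adj U" "mat_fun f M = U * rdiag n (f \<circ> d) * adj U"
proof -
  have "dim_row M = n" using assms by auto
  moreover obtain U d where "unitary_m n U" "M = U * rdiag n d * adj U"
    using spectral[OF assms] by metis
  ultimately have "\<exists>N U d. unitary_m (dim_row M) U \<and> M = U * rdiag (dim_row M) d * adj U \<and>
      N = U * rdiag (dim_row M) (f \<circ> d) * adj U" by blast
  then have "\<exists>U d. unitary_m (dim_row M) U \<and> M = U * rdiag (dim_row M) d * adj U \<and>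
      mat_fun f M = U * rdiag (dim_row M) (f \<circ> d) * adj U"
    unfolding mat_fun_def by (rule someI_ex)
  then show thesis using that \<open>dim_row M = n\<close> by blast
qed

lemma mat_fun_carrier:
  assumes "M \<in> carrier_mat n n" "adj M = M" shows "mat_fun f M \<in> carrier_mat n n"
  by (rule mat_fun_witness[OF assms, of f]) (auto dest: unitaryD intro!: carrier_matI)

text \<open>\<open>V\<close> may be rectangular: it is enough to know some eigenvectors of
  \<open>M\<close>. This is how the logarithm of a Markov state is evaluated block by block.\<close>

lemma mat_fun_intertwine:
  assumes M: "M \<in> carrier_mat n n" "adj M = M" and V: "dim_row V = n" "dim_col V = m"
    and eq: "M * V = V * rdiag m e"
  shows "mat_fun f M * V = V * rdiag m (f \<circ> e)"
  by (rule mat_fun_witness[OF M, of f]) (use diag_intertwine[of n _ V m _ e f] V eq in auto)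

lemma mat_fun_diag:
  assumes U: "unitary_m n U" shows "mat_fun f (U * rdiag n d * adj U) = U * rdiag n (f \<circ> d) * adj U"
proof -
  note u [simp] = unitaryD[OF U]
  let ?M = "U * rdiag n d * adj U"
  have M: "?M \<in> carrier_mat n n" "adj ?M = ?M"
    by (auto simp: adj_mult mult_assoc_dim intro!: carrier_matI)
  have "mat_fun f ?M * U = U * rdiag n (f \<circ> d)"
    by (rule mat_fun_intertwine[OF M]) (auto simp: mult_assoc_dim)
  then have "mat_fun f ?M * U * adj U = U * rdiag n (f \<circ> d) * adj U" by simp
  then show ?thesis using carrier_matD[OF mat_fun_carrier[OF M, of f]] by (simp add: mult_assoc_dim)
qed

section \<open>Positive matrices and entropy\<close>

text \<open>Vectors become matrices with one column, so that positivity can be handled by matrix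
  algebra alone.\<close>

lemma quad_form_eq:
  assumes "M \<in> carrier_mat n n" "v \<in> carrier_vec n"
  shows "(\<Sum>i<n. cnj (v $ i) * (M *\<^sub>v v) $ i) =
    (adj (mat n 1 (\<lambda>(i,_). v $ i)) * M * mat n 1 (\<lambda>(i,_). v $ i)) $$ (0,0)"
  using assms
  by (auto simp: mult_assoc_dim index_mult_sum scalar_prod_def lessThan_atLeast0 simp del: index_mult_mat(1) intro!: sum.cong)

lemma quad_form_col:
  assumes "M \<in> carrier_mat n n" "U \<in> carrier_mat n m" "j < m"
  shows "(adj U * M * U) $$ (j,j) = (\<Sum>i<n. cnj (col U j $ i) * (M *\<^sub>v col U j) $ i)"
  using assms
  by (auto simp: mult_assoc_dim index_mult_sum scalar_prod_def lessThan_atLeast0 simp del: index_mult_mat(1) intro!: sum.cong)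

lemma psdD:
  assumes "psd n M" shows "M \<in> carrier_mat n n" "adj M = M" "dim_row M = n" "dim_col M = n"
  using assms by (auto simp: psd_def)

lemma psd_diag_nonneg:
  assumes "psd n M" "U \<in> carrier_mat n m" "j < m"
  shows "0 \<le> Re ((adj U * M * U) $$ (j,j))"
proof -
  have "col U j \<in> carrier_vec n" using assms by auto
  then show ?thesis
    using assms(1) quad_form_col[OF psdD(1)[OF assms(1)] assms(2,3)] by (simp add: psd_def)
qed

lemma psdI:
  assumes "M \<in> carrier_mat n n" "adj M = M"
    and "\<And>V. V \<in> carrier_mat n 1 \<Longrightarrow> 0 \<le> Re ((adj V * M * V) $$ (0,0))"
  shows "psd n M"
  unfolding psd_def
proof (intro conjI ballI)
  fix v :: "complex vec" assume "v \<in> carrier_vec n"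
  then show "0 \<le> Re (\<Sum>i<n. cnj (v $ i) * (M *\<^sub>v v) $ i)"
    unfolding quad_form_eq[OF assms(1) \<open>v \<in> carrier_vec n\<close>] by (intro assms(3)) auto
qed (use assms(1,2) in auto)

lemma adj_mult_self_diag:
  assumes "i < dim_col A"
  shows "(adj A * A) $$ (i,i) = complex_of_real (\<Sum>k<dim_row A. (cmod (A $$ (k,i)))\<^sup>2)"
  using assms
  by (subst index_mult_sum) (auto simp: complex_norm_square[unfolded of_real_power] mult.commute intro!: sum.cong)

lemma psd_gram:
  assumes "G \<in> carrier_mat n m" shows "psd n (G * adj G)"
proof (rule psdI)
  note [simp] = carrier_matD[OF assms]
  show "G * adj G \<in> carrier_mat n n" by (auto intro!: carrier_matI)
  show "adj (G * adj G) = G * adj G" by (simp add: adj_mult)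
  fix V :: "complex mat" assume V: "V \<in> carrier_mat n 1"
  note [simp] = carrier_matD[OF V]
  have "adj V * (G * adj G) * V = adj (adj G * V) * (adj G * V)"
    by (simp add: adj_mult mult_assoc_dim)
  then show "0 \<le> Re ((adj V * (G * adj G) * V) $$ (0,0))"
    by (simp add: adj_mult_self_diag sum_nonneg del: index_mult_mat(1))
qed

lemma psd_spectral:
  assumes "psd n M"
  obtains U d where "unitary_m n U" "M = U * rdiag n d * adj U" "\<And>i. i < n \<Longrightarrow> 0 \<le> d i"
proof -
  obtain U d where U: "unitary_m n U" and M: "M = U * rdiag n d * adj U"
    by (rule spectral[OF psdD(1,2)[OF assms]], rule that)
  note u [simp] = unitaryD[OF U]
  have "adj U * M * U = rdiag n d" unfolding M
    by (simp add: mult_assoc_dim mult_adj_cancel)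
  then have "0 \<le> d i" if "i < n" for i
    using psd_diag_nonneg[OF assms carrier_matI[OF u(1,2)] that] that by (simp add: rdiag_index)
  then show thesis using that U M by blast
qed

lemma psd_sqrt:
  assumes "psd n M" obtains G where "G \<in> carrier_mat n n" "M = G * adj G"
proof -
  obtain U d where U: "unitary_m n U" and M: "M = U * rdiag n d * adj U"
    and d: "\<And>i. i < n \<Longrightarrow> 0 \<le> d i"
    by (rule psd_spectral[OF assms], rule that)
  note u [simp] = unitaryD[OF U]
  have "rdiag n (\<lambda>i. sqrt (d i)) * rdiag n (\<lambda>i. sqrt (d i)) = rdiag n d"
    unfolding rdiag_mult_rdiag by (rule eq_matI) (auto simp: rdiag_index d simp flip: of_real_mult)
  then have "rdiag n (\<lambda>i. sqrt (d i)) * (rdiag n (\<lambda>i. sqrt (d i)) * adj U) = rdiag n d * adj U"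
    by (subst mult_assoc_dim[symmetric]) auto
  then have "M = (U * rdiag n (\<lambda>i. sqrt (d i))) * adj (U * rdiag n (\<lambda>i. sqrt (d i)))"
    unfolding M by (simp add: adj_mult mult_assoc_dim)
  then show thesis by (intro that[of "U * rdiag n (\<lambda>i. sqrt (d i))"]) (auto intro!: carrier_matI)
qed

lemma psd_sandwich:
  assumes "psd n M" "S \<in> carrier_mat m n" shows "psd m (S * M * adj S)"
proof -
  obtain G where G: "G \<in> carrier_mat n n" "M = G * adj G" by (rule psd_sqrt[OF assms(1)], rule that)
  note [simp] = carrier_matD[OF G(1)] carrier_matD[OF assms(2)]
  have "S * M * adj S = (S * G) * adj (S * G)"
    unfolding G(2) by (simp add: adj_mult mult_assoc_dim)
  show ?thesis unfolding \<open>S * M * adj S = _\<close> by (rule psd_gram[of _ m n]) (auto intro!: carrier_matI)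
qed

lemma psd_add:
  assumes "psd n A" "psd n B" shows "psd n (A + B)"
proof (rule psdI)
  note [simp] = psdD[OF assms(1)] psdD[OF assms(2)]
  show "A + B \<in> carrier_mat n n" by (auto intro!: carrier_matI)
  show "adj (A + B) = A + B" by (simp add: adj_add)
  fix V :: "complex mat" assume V: "V \<in> carrier_mat n 1"
  note [simp] = carrier_matD[OF V]
  have "adj V * (A + B) * V = adj V * A * V + adj V * B * V"
    by (simp add: add_mult_dim mult_add_dim)
  then show "0 \<le> Re ((adj V * (A + B) * V) $$ (0,0))"
    using psd_diag_nonneg[OF assms(1) V, of 0] psd_diag_nonneg[OF assms(2) V, of 0]
    by (simp del: index_mult_mat(1))
qed

lemma psd_smult:
  assumes "psd n A" "0 \<le> a" shows "psd n (complex_of_real a \<cdot>\<^sub>m A)"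
proof (rule psdI)
  note [simp] = psdD[OF assms(1)]
  show "complex_of_real a \<cdot>\<^sub>m A \<in> carrier_mat n n" by (auto intro!: carrier_matI)
  show "adj (complex_of_real a \<cdot>\<^sub>m A) = complex_of_real a \<cdot>\<^sub>m A" by (simp add: adj_smult)
  fix V :: "complex mat" assume V: "V \<in> carrier_mat n 1"
  note [simp] = carrier_matD[OF V]
  have "adj V * (complex_of_real a \<cdot>\<^sub>m A) * V = complex_of_real a \<cdot>\<^sub>m (adj V * A * V)"
    by (simp add: mult_smult_dim smult_mult_dim)
  then show "0 \<le> Re ((adj V * (complex_of_real a \<cdot>\<^sub>m A) * V) $$ (0,0))"
    using psd_diag_nonneg[OF assms(1) V, of 0] assms(2) by (simp del: index_mult_mat(1))
qed

lemma mtrace_psd: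
  assumes "psd n M" shows "0 \<le> Re (mtrace M)" "Im (mtrace M) = 0"
proof -
  obtain G where G: "G \<in> carrier_mat n n" "M = G * adj G" by (rule psd_sqrt[OF assms], rule that)
  then have "mtrace M = mtrace (adj G * G)" by (auto intro: mtrace_comm)
  also have "\<dots> = complex_of_real (\<Sum>i<n. \<Sum>k<n. (cmod (G $$ (k,i)))\<^sup>2)"
    using G unfolding mtrace_def by (simp add: adj_mult_self_diag del: index_mult_mat(1))
  finally have *: "mtrace M = complex_of_real (\<Sum>i<n. \<Sum>k<n. (cmod (G $$ (k,i)))\<^sup>2)" .
  show "0 \<le> Re (mtrace M)" "Im (mtrace M) = 0" unfolding * by (simp_all add: sum_nonneg)
qed

lemma adj_ptr:
  assumes "X \<in> carrier_mat (m*n) (m*n)"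
  shows "adj (ptrR m n X) = ptrR m n (adj X)" "adj (ptrL m n X) = ptrL m n (adj X)"
  using assms by (auto intro!: eq_matI simp: ptrR_def ptrL_def pair_index_less)

lemma mtrace_sandwich_nonneg:
  assumes "psd n X" "S \<in> carrier_mat n m" shows "0 \<le> Re (mtrace (X * (S * adj S)))"
proof -
  note [simp] = psdD[OF assms(1)] carrier_matD[OF assms(2)]
  have "mtrace (X * (S * adj S)) = mtrace ((X * S) * adj S)" by (simp add: mult_assoc_dim)
  also have "\<dots> = mtrace (adj S * X * adj (adj S))" by (subst mtrace_comm) (auto simp: mult_assoc_dim)
  finally show ?thesis
    using mtrace_psd(1)[OF psd_sandwich[OF assms(1), of "adj S" m]] assms(2) by simp
qed

text \<open>By duality the quadratic form of the partial trace at \<open>V\<close> is the trace of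
  \<open>X\<close> against a positive matrix on the whole space.\<close>

lemma psd_ptrR:
  assumes "psd (m*n) X" shows "psd m (ptrR m n X)"
proof (rule psdI)
  note X = psdD[OF assms]
  show "adj (ptrR m n X) = ptrR m n X" using adj_ptr(1)[OF X(1)] X(2) by simp
  fix V :: "complex mat" assume V: "V \<in> carrier_mat m 1"
  note [simp] = carrier_matD[OF V] X(3,4)
  have "(adj V * ptrR m n X * V) $$ (0,0) = mtrace (adj V * (ptrR m n X * V))"
    by (simp add: mtrace_def mult_assoc_dim del: index_mult_mat(1))
  also have "\<dots> = mtrace ((ptrR m n X * V) * adj V)" by (rule mtrace_comm) auto
  also have "\<dots> = mtrace (ptrR m n X * (V * adj V))" by (simp add: mult_assoc_dim)
  also have "\<dots> = mtrace (X * kron (V * adj V) (1\<^sub>m n))"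
    by (rule mtrace_ptrR_mult[OF X(1)]) (auto intro!: carrier_matI)
  also have "kron (V * adj V) (1\<^sub>m n) = kron V (1\<^sub>m n) * adj (kron V (1\<^sub>m n))"
    by (simp add: adj_kron kron_mult)
  finally have eq: "(adj V * ptrR m n X * V) $$ (0,0) = mtrace (X * (kron V (1\<^sub>m n) * adj (kron V (1\<^sub>m n))))" .
  show "0 \<le> Re ((adj V * ptrR m n X * V) $$ (0,0))"
    unfolding eq by (rule mtrace_sandwich_nonneg[OF assms, of _ "1*n"]) (auto intro!: carrier_matI)
qed auto

lemma psd_ptrL:
  assumes "psd (m*n) X" shows "psd n (ptrL m n X)"
proof (rule psdI)
  note X = psdD[OF assms]
  show "adj (ptrL m n X) = ptrL m n X" using adj_ptr(2)[OF X(1)] X(2) by simp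
  fix V :: "complex mat" assume V: "V \<in> carrier_mat n 1"
  note [simp] = carrier_matD[OF V] X(3,4)
  have "(adj V * ptrL m n X * V) $$ (0,0) = mtrace (adj V * (ptrL m n X * V))"
    by (simp add: mtrace_def mult_assoc_dim del: index_mult_mat(1))
  also have "\<dots> = mtrace ((ptrL m n X * V) * adj V)" by (rule mtrace_comm) auto
  also have "\<dots> = mtrace (ptrL m n X * (V * adj V))" by (simp add: mult_assoc_dim)
  also have "\<dots> = mtrace (X * kron (1\<^sub>m m) (V * adj V))"
    by (rule mtrace_ptrL_mult[OF X(1)]) (auto intro!: carrier_matI)
  also have "kron (1\<^sub>m m) (V * adj V) = kron (1\<^sub>m m) V * adj (kron (1\<^sub>m m) V)"
    by (simp add: adj_kron kron_mult)
  finally have eq: "(adj V * ptrL m n X * V) $$ (0,0) = mtrace (X * (kron (1\<^sub>m m) V * adj (kron (1\<^sub>m m) V)))" .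
  show "0 \<le> Re ((adj V * ptrL m n X * V) $$ (0,0))"
    unfolding eq by (rule mtrace_sandwich_nonneg[OF assms, of _ "m*1"]) (auto intro!: carrier_matI)
qed auto

text \<open>Note the sign: this is the concave entropy summand, and the factor \<open>x\<close>
  makes its value at 0 equal to 0.\<close>

definition xlnx :: "real \<Rightarrow> real" where "xlnx x = - x * ln x"

lemma xlnx_0 [simp]: "xlnx 0 = 0" by (simp add: xlnx_def)

text \<open>From \<open>ln z \<le> z - 1\<close> at \<open>z = y / x\<close>: the graph lies below
  its tangent at \<open>y\<close>. Jensen and Gibbs are both sums of this inequality.\<close>

lemma xlnx_tangent:
  assumes "0 \<le> x" "0 < y" shows "xlnx x \<le> - x * ln y - x + y"
proof (cases "x = 0")
  case False
  with assms have x: "0 < x" by simp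
  have "ln (y / x) \<le> y / x - 1" by (rule ln_le_minus_one) (use x assms in simp)
  then have "x * (ln y - ln x) \<le> x * (y / x - 1)"
    using x assms by (intro mult_left_mono) (auto simp: ln_div)
  then show ?thesis using x by (simp add: xlnx_def algebra_simps)
qed (use assms in simp)

lemma xlnx_mult: "0 \<le> a \<Longrightarrow> 0 \<le> b \<Longrightarrow> xlnx (a * b) = a * xlnx b + b * xlnx a"
  by (cases "a = 0"; cases "b = 0") (auto simp: xlnx_def ln_mult algebra_simps)

text \<open>Sum the tangent inequality at the mean \<open>y\<close>. If the mean is 0 there is no
  tangent, but then every summand has weight 0 or argument 0.\<close>

lemma xlnx_jensen:
  assumes w: "\<And>k. k \<in> K \<Longrightarrow> 0 \<le> w k" "(\<Sum>k\<in>K. w k) = 1" and d: "\<And>k. k \<in> K \<Longrightarrow> 0 \<le> d k"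
  shows "(\<Sum>k\<in>K. w k * xlnx (d k)) \<le> xlnx (\<Sum>k\<in>K. w k * d k)"
proof -
  have fin: "finite K" using w(2) by (metis sum.infinite zero_neq_one)
  define y where "y = (\<Sum>k\<in>K. w k * d k)"
  have "0 \<le> y" unfolding y_def by (intro sum_nonneg mult_nonneg_nonneg w d)
  then consider "y = 0" | "0 < y" by linarith
  then show ?thesis
  proof cases
    case 1
    then have "\<forall>k\<in>K. w k * d k = 0"
      unfolding y_def using fin by (subst (asm) sum_nonneg_eq_0_iff) (auto intro: mult_nonneg_nonneg w(1) d)
    then have "(\<Sum>k\<in>K. w k * xlnx (d k)) = 0"
      by (intro sum.neutral) auto
    then show ?thesis using 1 by (simp add: y_def[symmetric])
  next
    case 2
    have "(\<Sum>k\<in>K. w k * xlnx (d k)) \<le> (\<Sum>k\<in>K. w k * (- d k * ln y - d k + y))"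
      by (intro sum_mono mult_left_mono xlnx_tangent w d 2)
    also have "\<dots> = (\<Sum>k\<in>K. - ln y * (w k * d k) - w k * d k + y * w k)"
      by (intro sum.cong) (auto simp: algebra_simps)
    also have "\<dots> = - ln y * y - y + y * 1"
      unfolding sum.distrib sum_subtractf sum_distrib_left[symmetric] w(2) y_def ..
    finally show ?thesis unfolding y_def[symmetric] by (simp add: xlnx_def[of y] mult.commute)
  qed
qed

lemma xlnx_concave2:
  assumes "0 \<le> a" "0 \<le> b" "a + b = 1" "0 \<le> x" "0 \<le> y"
  shows "a * xlnx x + b * xlnx y \<le> xlnx (a * x + b * y)"
  using xlnx_jensen[of UNIV "\<lambda>k. if k then a else b" "\<lambda>k. if k then x else y"] assms
  by (simp add: UNIV_bool add.commute)

text \<open>The tangent inequality at \<open>q * s i\<close> in each coordinate. The vector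
  \<open>x\<close> need not have total 1, which is why \<open>xlnx\<close> of its total
  \<open>q\<close> is subtracted; the support condition disposes of the indices where
  \<open>ln (s i)\<close> has no meaning.\<close>

lemma gibbs:
  assumes x: "\<And>i. i \<in> I \<Longrightarrow> 0 \<le> x i" and s: "\<And>i. i \<in> I \<Longrightarrow> 0 \<le> s i" "(\<Sum>i\<in>I. s i) = 1"
    and supp: "\<And>i. i \<in> I \<Longrightarrow> s i = 0 \<Longrightarrow> x i = 0"
  shows "(\<Sum>i\<in>I. xlnx (x i)) - xlnx (\<Sum>i\<in>I. x i) \<le> - (\<Sum>i\<in>I. x i * ln (s i))"
proof -
  have fin: "finite I" using s(2) by (metis sum.infinite zero_neq_one)
  define q where "q = (\<Sum>i\<in>I. x i)"
  have "0 \<le> q" unfolding q_def by (intro sum_nonneg x)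
  then consider "q = 0" | "0 < q" by linarith
  then show ?thesis
  proof cases
    case 1
    then have "\<forall>i\<in>I. x i = 0"
      unfolding q_def using fin by (subst (asm) sum_nonneg_eq_0_iff) (auto intro: x)
    then show ?thesis by simp
  next
    case 2
    have "xlnx (x i) \<le> - ln q * x i - x i * ln (s i) - x i + q * s i" if "i \<in> I" for i
    proof (cases "s i = 0")
      case False
      then have "0 < s i" using s(1)[OF that] by simp
      then show ?thesis
        using xlnx_tangent[OF x[OF that], of "q * s i"] 2 by (simp add: ln_mult algebra_simps)
    qed (simp add: supp[OF that])
    then have "(\<Sum>i\<in>I. xlnx (x i)) \<le> (\<Sum>i\<in>I. - ln q * x i - x i * ln (s i) - x i + q * s i)"
      by (rule sum_mono)
    also have "\<dots> = - ln q * q - (\<Sum>i\<in>I. x i * ln (s i)) - q + q * 1"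
      unfolding sum.distrib sum_subtractf sum_distrib_left[symmetric] s(2) q_def ..
    finally show ?thesis unfolding q_def[symmetric] by (simp add: xlnx_def[of q] mult.commute)
  qed
qed

text \<open>For a density matrix this is the von Neumann entropy.\<close>

definition eta :: "complex mat \<Rightarrow> real" where
  "eta M = Re (mtrace (mat_fun xlnx M))"

lemma mtrace_unitary_conj:
  assumes "unitary_m n U" "X \<in> carrier_mat n n" shows "mtrace (U * X * adj U) = mtrace X"
proof -
  note [simp] = unitaryD[OF assms(1)] carrier_matD[OF assms(2)]
  have "mtrace (U * X * adj U) = mtrace (U * (X * adj U))" by (simp add: mult_assoc_dim)
  also have "\<dots> = mtrace ((X * adj U) * U)" by (rule mtrace_comm) auto
  finally show ?thesis by (simp add: mult_assoc_dim)
qed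

lemma eta_diag:
  assumes "unitary_m n U" shows "eta (U * rdiag n d * adj U) = (\<Sum>i<n. xlnx (d i))"
  by (simp add: eta_def mat_fun_diag[OF assms] mtrace_unitary_conj[OF assms] mtrace_rdiag)

text \<open>In another orthonormal basis the diagonal of \<open>M\<close> is a mixture of its
  eigenvalues, with the squared moduli of the entries of \<open>W\<close> as weights. These form a
  doubly stochastic matrix, and concavity of \<open>xlnx\<close> applies to each column.\<close>

lemma eta_le_diag:
  assumes M: "psd n M" and U: "unitary_m n U"
  shows "eta M \<le> (\<Sum>i<n. xlnx (Re ((adj U * M * U) $$ (i,i))))"
proof -
  obtain V d where V: "unitary_m n V" and Md: "M = V * rdiag n d * adj V"
    and d: "\<And>i. i < n \<Longrightarrow> 0 \<le> d i"
    by (rule psd_spectral[OF M], rule that)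
  note u [simp] = unitaryD[OF U] unitaryD[OF V]
  define W where "W = adj V * U"
  have dW [simp]: "dim_row W = n" "dim_col W = n" by (auto simp: W_def)
  have WW: "adj W * W = 1\<^sub>m n" "W * adj W = 1\<^sub>m n"
    by (auto simp: W_def adj_mult mult_assoc_dim mult_adj_cancel' mult_adj_cancel)
  have col: "(\<Sum>k<n. (cmod (W $$ (k,i)))\<^sup>2) = 1" if "i < n" for i
    using that adj_mult_self_diag[of i W] by (simp add: WW flip: of_real_sum of_real_power)
  have row: "(\<Sum>i<n. (cmod (W $$ (k,i)))\<^sup>2) = 1" if "k < n" for k
    using that adj_mult_self_diag[of k "adj W"] by (simp add: WW flip: of_real_sum of_real_power)
  have eq: "adj U * M * U = adj W * (rdiag n d * W)"
    unfolding Md W_def by (simp add: adj_mult mult_assoc_dim)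
  have diag: "Re ((adj U * M * U) $$ (i,i)) = (\<Sum>k<n. (cmod (W $$ (k,i)))\<^sup>2 * d k)" if "i < n" for i
  proof -
    have "(adj U * M * U) $$ (i,i) = (\<Sum>k<n. complex_of_real ((cmod (W $$ (k,i)))\<^sup>2 * d k))"
      unfolding eq using that
      by (subst index_mult_sum)
        (auto simp: rdiag_mult_index complex_norm_square[unfolded of_real_power] mult_ac simp del: index_mult_mat(1) intro!: sum.cong)
    then show ?thesis by (simp flip: of_real_sum)
  qed
  have "eta M = (\<Sum>k<n. xlnx (d k))" unfolding Md by (rule eta_diag[OF V])
  also have "\<dots> = (\<Sum>k<n. (\<Sum>i<n. (cmod (W $$ (k,i)))\<^sup>2) * xlnx (d k))" by (simp add: row)
  also have "\<dots> = (\<Sum>i<n. \<Sum>k<n. (cmod (W $$ (k,i)))\<^sup>2 * xlnx (d k))"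
    unfolding sum_distrib_right by (rule sum.swap)
  also have "\<dots> \<le> (\<Sum>i<n. xlnx (\<Sum>k<n. (cmod (W $$ (k,i)))\<^sup>2 * d k))"
    by (intro sum_mono xlnx_jensen) (auto simp: col d)
  also have "\<dots> = (\<Sum>i<n. xlnx (Re ((adj U * M * U) $$ (i,i))))" by (simp add: diag del: index_mult_mat(1))
  finally show ?thesis .
qed

text \<open>The eigenbasis of the mixture is used for all three matrices: there the diagonal of the
  mixture is its spectrum, while reading off diagonals can only raise the entropy of
  \<open>A\<close> and \<open>B\<close>. What remains is scalar concavity.\<close>

lemma eta_concave:
  assumes A: "psd n A" and B: "psd n B" and ab: "0 \<le> a" "0 \<le> b" "a + b = 1"
  shows "a * eta A + b * eta B \<le> eta (complex_of_real a \<cdot>\<^sub>m A + complex_of_real b \<cdot>\<^sub>m B)"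
proof -
  let ?C = "complex_of_real a \<cdot>\<^sub>m A + complex_of_real b \<cdot>\<^sub>m B"
  have C: "psd n ?C" by (intro psd_add psd_smult A B ab)
  obtain U d where U: "unitary_m n U" and Cd: "?C = U * rdiag n d * adj U"
    by (rule psd_spectral[OF C], rule that)
  note [simp] = unitaryD[OF U] psdD[OF A] psdD[OF B]
  have U': "U \<in> carrier_mat n n" by (auto intro!: carrier_matI)
  have "adj U * ?C * U = rdiag n d" unfolding Cd by (simp add: mult_assoc_dim mult_adj_cancel)
  moreover have "adj U * ?C * U = complex_of_real a \<cdot>\<^sub>m (adj U * A * U) + complex_of_real b \<cdot>\<^sub>m (adj U * B * U)"
    by (simp add: add_mult_dim mult_add_dim mult_smult_dim smult_mult_dim)
  ultimately have d: "d i = a * Re ((adj U * A * U) $$ (i,i)) + b * Re ((adj U * B * U) $$ (i,i))"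
    if "i < n" for i
    using that by (auto simp: rdiag_index dest!: arg_cong[where f = "\<lambda>X. Re (X $$ (i,i))"] simp del: index_mult_mat(1))
  have "a * eta A + b * eta B \<le> a * (\<Sum>i<n. xlnx (Re ((adj U * A * U) $$ (i,i))))
      + b * (\<Sum>i<n. xlnx (Re ((adj U * B * U) $$ (i,i))))"
    by (intro add_mono mult_left_mono eta_le_diag A B U ab)
  also have "\<dots> = (\<Sum>i<n. a * xlnx (Re ((adj U * A * U) $$ (i,i))) + b * xlnx (Re ((adj U * B * U) $$ (i,i))))"
    by (simp only: sum_distrib_left sum.distrib)
  also have "\<dots> \<le> (\<Sum>i<n. xlnx (d i))"
    by (intro sum_mono) (auto simp: d simp del: index_mult_mat(1) intro!: xlnx_concave2 ab psd_diag_nonneg[OF A U'] psd_diag_nonneg[OF B U'])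
  also have "\<dots> = eta ?C" unfolding Cd by (rule eta_diag[OF U, symmetric])
  finally show ?thesis .
qed

lemma pow_mat_dim_row [simp]: "dim_row A = dim_col A \<Longrightarrow> dim_row (A ^\<^sub>m k) = dim_col A"
  "dim_row A = dim_col A \<Longrightarrow> dim_col (A ^\<^sub>m k) = dim_col A"
  by (simp_all add: pow_mat_dim)

section \<open>Entropy through the traces of powers\<close>

lemma pow_unitary_conj:
  assumes U: "unitary_m n U"
  shows "(U * rdiag n d * adj U) ^\<^sub>m k = U * rdiag n (\<lambda>i. d i ^ k) * adj U"
proof (induction k)
  note [simp] = unitaryD[OF U]
  case 0
  have "rdiag n (\<lambda>i. 1) = 1\<^sub>m n" by (rule eq_matI) (auto simp: rdiag_index)
  then show ?case by simp
next
  note [simp] = unitaryD[OF U]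
  case (Suc k)
  have "rdiag n (\<lambda>i. d i ^ k) * (rdiag n d * adj U) = rdiag n (\<lambda>i. d i ^ Suc k) * adj U"
    by (subst mult_assoc_dim[symmetric]) (auto simp: rdiag_mult_rdiag mult.commute)
  moreover have "(U * rdiag n d * adj U) ^\<^sub>m Suc k = U * (rdiag n (\<lambda>i. d i ^ k) * (rdiag n d * adj U))"
    unfolding pow_mat.simps Suc by (simp add: mult_assoc_dim mult_adj_cancel)
  ultimately show ?case by (simp add: mult_assoc_dim)
qed

lemma mtrace_pow_unitary_conj:
  assumes U: "unitary_m n U"
  shows "mtrace ((U * rdiag n d * adj U) ^\<^sub>m k) = complex_of_real (\<Sum>i<n. d i ^ k)"
  by (simp only: pow_unitary_conj[OF U] mtrace_unitary_conj[OF U rdiag_carrier] mtrace_rdiag)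

text \<open>Comes from \<open>ln z \<le> z - 1\<close> at \<open>z = 1 / sqrt x\<close>; it serves
  continuity at 0.\<close>

lemma abs_xlnx_le: assumes "0 \<le> x" "x \<le> 1" shows "\<bar>xlnx x\<bar> \<le> 2 * sqrt x"
proof (cases "x = 0")
  case False
  with assms have x: "0 < x" by simp
  have "ln (1 / sqrt x) \<le> 1 / sqrt x - 1" by (rule ln_le_minus_one) (use x in simp)
  then have "- ln x \<le> 2 * (1 / sqrt x)" using x by (simp add: ln_div ln_sqrt)
  then have "x * (- ln x) \<le> x * (2 * (1 / sqrt x))" using x by (intro mult_left_mono) auto
  also have "\<dots> = 2 * sqrt x" using x by (simp add: field_simps)
  finally have "xlnx x \<le> 2 * sqrt x" by (simp add: xlnx_def)
  moreover have "0 \<le> xlnx x" using x assms by (simp add: xlnx_def mult_nonneg_nonpos)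
  ultimately show ?thesis by simp
qed simp

lemma tendsto_xlnx_0: "(xlnx \<longlongrightarrow> 0) (at 0 within {0..})"
proof (rule Lim_null_comparison)
  show "eventually (\<lambda>x. norm (xlnx x) \<le> 2 * sqrt x) (at 0 within {0..})"
    unfolding eventually_at by (intro exI[of _ 1]) (auto simp: dist_real_def intro!: abs_xlnx_le)
  show "((\<lambda>x. 2 * sqrt x) \<longlongrightarrow> 0) (at 0 within {0..})"
    by (rule tendsto_eq_intros refl | simp)+
qed

lemma continuous_on_xlnx: "continuous_on {0..} xlnx"
  unfolding continuous_on
proof
  fix x :: real assume "x \<in> {0..}"
  then consider "x = 0" | "0 < x" by fastforce
  then show "(xlnx \<longlongrightarrow> xlnx x) (at x within {0..})"
  proof cases
    case 1
    then show ?thesis using tendsto_xlnx_0 by simp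
  next
    case 2
    then have "isCont xlnx x" unfolding xlnx_def[abs_def] by (intro continuous_intros) auto
    then show ?thesis unfolding isCont_def by (rule tendsto_within_subset) simp
  qed
qed

lemma tendsto_xlnx:
  assumes "(f \<longlongrightarrow> x) sequentially" "\<And>n. 0 \<le> f n" "0 \<le> x"
  shows "(\<lambda>n. xlnx (f n)) \<longlonglongrightarrow> xlnx x"
  using continuous_on_tendsto_compose[OF continuous_on_xlnx assms(1)] assms by simp

text \<open>Weierstrass gives a polynomial; its constant term is small because
  \<open>xlnx 0 = 0\<close>, and it is dropped. Then zero eigenvalues contribute nothing, so
  matrices of different sizes can share one polynomial.\<close>

lemma xlnx_poly_approx:
  assumes "0 < e"
  obtains a N where "\<And>x. 0 \<le> x \<Longrightarrow> x \<le> c \<Longrightarrow> \<bar>xlnx x - (\<Sum>k=1..N. a k * x ^ k)\<bar> < e"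
proof -
  \<comment> \<open>The interval must contain 0 even for negative \<open>c\<close>, since the
    constant term is estimated there.\<close>
  have "continuous_on {0..max c 0} xlnx"
    by (rule continuous_on_subset[OF continuous_on_xlnx]) auto
  then obtain g where g: "real_polynomial_function g"
    "\<And>x. x \<in> {0..max c 0} \<Longrightarrow> \<bar>xlnx x - g x\<bar> < e / 2"
    using Stone_Weierstrass_real_polynomial_function[of "{0..max c 0}" xlnx "e/2"] assms by auto
  then obtain a N where a: "g = (\<lambda>x. \<Sum>i\<le>N. a i * x ^ i)"
    by (auto simp: real_polynomial_function_iff_sum)
  have split: "g x = a 0 + (\<Sum>k=1..N. a k * x ^ k)" for x
    unfolding a atMost_atLeast0 by (simp add: sum.atLeast_Suc_atMost)
  have "g 0 = a 0" unfolding split by (simp add: power_0_left)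
  then have a0: "\<bar>a 0\<bar> < e / 2" using g(2)[of 0] by simp
  show thesis
  proof (rule that)
    fix x assume "0 \<le> x" "x \<le> c"
    then show "\<bar>xlnx x - (\<Sum>k=1..N. a k * x ^ k)\<bar> < e"
      using g(2)[of x] a0 unfolding split abs_less_iff by (simp; linarith)
  qed
qed

lemma psd_eigenvalue_le_trace:
  assumes "unitary_m n U" "\<And>i. i < n \<Longrightarrow> 0 \<le> d i" "i < n"
  shows "d i \<le> Re (mtrace (U * rdiag n d * adj U))"
  unfolding mtrace_unitary_conj[OF assms(1) rdiag_carrier] mtrace_rdiag
  using member_le_sum[of i "{..<n}" d] assms by simp

text \<open>The trace bounds every eigenvalue of a positive matrix, so \<open>c\<close> confines the
  spectrum to the interval of approximation; each of the \<open>n\<close> eigenvalues costs at most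
  \<open>e\<close>.\<close>

lemma eta_poly_approx:
  assumes M: "psd n M" and tr: "Re (mtrace M) \<le> c"
    and a: "\<And>x. 0 \<le> x \<Longrightarrow> x \<le> c \<Longrightarrow> \<bar>xlnx x - (\<Sum>k=1..N. a k * x ^ k)\<bar> < e"
  shows "\<bar>eta M - (\<Sum>k=1..N. a k * Re (mtrace (M ^\<^sub>m k)))\<bar> \<le> real n * e"
proof -
  obtain U d where U: "unitary_m n U" and Md: "M = U * rdiag n d * adj U"
    and d: "\<And>i. i < n \<Longrightarrow> 0 \<le> d i"
    by (rule psd_spectral[OF M], rule that)
  have dc: "d i \<le> c" if "i < n" for i
    using psd_eigenvalue_le_trace[of n U d i] U d that tr unfolding Md by fastforce
  have "(\<Sum>k=1..N. a k * Re (mtrace (M ^\<^sub>m k))) = (\<Sum>k=1..N. \<Sum>i<n. a k * d i ^ k)"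
    unfolding Md mtrace_pow_unitary_conj[OF U] by (simp add: sum_distrib_left)
  also have "\<dots> = (\<Sum>i<n. \<Sum>k=1..N. a k * d i ^ k)" by (rule sum.swap)
  finally have "eta M - (\<Sum>k=1..N. a k * Re (mtrace (M ^\<^sub>m k)))
      = (\<Sum>i<n. xlnx (d i) - (\<Sum>k=1..N. a k * d i ^ k))"
    unfolding Md eta_diag[OF U] by (simp add: sum_subtractf)
  also have "\<bar>\<dots>\<bar> \<le> (\<Sum>i<n. \<bar>xlnx (d i) - (\<Sum>k=1..N. a k * d i ^ k)\<bar>)" by (rule sum_abs)
  also have "\<dots> \<le> (\<Sum>i<n. e)" by (intro sum_mono order.strict_implies_order[OF a]) (auto simp: d dc)
  finally show ?thesis by simp
qed

lemma abs_le_all_eps: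
  fixes x C :: real assumes "\<And>e. 0 < e \<Longrightarrow> \<bar>x\<bar> \<le> C * e" "0 \<le> C" shows "x = 0"
proof (rule ccontr)
  assume "x \<noteq> 0"
  then have "\<bar>x\<bar> \<le> C * (\<bar>x\<bar> / (C + 1))" using assms(2) by (intro assms(1)) auto
  then have "\<bar>x\<bar> * (C + 1) \<le> C * \<bar>x\<bar>" using assms(2) by (simp add: field_simps)
  then show False using \<open>x \<noteq> 0\<close> by (simp add: algebra_simps)
qed

text \<open>Both entropies are within a multiple of \<open>e\<close> of the same polynomial in the
  power traces. The powers start at 1, so \<open>n\<close> and \<open>m\<close> may differ.\<close>

lemma eta_eq_of_power_traces:
  assumes M: "psd n M" and M': "psd m M'"
    and tr: "\<And>k. 1 \<le> k \<Longrightarrow> mtrace (M ^\<^sub>m k) = mtrace (M' ^\<^sub>m k)"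
  shows "eta M = eta M'"
proof -
  have t1: "mtrace M = mtrace M'" using tr[of 1] psdD[OF M] psdD[OF M'] by simp
  define c where "c = Re (mtrace M)"
  have "\<bar>eta M - eta M'\<bar> \<le> real (n + m) * e" if e: "0 < e" for e
  proof -
    obtain a N where a: "\<And>x. 0 \<le> x \<Longrightarrow> x \<le> c \<Longrightarrow> \<bar>xlnx x - (\<Sum>k=1..N. a k * x ^ k)\<bar> < e"
      by (rule xlnx_poly_approx[OF e, of c], rule that)
    have "(\<Sum>k=1..N. a k * Re (mtrace (M ^\<^sub>m k))) = (\<Sum>k=1..N. a k * Re (mtrace (M' ^\<^sub>m k)))"
      by (intro sum.cong) (auto simp: tr)
    moreover have "\<bar>eta M - (\<Sum>k=1..N. a k * Re (mtrace (M ^\<^sub>m k)))\<bar> \<le> real n * e"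
      by (rule eta_poly_approx[OF M _ a]) (simp_all add: c_def)
    moreover have "\<bar>eta M' - (\<Sum>k=1..N. a k * Re (mtrace (M' ^\<^sub>m k)))\<bar> \<le> real m * e"
      by (rule eta_poly_approx[OF M' _ a]) (simp_all add: c_def t1)
    ultimately show ?thesis by (simp add: algebra_simps)
  qed
  then have "eta M - eta M' = 0" by (rule abs_le_all_eps[of _ "real (n + m)"]) auto
  then show ?thesis by simp
qed

lemma pow_mult_swap:
  fixes A B :: "complex mat"
  assumes "dim_col A = dim_row B" "dim_col B = dim_row A"
  shows "(A * B) ^\<^sub>m Suc k = A * ((B * A) ^\<^sub>m k * B)"
proof (induction k)
  case 0
  then show ?case using assms by (simp add: mult_assoc_dim)
next
  case (Suc k)
  have "(A * B) ^\<^sub>m Suc (Suc k) = (A * ((B * A) ^\<^sub>m k * B)) * (A * B)"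
    using Suc by simp
  also have "\<dots> = A * ((B * A) ^\<^sub>m Suc k * B)" using assms by (simp add: mult_assoc_dim)
  finally show ?case .
qed

lemma mtrace_pow_swap:
  assumes "dim_col A = dim_row B" "dim_col B = dim_row A" "1 \<le> k"
  shows "mtrace ((A * B) ^\<^sub>m k) = mtrace ((B * A) ^\<^sub>m k)"
proof -
  obtain l where k: "k = Suc l" using assms(3) by (cases k) auto
  have "mtrace ((A * B) ^\<^sub>m Suc l) = mtrace (((B * A) ^\<^sub>m l * B) * A)"
    unfolding pow_mult_swap[OF assms(1,2)] by (rule mtrace_comm) (use assms in auto)
  also have "((B * A) ^\<^sub>m l * B) * A = (B * A) ^\<^sub>m Suc l" using assms by (simp add: mult_assoc_dim)
  finally show ?thesis unfolding k .
qed

text \<open>By cyclicity both products have the same traces of positive powers, even when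
  \<open>G\<close> is rectangular.\<close>

lemma eta_gram_swap:
  assumes "G \<in> carrier_mat n m" shows "eta (G * adj G) = eta (adj G * G)"
proof (rule eta_eq_of_power_traces)
  show "psd n (G * adj G)" by (rule psd_gram[OF assms])
  show "psd m (adj G * G)" using psd_gram[of "adj G" m n] assms by simp
qed (use assms in \<open>auto intro: mtrace_pow_swap\<close>)

lemma eta_isometry:
  assumes M: "psd n M" and S: "isometry n m S" shows "eta (S * M * adj S) = eta M"
proof -
  obtain G where G: "G \<in> carrier_mat n n" "M = G * adj G" by (rule psd_sqrt[OF M], rule that)
  note [simp] = carrier_matD[OF G(1)] isometryD(1-3)[OF S]
  have "S * M * adj S = (S * G) * adj (S * G)" unfolding G(2) by (simp add: adj_mult mult_assoc_dim)
  moreover have "eta ((S * G) * adj (S * G)) = eta (adj (S * G) * (S * G))"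
    by (rule eta_gram_swap[of _ m n]) (auto intro!: carrier_matI)
  moreover have "adj (S * G) * (S * G) = adj G * G" by (simp add: adj_mult mult_assoc_dim mult_adj_cancel)
  ultimately show ?thesis unfolding G(2) eta_gram_swap[OF G(1)] by simp
qed

text \<open>Writing \<open>Y = G * adj G\<close> and swapping the factors of \<open>Q * G\<close>
  replaces \<open>Q * Y * adj Q\<close> by a matrix that is linear in \<open>adj Q * Q\<close> and
  lives on one fixed space. Concavity applies there, and the average collapses to
  \<open>adj G * G\<close>.\<close>

lemma eta_compress_le:
  assumes Y: "psd n Y" and w: "0 \<le> w1" "0 \<le> w2" "w1 + w2 = 1"
    and Q: "Q1 \<in> carrier_mat m1 n" "Q2 \<in> carrier_mat m2 n"
    and avg: "complex_of_real w1 \<cdot>\<^sub>m (adj Q1 * Q1) + complex_of_real w2 \<cdot>\<^sub>m (adj Q2 * Q2) = 1\<^sub>m n"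
  shows "w1 * eta (Q1 * Y * adj Q1) + w2 * eta (Q2 * Y * adj Q2) \<le> eta Y"
proof -
  obtain G where G: "G \<in> carrier_mat n n" "Y = G * adj G" by (rule psd_sqrt[OF Y], rule that)
  note [simp] = carrier_matD[OF G(1)] carrier_matD[OF Q(1)] carrier_matD[OF Q(2)]
  let ?H = "\<lambda>Q. adj G * (adj Q * Q) * G"
  have swap: "eta (Q * Y * adj Q) = eta (?H Q)" and psdH: "psd n (?H Q)"
    if "Q \<in> carrier_mat m n" for Q m
  proof -
    note [simp] = carrier_matD[OF that]
    have QG: "Q * G \<in> carrier_mat m n" by (auto intro!: carrier_matI)
    have 1: "Q * Y * adj Q = (Q * G) * adj (Q * G)" unfolding G(2) by (simp add: adj_mult mult_assoc_dim)
    have 2: "?H Q = adj (Q * G) * (Q * G)" by (simp add: adj_mult mult_assoc_dim)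
    show "eta (Q * Y * adj Q) = eta (?H Q)" unfolding 1 2 by (rule eta_gram_swap[OF QG])
    show "psd n (?H Q)" unfolding 2 using psd_gram[of "adj (Q * G)" n m] QG by simp
  qed
  have "w1 * eta (Q1 * Y * adj Q1) + w2 * eta (Q2 * Y * adj Q2) = w1 * eta (?H Q1) + w2 * eta (?H Q2)"
    by (simp add: swap[OF Q(1)] swap[OF Q(2)])
  also have "\<dots> \<le> eta (complex_of_real w1 \<cdot>\<^sub>m ?H Q1 + complex_of_real w2 \<cdot>\<^sub>m ?H Q2)"
    by (intro eta_concave[of n] psdH[OF Q(1)] psdH[OF Q(2)] w)
  also have "complex_of_real w1 \<cdot>\<^sub>m ?H Q1 + complex_of_real w2 \<cdot>\<^sub>m ?H Q2 =
     adj G * (complex_of_real w1 \<cdot>\<^sub>m (adj Q1 * Q1) + complex_of_real w2 \<cdot>\<^sub>m (adj Q2 * Q2)) * G"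
    by (simp add: add_mult_dim mult_add_dim mult_smult_dim smult_mult_dim)
  also have "\<dots> = adj G * G" unfolding avg by simp
  also have "eta (adj G * G) = eta Y" unfolding G(2) by (rule eta_gram_swap[OF G(1), symmetric])
  finally show ?thesis .
qed

section \<open>Entrywise limits of matrices and continuity of the entropy\<close>

definition mlim :: "nat \<Rightarrow> nat \<Rightarrow> (nat \<Rightarrow> complex mat) \<Rightarrow> complex mat \<Rightarrow> bool" where
  "mlim m n X L \<longleftrightarrow> (\<forall>k. X k \<in> carrier_mat m n) \<and> L \<in> carrier_mat m n \<and>
     (\<forall>i<m. \<forall>j<n. (\<lambda>k. X k $$ (i,j)) \<longlonglongrightarrow> L $$ (i,j))"

lemma mlimD:
  assumes "mlim m n X L"
  shows "dim_row (X k) = m" "dim_col (X k) = n" "dim_row L = m" "dim_col L = n"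
    "i < m \<Longrightarrow> j < n \<Longrightarrow> (\<lambda>k. X k $$ (i,j)) \<longlonglongrightarrow> L $$ (i,j)"
  using assms by (auto simp: mlim_def)

lemma mlimI:
  assumes "\<And>k. dim_row (X k) = m" "\<And>k. dim_col (X k) = n" "dim_row L = m" "dim_col L = n"
    "\<And>i j. i < m \<Longrightarrow> j < n \<Longrightarrow> (\<lambda>k. X k $$ (i,j)) \<longlonglongrightarrow> L $$ (i,j)"
  shows "mlim m n X L"
  using assms by (auto simp: mlim_def intro!: carrier_matI)

lemma mlim_const: "A \<in> carrier_mat m n \<Longrightarrow> mlim m n (\<lambda>_. A) A"
  by (auto simp: mlim_def)

lemma mlim_mult:
  assumes "mlim a b X L" "mlim b c Y K" shows "mlim a c (\<lambda>k. X k * Y k) (L * K)"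
proof (rule mlimI)
  note [simp] = mlimD(1-4)[OF assms(1)] mlimD(1-4)[OF assms(2)]
  fix i j assume ij: "i < a" "j < c"
  then show "(\<lambda>k. (X k * Y k) $$ (i,j)) \<longlonglongrightarrow> (L * K) $$ (i,j)"
    by (simp add: index_mult_sum del: index_mult_mat(1))
      (intro tendsto_intros mlimD(5)[OF assms(1)] mlimD(5)[OF assms(2)]; simp)
qed (use mlimD(1-4)[OF assms(1)] mlimD(1-4)[OF assms(2)] in auto)

lemma mlim_adj:
  assumes "mlim a b X L" shows "mlim b a (\<lambda>k. adj (X k)) (adj L)"
proof (rule mlimI)
  note [simp] = mlimD(1-4)[OF assms(1)]
  fix i j assume ij: "i < b" "j < a"
  then show "(\<lambda>k. adj (X k) $$ (i,j)) \<longlonglongrightarrow> adj L $$ (i,j)"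
    by simp (intro tendsto_intros mlimD(5)[OF assms(1)])
qed (use mlimD(1-4)[OF assms(1)] in auto)

lemma mlim_kron:
  assumes "mlim a b X L" "mlim c d Y K" shows "mlim (a*c) (b*d) (\<lambda>k. kron (X k) (Y k)) (kron L K)"
proof (rule mlimI)
  note [simp] = mlimD(1-4)[OF assms(1)] mlimD(1-4)[OF assms(2)]
  fix i j assume ij: "i < a * c" "j < b * d"
  then show "(\<lambda>k. kron (X k) (Y k) $$ (i,j)) \<longlonglongrightarrow> kron L K $$ (i,j)"
    by (simp add: kron_index)
      (intro tendsto_mult mlimD(5)[OF assms(1)] mlimD(5)[OF assms(2)] less_mult_div_mod; simp)
qed (use mlimD(1-4)[OF assms(1)] mlimD(1-4)[OF assms(2)] in auto)

lemma mlim_ptrR: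
  assumes "mlim (a*b) (a*b) X L" shows "mlim a a (\<lambda>k. ptrR a b (X k)) (ptrR a b L)"
proof (rule mlimI)
  fix i j assume ij: "i < a" "j < a"
  then show "(\<lambda>k. ptrR a b (X k) $$ (i,j)) \<longlonglongrightarrow> ptrR a b L $$ (i,j)"
    by (simp add: ptrR_def) (intro tendsto_sum mlimD(5)[OF assms(1)] pair_index_less; simp)
qed auto

lemma mlim_ptrL:
  assumes "mlim (a*b) (a*b) X L" shows "mlim b b (\<lambda>k. ptrL a b (X k)) (ptrL a b L)"
proof (rule mlimI)
  fix i j assume ij: "i < b" "j < b"
  then show "(\<lambda>k. ptrL a b (X k) $$ (i,j)) \<longlonglongrightarrow> ptrL a b L $$ (i,j)"
    by (simp add: ptrL_def) (intro tendsto_sum mlimD(5)[OF assms(1)] pair_index_less; simp)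
qed auto

lemma mlim_pow:
  assumes "mlim n n X L" shows "mlim n n (\<lambda>k. X k ^\<^sub>m p) (L ^\<^sub>m p)"
proof (induction p)
  case 0
  then show ?case using mlimD(1-4)[OF assms] mlim_const[of "1\<^sub>m n" n n] by simp
next
  case (Suc p)
  then show ?case using mlim_mult[OF Suc assms] by simp
qed

lemma mlim_mtrace:
  assumes "mlim n n X L" shows "(\<lambda>k. mtrace (X k)) \<longlonglongrightarrow> mtrace L"
  unfolding mtrace_def mlimD(1,3)[OF assms]
  by (intro tendsto_sum mlimD(5)[OF assms]) auto

text \<open>Three-epsilon argument: the polynomial in power traces converges, and its distance to
  the entropy is uniformly small along the sequence because the traces, hence the spectra, are
  bounded.\<close>

lemma tendsto_eta:
  assumes lim: "mlim n n X L" and X: "\<And>k. psd n (X k)" and L: "psd n L"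
  shows "(\<lambda>k. eta (X k)) \<longlonglongrightarrow> eta L"
proof (rule LIMSEQ_I)
  fix r :: real assume r: "0 < r"
  have "(\<lambda>k. Re (mtrace (X k))) \<longlonglongrightarrow> Re (mtrace L)"
    by (intro tendsto_Re mlim_mtrace[OF lim])
  then have "Bseq (\<lambda>k. Re (mtrace (X k)))" by (intro convergent_imp_Bseq convergentI)
  then obtain c0 where c0: "\<And>k. \<bar>Re (mtrace (X k))\<bar> \<le> c0" by (auto simp: Bseq_def)
  define c where "c = max c0 (Re (mtrace L))"
  \<comment> \<open>The extra 1 in the denominator makes \<open>n * e\<close> strictly less than
    \<open>r / 3\<close> and avoids division by 0 at \<open>n = 0\<close>.\<close>
  define e where "e = r / (3 * (real n + 1))"
  have e: "0 < e" using r by (simp add: e_def)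
  have ne: "real n * e < r / 3" using r by (simp add: e_def field_simps)
  obtain a N where a: "\<And>x. 0 \<le> x \<Longrightarrow> x \<le> c \<Longrightarrow> \<bar>xlnx x - (\<Sum>k=1..N. a k * x ^ k)\<bar> < e"
    by (rule xlnx_poly_approx[OF e, of c], rule that)
  define P where "P M = (\<Sum>k=1..N. a k * Re (mtrace (M ^\<^sub>m k)))" for M :: "complex mat"
  have "(\<lambda>k. P (X k)) \<longlonglongrightarrow> P L"
    unfolding P_def by (intro tendsto_intros mlim_mtrace[of n] mlim_pow lim)
  then obtain K where K: "\<And>k. K \<le> k \<Longrightarrow> \<bar>P (X k) - P L\<bar> < r / 3"
    using LIMSEQ_D[of "\<lambda>k. P (X k)" "P L" "r/3"] r by (metis real_norm_def zero_less_divide_iff zero_less_numeral)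
  have 1: "\<bar>eta (X k) - P (X k)\<bar> \<le> real n * e" for k
    unfolding P_def by (rule eta_poly_approx[OF X _ a]) (use c0[of k] in \<open>auto simp: c_def\<close>)
  have 2: "\<bar>eta L - P L\<bar> \<le> real n * e"
    unfolding P_def by (rule eta_poly_approx[OF L _ a]) (auto simp: c_def)
  have "\<bar>eta (X k) - eta L\<bar> < r" if "K \<le> k" for k
  proof -
    have "eta (X k) - eta L = (eta (X k) - P (X k)) + (P (X k) - P L) - (eta L - P L)" by simp
    also have "\<bar>\<dots>\<bar> \<le> \<bar>eta (X k) - P (X k)\<bar> + \<bar>P (X k) - P L\<bar> + \<bar>eta L - P L\<bar>" by linarith
    finally show ?thesis using K[OF that] ne 1[of k] 2 by linarith
  qed
  then show "\<exists>no. \<forall>k\<ge>no. norm (eta (X k) - eta L) < r" by auto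
qed

section \<open>Extremal points of the measurements on a factor\<close>

text \<open>Elimination of one equation: a pivot \<open>p\<close> with nonzero coefficient solves
  the last equation, and substituting it leaves \<open>n\<close> equations in one unknown
  fewer.\<close>

lemma nontrivial_solution:
  fixes v :: "nat \<Rightarrow> 'a \<Rightarrow> complex"
  assumes "finite J" "n < card J"
  shows "\<exists>a. (\<exists>j\<in>J. a j \<noteq> 0) \<and> (\<forall>i<n. (\<Sum>j\<in>J. a j * v i j) = 0)"
  using assms
proof (induction n arbitrary: J v)
  case 0
  then have "J \<noteq> {}" by auto
  then show ?case by (intro exI[of _ "\<lambda>_. 1"]) auto
next
  case (Suc n)
  show ?case
  proof (cases "\<forall>j\<in>J. v n j = 0")
    case True
    obtain a where "\<exists>j\<in>J. a j \<noteq> 0" "\<forall>i<n. (\<Sum>j\<in>J. a j * v i j) = 0"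
      using Suc.IH[of J v] Suc.prems by auto
    with True show ?thesis by (intro exI[of _ a]) (auto simp: less_Suc_eq)
  next
    case False
    then obtain p where p: "p \<in> J" "v n p \<noteq> 0" by auto
    define J' where "J' = J - {p}"
    have J': "finite J'" "n < card J'" "p \<notin> J'" "J = insert p J'"
      using Suc.prems p by (auto simp: J'_def)
    obtain a where a: "\<exists>j\<in>J'. a j \<noteq> 0"
      and eq: "\<And>i. i < n \<Longrightarrow> (\<Sum>j\<in>J'. a j * (v i j - v i p * v n j / v n p)) = 0"
      using Suc.IH[OF J'(1,2), of "\<lambda>i j. v i j - v i p * v n j / v n p"] by auto
    define s where "s = (\<Sum>j\<in>J'. a j * v n j)"
    define b where "b = a(p := - s / v n p)"
    have sum_b: "(\<Sum>j\<in>J. b j * v i j) = (\<Sum>j\<in>J'. a j * v i j) - s / v n p * v i p" for i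
    proof -
      have "(\<Sum>j\<in>J'. b j * v i j) = (\<Sum>j\<in>J'. a j * v i j)"
        by (intro sum.cong) (use J' in \<open>auto simp: b_def\<close>)
      then show ?thesis using J' by (simp add: b_def)
    qed
    have "(\<Sum>j\<in>J. b j * v i j) = 0" if "i < n" for i
    proof -
      have "(\<Sum>j\<in>J'. a j * (v i j - v i p * v n j / v n p))
          = (\<Sum>j\<in>J'. a j * v i j - v i p / v n p * (a j * v n j))"
        by (intro sum.cong) (auto simp: algebra_simps)
      also have "\<dots> = (\<Sum>j\<in>J'. a j * v i j) - v i p / v n p * s"
        by (simp only: sum_subtractf sum_distrib_left s_def)
      finally show ?thesis
        using eq[OF that] unfolding sum_b by (simp add: mult.commute)
    qed
    moreover have "(\<Sum>j\<in>J. b j * v n j) = 0" unfolding sum_b using p by (simp add: s_def)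
    moreover have "\<exists>j\<in>J. b j \<noteq> 0" using a J' by (auto simp: b_def)
    ultimately show ?thesis by (intro exI[of _ b]) (auto simp: less_Suc_eq)
  qed
qed

section \<open>Walking to the boundary of the positive orthant\<close>

lemma exists_neg_of_weighted_sum_zero:
  fixes x c :: "'a \<Rightarrow> real"
  assumes "finite I" "\<forall>i\<in>I. 0 < c i" "(\<Sum>i\<in>I. c i * x i) = 0" "\<exists>i\<in>I. x i \<noteq> 0"
  shows "\<exists>i\<in>I. x i < 0"
proof (rule ccontr)
  assume "\<not> ?thesis"
  then have nn: "\<And>i. i \<in> I \<Longrightarrow> 0 \<le> c i * x i" using assms(2) by (force intro: mult_nonneg_nonneg)
  then have "\<forall>i\<in>I. c i * x i = 0" using assms(1,3) by (subst (asm) sum_nonneg_eq_0_iff) auto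
  then show False using assms(2,4) by fastforce
qed

text \<open>A vanishing sum with positive weights forces a negative coordinate; along the ray the
  most negative one, \<open>x j\<close>, reaches 0 first, at \<open>t = - 1 / x j\<close>.\<close>

lemma boundary_step:
  fixes x c :: "'a \<Rightarrow> real"
  assumes "finite I" "\<forall>i\<in>I. 0 < c i" "(\<Sum>i\<in>I. c i * x i) = 0" "\<exists>i\<in>I. x i \<noteq> 0"
  obtains t j where "0 < t" "j \<in> I" "1 + t * x j = 0" "\<And>i. i \<in> I \<Longrightarrow> 0 \<le> 1 + t * x i"
proof -
  obtain i where i: "i \<in> I" "x i < 0" using exists_neg_of_weighted_sum_zero[OF assms] by auto
  obtain j where j: "j \<in> I" "\<And>k. k \<in> I \<Longrightarrow> x j \<le> x k"
    using arg_min_if_finite[OF assms(1), of x] i(1) by (metis empty_iff not_less)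
  then have xj: "x j < 0" using i by force
  show thesis
  proof (rule that[of "- 1 / x j" j])
    fix k assume "k \<in> I"
    then show "0 \<le> 1 + - 1 / x j * x k" using j(2)[of k] xj by (simp add: field_simps)
  qed (use j xj in \<open>auto simp: field_simps\<close>)
qed

text \<open>Moving from \<open>1\<close> along \<open>x\<close> in both directions until a coordinate vanishes.\<close>

lemma boundary_segment:
  fixes x c :: "'a \<Rightarrow> real"
  assumes "finite I" "\<forall>i\<in>I. 0 < c i" "(\<Sum>i\<in>I. c i * x i) = 0" "\<exists>i\<in>I. x i \<noteq> 0"
  obtains t1 t2 w1 w2 j1 j2 where "0 \<le> w1" "0 \<le> w2" "w1 + w2 = (1::real)" "w1 * t1 + w2 * t2 = 0"
    "j1 \<in> I" "1 + t1 * x j1 = 0" "\<And>i. i \<in> I \<Longrightarrow> 0 \<le> 1 + t1 * x i"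
    "j2 \<in> I" "1 + t2 * x j2 = 0" "\<And>i. i \<in> I \<Longrightarrow> 0 \<le> 1 + t2 * x i"
proof -
  obtain t1 j1 where 1: "0 < t1" "j1 \<in> I" "1 + t1 * x j1 = 0" "\<And>i. i \<in> I \<Longrightarrow> 0 \<le> 1 + t1 * x i"
    by (rule boundary_step[OF assms], rule that)
  obtain t2 j2 where 2: "0 < t2" "j2 \<in> I" "1 + t2 * - x j2 = 0" "\<And>i. i \<in> I \<Longrightarrow> 0 \<le> 1 + t2 * - x i"
    by (rule boundary_step[OF assms(1,2), of "\<lambda>i. - x i"], use assms in \<open>auto simp: sum_negf\<close>)
  show thesis
  \<comment> \<open>These weights make 0 the average of the steps \<open>t1\<close> and
    \<open>- t2\<close>, so the two endpoints average to the starting point.\<close>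
  proof (rule that[of "t2 / (t1 + t2)" "t1 / (t1 + t2)" t1 "- t2" j1 j2])
    show "t2 / (t1 + t2) + t1 / (t1 + t2) = 1"
      using 1(1) 2(1) by (simp add: add_divide_distrib[symmetric] add.commute)
  qed (use 1 2 in auto)
qed

lemma bij_betw_skip:
  assumes "i0 < Suc m"
  shows "bij_betw (\<lambda>a. if a < i0 then a else Suc a) {..<m} ({..<Suc m} - {i0})"
proof (rule bij_betw_imageI)
  show "inj_on (\<lambda>a. if a < i0 then a else Suc a) {..<m}" by (auto simp: inj_on_def split: if_splits)
  show "(\<lambda>a. if a < i0 then a else Suc a) ` {..<m} = {..<Suc m} - {i0}"
  proof (intro equalityI subsetI)
    fix b assume b: "b \<in> {..<Suc m} - {i0}"
    show "b \<in> (\<lambda>a. if a < i0 then a else Suc a) ` {..<m}"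
    proof (cases "b < i0")
      case True
      then show ?thesis using b assms by (intro image_eqI[of _ _ b]) auto
    next
      case False
      then show ?thesis using b assms by (intro image_eqI[of _ _ "b - 1"]) auto
    qed
  qed (use assms in auto)
qed

text \<open>Scaling the rows of \<open>adj U\<close> by the roots of the eigenvalues gives a Gram
  factor; the row of the zero eigenvalue vanishes and can be deleted, which lowers the dimension by
  one.\<close>

lemma singular_gram:
  assumes U: "unitary_m (Suc m) U" and d: "\<And>i. i < Suc m \<Longrightarrow> 0 \<le> d i" and i0: "i0 < Suc m" "d i0 = 0"
  obtains Q where "Q \<in> carrier_mat m (Suc m)" "adj Q * Q = U * rdiag (Suc m) d * adj U"
proof -
  note [simp] = unitaryD[OF U]
  let ?s = "\<lambda>a. if a < i0 then a else Suc a"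
  define Q where "Q = mat m (Suc m) (\<lambda>(a,b). complex_of_real (sqrt (d (?s a))) * adj U $$ (?s a, b))"
  have dQ [simp]: "dim_row Q = m" "dim_col Q = Suc m" by (auto simp: Q_def)
  have s: "?s a < Suc m" if "a < m" for a using that by auto
  have "adj Q * Q = U * (rdiag (Suc m) d * adj U)"
  proof (rule eq_matI)
    fix i j assume "i < dim_row (U * (rdiag (Suc m) d * adj U))" "j < dim_col (U * (rdiag (Suc m) d * adj U))"
    then have ij: "i < Suc m" "j < Suc m" by auto
    define f where "f c = U $$ (i,c) * (complex_of_real (d c) * cnj (U $$ (j,c)))" for c
    have "(adj Q * Q) $$ (i,j) = (\<Sum>a<m. f (?s a))"
    proof (subst index_mult_sum)
      show "(\<Sum>k<dim_col (adj Q). adj Q $$ (i, k) * Q $$ (k, j)) = (\<Sum>a<m. f (?s a))"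
      proof (intro sum.cong)
        fix a assume "a \<in> {..<m}"
        then have a: "a < m" by simp
        have "complex_of_real (sqrt (d (?s a))) * complex_of_real (sqrt (d (?s a))) = complex_of_real (d (?s a))"
          using d[OF s[OF a]] by (simp flip: of_real_mult del: if_split)
        then show "adj Q $$ (i, a) * Q $$ (a, j) = f (?s a)"
          using a ij s[OF a] by (simp add: Q_def f_def mult_ac del: if_split)
      qed auto
    qed (use ij in auto)
    also have "\<dots> = (\<Sum>c\<in>{..<Suc m} - {i0}. f c)"
      by (rule sum.reindex_bij_betw[OF bij_betw_skip[OF i0(1)]])
    also have "\<dots> = (\<Sum>c<Suc m. f c)"
      by (intro sum.mono_neutral_left) (use i0 in \<open>auto simp: f_def\<close>)
    also have "\<dots> = (U * (rdiag (Suc m) d * adj U)) $$ (i,j)"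
      using ij by (subst index_mult_sum) (auto simp: f_def rdiag_mult_index simp del: index_mult_mat(1) sum.lessThan_Suc)
    finally show "(adj Q * Q) $$ (i,j) = (U * (rdiag (Suc m) d * adj U)) $$ (i,j)" .
  qed auto
  then show thesis by (intro that[of Q]) (auto simp: mult_assoc_dim intro!: carrier_matI)
qed

text \<open>Vanishing trace makes \<open>boundary_segment\<close> apply to the eigenvalues with all
  weights 1. At both endpoints \<open>1 + t N\<close> is positive and singular, hence factors
  through dimension \<open>m\<close>.\<close>

lemma extremal_pair:
  assumes N: "N \<in> carrier_mat (Suc m) (Suc m)" "adj N = N" "N \<noteq> 0\<^sub>m (Suc m) (Suc m)" "mtrace N = 0"
  obtains w1 w2 t1 t2 Q1 Q2 where "0 \<le> w1" "0 \<le> w2" "w1 + w2 = (1::real)"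
    "w1 * t1 + w2 * t2 = 0" "Q1 \<in> carrier_mat m (Suc m)" "Q2 \<in> carrier_mat m (Suc m)"
    "adj Q1 * Q1 = 1\<^sub>m (Suc m) + complex_of_real t1 \<cdot>\<^sub>m N"
    "adj Q2 * Q2 = 1\<^sub>m (Suc m) + complex_of_real t2 \<cdot>\<^sub>m N"
proof -
  let ?n = "Suc m"
  obtain U x where U: "unitary_m ?n U" and Nd: "N = U * rdiag ?n x * adj U"
    by (rule spectral[OF N(1,2)], rule that)
  note [simp] = unitaryD[OF U]
  have x0: "(\<Sum>i<?n. 1 * x i) = 0"
    using N(4) unfolding Nd mtrace_unitary_conj[OF U rdiag_carrier] mtrace_rdiag of_real_eq_0_iff by simp
  have nz: "\<exists>i\<in>{..<?n}. x i \<noteq> 0"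
  proof (rule ccontr)
    assume "\<not> ?thesis"
    then have "rdiag ?n x = 0\<^sub>m ?n ?n" by (intro eq_matI) (auto simp: rdiag_index)
    then show False using N(3) unfolding Nd by simp
  qed
  obtain w1 w2 t1 t2 i1 i2 where *: "0 \<le> w1" "0 \<le> w2" "w1 + w2 = (1::real)" "w1 * t1 + w2 * t2 = 0"
    "i1 \<in> {..<?n}" "1 + t1 * x i1 = 0" "\<And>i. i \<in> {..<?n} \<Longrightarrow> 0 \<le> 1 + t1 * x i"
    "i2 \<in> {..<?n}" "1 + t2 * x i2 = 0" "\<And>i. i \<in> {..<?n} \<Longrightarrow> 0 \<le> 1 + t2 * x i"
    by (rule boundary_segment[OF finite_lessThan _ x0 nz], simp, rule that)
  have shift: "U * rdiag ?n (\<lambda>i. 1 + t * x i) * adj U = 1\<^sub>m ?n + complex_of_real t \<cdot>\<^sub>m N" for t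
  proof -
    have "rdiag ?n (\<lambda>i. 1 + t * x i) = 1\<^sub>m ?n + complex_of_real t \<cdot>\<^sub>m rdiag ?n x"
      by (rule eq_matI) (auto simp: rdiag_index)
    then show ?thesis unfolding Nd
      by (simp add: add_mult_dim mult_add_dim mult_smult_dim smult_mult_dim mult_assoc_dim)
  qed
  obtain Q1 where "Q1 \<in> carrier_mat m ?n" "adj Q1 * Q1 = U * rdiag ?n (\<lambda>i. 1 + t1 * x i) * adj U"
    by (rule singular_gram[OF U, of "\<lambda>i. 1 + t1 * x i" i1]) (use * in auto)
  moreover obtain Q2 where "Q2 \<in> carrier_mat m ?n" "adj Q2 * Q2 = U * rdiag ?n (\<lambda>i. 1 + t2 * x i) * adj U"
    by (rule singular_gram[OF U, of "\<lambda>i. 1 + t2 * x i" i2]) (use * in auto)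
  ultimately show thesis unfolding shift using that *(1-4) by blast
qed

text \<open>\<open>N + adj N\<close> and \<open>\<i>\<close> times \<open>N - adj N\<close> are
  Hermitian and cannot both vanish. \<open>P\<close> stands for a linear condition satisfied by
  \<open>N\<close> and its adjoint.\<close>

lemma hermitian_part_nonzero:
  assumes N: "N \<in> carrier_mat n n" "N \<noteq> 0\<^sub>m n n" "P N" "P (adj N)"
    and add: "\<And>A B. A \<in> carrier_mat n n \<Longrightarrow> B \<in> carrier_mat n n \<Longrightarrow> P A \<Longrightarrow> P B \<Longrightarrow> P (A + B)"
    and smult: "\<And>c A. A \<in> carrier_mat n n \<Longrightarrow> P A \<Longrightarrow> P (c \<cdot>\<^sub>m A)"
  obtains H where "H \<in> carrier_mat n n" "adj H = H" "H \<noteq> 0\<^sub>m n n" "P H"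
proof -
  note [simp] = carrier_matD[OF N(1)]
  define H1 where "H1 = N + adj N"
  define H2 where "H2 = \<i> \<cdot>\<^sub>m N + (- \<i>) \<cdot>\<^sub>m adj N"
  have c: "H1 \<in> carrier_mat n n" "H2 \<in> carrier_mat n n" by (auto simp: H1_def H2_def intro!: carrier_matI)
  have h: "adj H1 = H1" "adj H2 = H2"
    by (auto simp: H1_def H2_def intro!: eq_matI)
  have p: "P H1" "P H2" unfolding H1_def H2_def using N by (auto intro!: add smult)
  have "H1 \<noteq> 0\<^sub>m n n \<or> H2 \<noteq> 0\<^sub>m n n"
  proof (rule ccontr)
    assume "\<not> ?thesis"
    then have z: "H1 = 0\<^sub>m n n" "H2 = 0\<^sub>m n n" by auto
    have "N $$ (i,j) = 0" if "i < n" "j < n" for i j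
      using arg_cong[OF z(1), of "\<lambda>X. X $$ (i,j)"] arg_cong[OF z(2), of "\<lambda>X. X $$ (i,j)"] that
      by (simp add: H1_def H2_def)
    then have "N = 0\<^sub>m n n" by (intro eq_matI) auto
    then show False using N by simp
  qed
  then show thesis using that c h p by blast
qed

text \<open>A Hermitian traceless solution of \<open>d * d\<close> linear equations; imposing zero trace forces
  eigenvalues of both signs and costs one more equation, still fewer than \<open>(d + 1)\<^sup>2\<close>.\<close>

lemma traceless_kernel:
  assumes d: "0 < d" "d < r" and K: "\<And>c e. K c e \<in> carrier_mat (r) (r)"
    and \<Phi>: "\<And>N c e. N \<in> carrier_mat (r) (r) \<Longrightarrow> c < d \<Longrightarrow> e < d \<Longrightarrow> \<Phi> N $$ (c,e) = mtrace (K c e * N)"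
    and \<Phi>_dim: "\<And>N. N \<in> carrier_mat (r) (r) \<Longrightarrow> \<Phi> N \<in> carrier_mat d d"
    and \<Phi>_adj: "\<And>N. N \<in> carrier_mat (r) (r) \<Longrightarrow> \<Phi> (adj N) = adj (\<Phi> N)"
  obtains N where "N \<in> carrier_mat (r) (r)" "adj N = N" "N \<noteq> 0\<^sub>m (r) (r)" "mtrace N = 0"
    "\<Phi> N = 0\<^sub>m d d"
proof -
  \<comment> \<open>The last equation, of index \<open>d * d\<close>, pairs with the identity and
    expresses zero trace.\<close>
  define eqn where "eqn k = (if k < d * d then K (k div d) (k mod d) else 1\<^sub>m r)" for k
  have eqn [simp]: "eqn k \<in> carrier_mat r r" for k using K by (simp add: eqn_def)
  have "d * d + 1 < card {..<r * r}"
  proof -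
    have "d * d + 1 < d * d + 2 * d + 1" using d(1) by simp
    also have "\<dots> = Suc d * Suc d" by (simp add: algebra_simps)
    also have "\<dots> \<le> r * r" using d(2) by (intro mult_le_mono) auto
    finally show ?thesis by simp
  qed
  \<comment> \<open>Coefficients are read transposed, so that equation \<open>k\<close> says that
    the trace of \<open>eqn k * N\<close> is 0.\<close>
  from nontrivial_solution[OF finite_lessThan this, of "\<lambda>k j. eqn k $$ (j mod r, j div r)"]
  obtain a where a: "\<exists>j<r * r. a j \<noteq> 0"
    and sol: "\<And>k. k < d * d + 1 \<Longrightarrow> (\<Sum>j<r*r. a j * eqn k $$ (j mod r, j div r)) = 0"
    by auto
  define N where "N = mat r r (\<lambda>(i,j). a (i * r + j))"
  have N: "N \<in> carrier_mat r r" by (simp add: N_def)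
  have tr: "mtrace (eqn k * N) = 0" if "k < d * d + 1" for k
  proof -
    have "mtrace (eqn k * N) = mtrace (N * eqn k)"
      using carrier_matD[OF eqn[of k]] N by (intro mtrace_comm) auto
    also have "\<dots> = (\<Sum>i<r. \<Sum>j<r. a (i * r + j) * eqn k $$ (j,i))"
      using carrier_matD[OF eqn[of k]] by (subst mtrace_mult) (auto simp: N_def simp del: sum.lessThan_Suc)
    also have "\<dots> = (\<Sum>j<r*r. a j * eqn k $$ (j mod r, j div r))"
      unfolding sum_prod_nat by (intro sum.cong refl) simp
    finally show ?thesis using sol[OF that] by simp
  qed
  define P where "P M \<longleftrightarrow> mtrace M = 0 \<and> (\<forall>c<d. \<forall>e<d. mtrace (K c e * M) = 0)" for M
  have P_iff: "P M \<longleftrightarrow> mtrace M = 0 \<and> \<Phi> M = 0\<^sub>m d d" if "M \<in> carrier_mat r r" for M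
    using \<Phi>[OF that] \<Phi>_dim[OF that] unfolding P_def by (auto intro!: eq_matI)
  have PN: "P N"
    unfolding P_def
  proof (intro conjI allI impI)
    have "N = eqn (d * d) * N" using N by (simp add: eqn_def)
    then show "mtrace N = 0" using tr[of "d * d"] by simp
    fix c e assume ce: "c < d" "e < d"
    then have "c * d + e < d * d" by (rule pair_index_less)
    then show "mtrace (K c e * N) = 0" using tr[of "c * d + e"] ce by (simp add: eqn_def)
  qed
  have nz: "N \<noteq> 0\<^sub>m r r"
  proof
    assume z: "N = 0\<^sub>m r r"
    obtain j where j: "j < r * r" "a j \<noteq> 0" using a by auto
    have "N $$ (j div r, j mod r) = a j"
      using less_mult_div_mod[OF j(1)] unfolding N_def by simp
    then show False using j less_mult_div_mod[OF j(1)] unfolding z by simp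
  qed
  have PN': "P (adj N)"
  proof -
    have "mtrace (adj N) = cnj (mtrace N)" using N by (auto simp: mtrace_def simp del: sum.lessThan_Suc)
    then show ?thesis using PN N \<Phi>_adj[OF N] by (simp add: P_iff)
  qed
  have padd: "P (A + B)" if "A \<in> carrier_mat r r" "B \<in> carrier_mat r r" "P A" "P B" for A B
  proof -
    note [simp] = carrier_matD[OF that(1)] carrier_matD[OF that(2)] carrier_matD[OF K]
    have "K c e * (A + B) = K c e * A + K c e * B" for c e by (rule mult_add_dim) auto
    then have "mtrace (K c e * (A + B)) = mtrace (K c e * A) + mtrace (K c e * B)" for c e
      by (simp only:) (rule mtrace_add[of _ r]; auto intro!: carrier_matI)
    then show ?thesis using that(3,4) mtrace_add[OF that(1,2)] by (auto simp: P_def)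
  qed
  have psmult: "P (c \<cdot>\<^sub>m A)" if "A \<in> carrier_mat r r" "P A" for c A
  proof -
    note [simp] = carrier_matD[OF that(1)] carrier_matD[OF K]
    have "K a b * (c \<cdot>\<^sub>m A) = c \<cdot>\<^sub>m (K a b * A)" for a b by (rule mult_smult_dim) auto
    then have "mtrace (K a b * (c \<cdot>\<^sub>m A)) = c * mtrace (K a b * A)" for a b
      by (simp only:) (rule mtrace_smult[of _ r]; auto intro!: carrier_matI)
    then show ?thesis using that(2) mtrace_smult[OF that(1)] by (auto simp: P_def)
  qed
  obtain H where "H \<in> carrier_mat r r" "adj H = H" "H \<noteq> 0\<^sub>m r r" "P H"
    by (rule hermitian_part_nonzero[of N r P, OF N nz PN PN']) (blast intro: padd psmult that)+
  then show thesis using that P_iff by blast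
qed

section \<open>Cost of a block and reduction of its dimensions\<close>

definition extend :: "nat \<Rightarrow> nat \<Rightarrow> complex mat \<Rightarrow> complex mat" where
  "extend a c V = kron (kron (1\<^sub>m a) V) (1\<^sub>m c)"

text \<open>The unnormalised output of the measurement operator \<open>V\<close> on the middle
  system; for a state and a complete family of operators, its trace is the probability of the
  outcome.\<close>

definition block_out :: "nat \<Rightarrow> nat \<Rightarrow> complex mat \<Rightarrow> complex mat \<Rightarrow> complex mat" where
  "block_out a c V \<rho> = extend a c V * \<rho> * adj (extend a c V)"

text \<open>The block is a product of dimensions \<open>l\<close> and \<open>r\<close>; the same
  index set is bracketed as \<open>(a * l) * (r * c)\<close>, so that \<open>A\<close> joins the
  left factor and \<open>C\<close> the right one.\<close>

definition margL :: "nat \<Rightarrow> nat \<Rightarrow> nat \<Rightarrow> nat \<Rightarrow> complex mat \<Rightarrow> complex mat \<Rightarrow> complex mat" where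
  "margL a c l r V \<rho> = ptrR (a * l) (r * c) (block_out a c V \<rho>)"

definition margR :: "nat \<Rightarrow> nat \<Rightarrow> nat \<Rightarrow> nat \<Rightarrow> complex mat \<Rightarrow> complex mat \<Rightarrow> complex mat" where
  "margR a c l r V \<rho> = ptrL (a * l) (r * c) (block_out a c V \<rho>)"

text \<open>The contribution of one block to the relative entropy from \<open>\<rho>\<close> to the best Markov state
  with given block isometries, where \<open>V\<close> is the component of the embedding of \<open>B\<close> in that block.\<close>

definition cost :: "nat \<Rightarrow> nat \<Rightarrow> nat \<Rightarrow> nat \<Rightarrow> complex mat \<Rightarrow> complex mat \<Rightarrow> real" where
  "cost a c l r V \<rho> = eta (margL a c l r V \<rho>) + eta (margR a c l r V \<rho>)
      - xlnx (Re (mtrace (block_out a c V \<rho>)))"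

lemma extend_dim [simp]: "dim_row (extend a c V) = a * dim_row V * c" "dim_col (extend a c V) = a * dim_col V * c"
  by (auto simp: extend_def)

lemma block_out_dim [simp]: "dim_row (block_out a c V \<rho>) = a * dim_row V * c"
  "dim_col (block_out a c V \<rho>) = a * dim_row V * c"
  by (auto simp: block_out_def)

lemma margR_carrier [simp]: "margR a c l r V \<rho> \<in> carrier_mat (r*c) (r*c)"
  by (simp add: margR_def)

lemma extend_mult: "dim_col V = dim_row W \<Longrightarrow> extend a c (V * W) = extend a c V * extend a c W"
  by (simp add: extend_def kron_mult)

lemma adj_extend: "adj (extend a c V) = extend a c (adj V)"
  by (simp add: extend_def adj_kron)

lemma extend_one [simp]: "extend a c (1\<^sub>m n) = 1\<^sub>m (a * n * c)"
  by (simp add: extend_def)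

lemma extend_kron: "extend a c (kron L R) = kron (kron (1\<^sub>m a) L) (kron R (1\<^sub>m c))"
  by (simp add: extend_def kron_assoc)

lemma block_out_carrier:
  "V \<in> carrier_mat (l*r) d \<Longrightarrow> block_out a c V \<rho> \<in> carrier_mat (a * l * (r * c)) (a * l * (r * c))"
  by (auto simp: mult.assoc intro!: carrier_matI)

lemma psd_block_out:
  assumes "psd (a*d*c) \<rho>" "V \<in> carrier_mat n d" shows "psd (a*n*c) (block_out a c V \<rho>)"
  unfolding block_out_def by (rule psd_sandwich[OF assms(1)]) (use assms(2) in \<open>auto intro!: carrier_matI\<close>)

lemma psd_block_out':
  assumes "psd (a*d*c) \<rho>" "V \<in> carrier_mat (l*r) d" shows "psd (a*l*(r*c)) (block_out a c V \<rho>)"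
  using psd_block_out[OF assms] by (simp add: mult.assoc)

lemma psd_marg:
  assumes "psd (a*d*c) \<rho>" "V \<in> carrier_mat (l*r) d"
  shows "psd (a*l) (margL a c l r V \<rho>)" "psd (r*c) (margR a c l r V \<rho>)"
  unfolding margL_def margR_def by (intro psd_ptrR psd_ptrL psd_block_out'[OF assms])+

text \<open>The probability of an outcome depends only on its effect \<open>adj V * V\<close>; all
  reductions keep this matrix or its sum over blocks.\<close>

lemma mtrace_block_out:
  assumes \<rho>: "\<rho> \<in> carrier_mat (a*d*c) (a*d*c)" and V: "dim_col V = d"
  shows "mtrace (block_out a c V \<rho>) = mtrace (\<rho> * extend a c (adj V * V))"
proof -
  note [simp] = carrier_matD[OF \<rho>] V
  have "mtrace (block_out a c V \<rho>) = mtrace (extend a c V * (\<rho> * adj (extend a c V)))"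
    by (simp add: block_out_def mult_assoc_dim)
  also have "\<dots> = mtrace ((\<rho> * adj (extend a c V)) * extend a c V)" by (rule mtrace_comm) auto
  also have "(\<rho> * adj (extend a c V)) * extend a c V = \<rho> * extend a c (adj V * V)"
    by (simp add: adj_extend extend_mult mult_assoc_dim)
  finally show ?thesis .
qed

lemma mtrace_marg:
  assumes "V \<in> carrier_mat (l*r) d"
  shows "mtrace (margL a c l r V \<rho>) = mtrace (block_out a c V \<rho>)"
    "mtrace (margR a c l r V \<rho>) = mtrace (block_out a c V \<rho>)"
  unfolding margL_def margR_def by (intro mtrace_ptr block_out_carrier[OF assms])+

lemma block_out_kron:
  assumes "\<rho> \<in> carrier_mat (a*d*c) (a*d*c)" "V \<in> carrier_mat (l*r) d" "dim_col L = l" "dim_col R = r"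
  shows "block_out a c (kron L R * V) \<rho> = kron (kron (1\<^sub>m a) L) (kron R (1\<^sub>m c)) * block_out a c V \<rho> *
     adj (kron (kron (1\<^sub>m a) L) (kron R (1\<^sub>m c)))"
proof -
  note [simp] = carrier_matD[OF assms(1)] carrier_matD[OF assms(2)] assms(3,4)
  show ?thesis
    unfolding extend_kron[symmetric] by (simp add: block_out_def extend_mult adj_mult mult_assoc_dim mult.assoc)
qed

text \<open>An operator on one factor conjugates the marginal that contains this factor and enters
  the other marginal only through its Gram matrix, where the dependence is linear. The reductions
  rest on this asymmetry.\<close>

lemma
  assumes \<rho>: "\<rho> \<in> carrier_mat (a*d*c) (a*d*c)" and V: "V \<in> carrier_mat (l*r) d"
    and L: "L \<in> carrier_mat l' l" and R: "R \<in> carrier_mat r' r"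
  shows margL_kron: "margL a c l' r' (kron L R * V) \<rho> = kron (1\<^sub>m a) L *
      ptrR (a*l) (r*c) (block_out a c V \<rho> * kron (1\<^sub>m (a*l)) (kron (adj R * R) (1\<^sub>m c))) * adj (kron (1\<^sub>m a) L)"
    and margR_kron: "margR a c l' r' (kron L R * V) \<rho> = kron R (1\<^sub>m c) *
      ptrL (a*l) (r*c) (block_out a c V \<rho> * kron (kron (1\<^sub>m a) (adj L * L)) (1\<^sub>m (r*c))) * adj (kron R (1\<^sub>m c))"
proof -
  note [simp] = carrier_matD[OF L] carrier_matD[OF R]
  have S: "kron (1\<^sub>m a) L \<in> carrier_mat (a*l') (a*l)" and T: "kron R (1\<^sub>m c) \<in> carrier_mat (r'*c) (r*c)"
    by (auto intro!: carrier_matI)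
  have SS: "adj (kron (1\<^sub>m a) L) * kron (1\<^sub>m a) L = kron (1\<^sub>m a) (adj L * L)"
    and TT: "adj (kron R (1\<^sub>m c)) * kron R (1\<^sub>m c) = kron (adj R * R) (1\<^sub>m c)"
    by (simp_all add: adj_kron kron_mult)
  note eq = block_out_kron[OF \<rho> V carrier_matD(2)[OF L] carrier_matD(2)[OF R]]
  show "margL a c l' r' (kron L R * V) \<rho> = kron (1\<^sub>m a) L *
      ptrR (a*l) (r*c) (block_out a c V \<rho> * kron (1\<^sub>m (a*l)) (kron (adj R * R) (1\<^sub>m c))) * adj (kron (1\<^sub>m a) L)"
    unfolding margL_def eq ptrR_sandwich[OF block_out_carrier[OF V] S T] TT ..
  show "margR a c l' r' (kron L R * V) \<rho> = kron R (1\<^sub>m c) *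
      ptrL (a*l) (r*c) (block_out a c V \<rho> * kron (kron (1\<^sub>m a) (adj L * L)) (1\<^sub>m (r*c))) * adj (kron R (1\<^sub>m c))"
    unfolding margR_def eq ptrL_sandwich[OF block_out_carrier[OF V] S T] SS ..
qed

lemma kron_mult_gram:
  assumes "V \<in> carrier_mat (l*r) d" "dim_col L = l" "dim_col R = r"
  shows "adj (kron L R * V) * (kron L R * V) = adj V * kron (adj L * L) (adj R * R) * V"
proof -
  note [simp] = carrier_matD[OF assms(1)] assms(2,3)
  have "adj (kron L R) * (kron L R * V) = kron (adj L * L) (adj R * R) * V"
    by (subst mult_assoc_dim[symmetric]) (auto simp: adj_kron kron_mult)
  then show ?thesis by (simp add: adj_mult mult_assoc_dim)
qed

text \<open>Isometries on the two factors conjugate the marginals by isometries and fix the effect.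
  This is used for padding a factor to a larger dimension.\<close>

lemma cost_isometry:
  assumes \<rho>: "psd (a*d*c) \<rho>" and V: "V \<in> carrier_mat (l*r) d"
    and L: "isometry l l' L" and R: "isometry r r' R"
  shows "cost a c l' r' (kron L R * V) \<rho> = cost a c l r V \<rho>"
    "adj (kron L R * V) * (kron L R * V) = adj V * V"
proof -
  note [simp] = isometryD(1-3)[OF L] isometryD(1-3)[OF R] carrier_matD[OF V]
  note c = psdD(1)[OF \<rho>] V isometryD(4)[OF L] isometryD(4)[OF R]
  show gram: "adj (kron L R * V) * (kron L R * V) = adj V * V"
    by (subst kron_mult_gram[OF V]) auto
  have 1: "isometry (a*l) (a*l') (kron (1\<^sub>m a) L)" "isometry (r*c) (r'*c) (kron R (1\<^sub>m c))"
    by (auto simp: isometry_def adj_kron kron_mult intro!: carrier_matI)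
  have X: "block_out a c V \<rho> * 1\<^sub>m (a*l*(r*c)) = block_out a c V \<rho>"
    by (simp add: mult.assoc)
  have "eta (margL a c l' r' (kron L R * V) \<rho>) = eta (margL a c l r V \<rho>)"
    unfolding margL_kron[OF c] by (simp add: X margL_def[symmetric] eta_isometry[OF psd_marg(1)[OF \<rho> V] 1(1)])
  moreover have "eta (margR a c l' r' (kron L R * V) \<rho>) = eta (margR a c l r V \<rho>)"
    unfolding margR_kron[OF c] by (simp add: X margR_def[symmetric] eta_isometry[OF psd_marg(2)[OF \<rho> V] 1(2)])
  moreover have "mtrace (block_out a c (kron L R * V) \<rho>) = mtrace (block_out a c V \<rho>)"
    by (subst (1 2) mtrace_block_out[OF psdD(1)[OF \<rho>]]) (auto simp: gram)
  ultimately show "cost a c l' r' (kron L R * V) \<rho> = cost a c l r V \<rho>"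
    by (simp add: cost_def)
qed

section \<open>Shrinking one factor of a block\<close>

lemma convex_min_le:
  fixes w1 :: real
  assumes "w1 * c1 + w2 * c2 \<le> c" "0 \<le> w1" "0 \<le> w2" "w1 + w2 = 1"
  shows "c1 \<le> c \<or> c2 \<le> c"
proof (rule ccontr)
  assume "\<not> ?thesis"
  then have h: "c < min c1 c2" by simp
  have "min c1 c2 = w1 * min c1 c2 + w2 * min c1 c2"
    using assms(4) by (simp flip: distrib_right)
  also have "\<dots> \<le> w1 * c1 + w2 * c2" using assms by (intro add_mono mult_left_mono) auto
  finally show False using h assms(1) by linarith
qed

text \<open>The left marginals of the two candidates average to that of \<open>V\<close>, so
  concavity applies directly; the right marginals are compressions, covered by
  \<open>eta_compress_le\<close>. The subtracted term is the same for all three because the effects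
  agree.\<close>

lemma cost_average_R:
  assumes \<rho>: "psd (a*d*c) \<rho>" and V: "V \<in> carrier_mat (l*r) d"
    and w: "0 \<le> w1" "0 \<le> w2" "w1 + w2 = 1"
    and Q: "Q1 \<in> carrier_mat m r" "Q2 \<in> carrier_mat m r"
    and avg: "complex_of_real w1 \<cdot>\<^sub>m (adj Q1 * Q1) + complex_of_real w2 \<cdot>\<^sub>m (adj Q2 * Q2) = 1\<^sub>m r"
    and gram: "\<And>Q. Q = Q1 \<or> Q = Q2 \<Longrightarrow> adj (kron (1\<^sub>m l) Q * V) * (kron (1\<^sub>m l) Q * V) = adj V * V"
  shows "w1 * cost a c l m (kron (1\<^sub>m l) Q1 * V) \<rho> + w2 * cost a c l m (kron (1\<^sub>m l) Q2 * V) \<rho> \<le> cost a c l r V \<rho>"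
proof -
  note [simp] = carrier_matD[OF V] carrier_matD[OF Q(1)] carrier_matD[OF Q(2)]
  let ?V = "\<lambda>Q. kron (1\<^sub>m l) Q * V"
  let ?X = "block_out a c V \<rho>"
  let ?K = "\<lambda>Q. kron (1\<^sub>m (a*l)) (kron (adj Q * Q) (1\<^sub>m c))"
  have V': "?V Q \<in> carrier_mat (l*m) d" if "Q \<in> carrier_mat m r" for Q
    using that by (auto intro!: carrier_matI)
  have mL: "margL a c l m (?V Q) \<rho> = ptrR (a*l) (r*c) (?X * ?K Q)" if "Q \<in> carrier_mat m r" for Q
    using margL_kron[OF psdD(1)[OF \<rho>] V one_carrier_mat that] by simp
  have mR: "margR a c l m (?V Q) \<rho> = kron Q (1\<^sub>m c) * margR a c l r V \<rho> * adj (kron Q (1\<^sub>m c))"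
    if "Q \<in> carrier_mat m r" for Q
    using margR_kron[OF psdD(1)[OF \<rho>] V one_carrier_mat that] by (simp add: margR_def mult.assoc)
  have tr: "mtrace (block_out a c (?V Q) \<rho>) = mtrace ?X" if "Q = Q1 \<or> Q = Q2" for Q
    using gram[OF that] by (subst (1 2) mtrace_block_out[OF psdD(1)[OF \<rho>]]) auto
  have KQ: "?X * ?K Q \<in> carrier_mat (a*l*(r*c)) (a*l*(r*c))" if "Q \<in> carrier_mat m r" for Q
    using that by (auto simp: mult.assoc intro!: carrier_matI)
  have "complex_of_real w1 \<cdot>\<^sub>m ?K Q1 + complex_of_real w2 \<cdot>\<^sub>m ?K Q2 =
      kron (1\<^sub>m (a*l)) (kron (complex_of_real w1 \<cdot>\<^sub>m (adj Q1 * Q1) + complex_of_real w2 \<cdot>\<^sub>m (adj Q2 * Q2)) (1\<^sub>m c))"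
    by (simp add: kron_add_left kron_add_right kron_smult_left kron_smult_right)
  also have "\<dots> = 1\<^sub>m (a*l*(r*c))" unfolding avg by simp
  finally have K: "complex_of_real w1 \<cdot>\<^sub>m ?K Q1 + complex_of_real w2 \<cdot>\<^sub>m ?K Q2 = 1\<^sub>m (a*l*(r*c))" .
  have "complex_of_real w1 \<cdot>\<^sub>m (?X * ?K Q1) + complex_of_real w2 \<cdot>\<^sub>m (?X * ?K Q2) = ?X"
    using arg_cong[OF K, of "\<lambda>K. ?X * K"] by (simp add: mult_add_dim mult_smult_dim mult.assoc)
  then have mix: "complex_of_real w1 \<cdot>\<^sub>m margL a c l m (?V Q1) \<rho> + complex_of_real w2 \<cdot>\<^sub>m margL a c l m (?V Q2) \<rho>
      = margL a c l r V \<rho>"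
    unfolding mL[OF Q(1)] mL[OF Q(2)] unfolding margL_def
    by (simp add: ptrR_smult[OF KQ[OF Q(1)], symmetric] ptrR_smult[OF KQ[OF Q(2)], symmetric]
        ptrR_add[symmetric] KQ Q del: index_mult_mat)
  have "w1 * eta (margL a c l m (?V Q1) \<rho>) + w2 * eta (margL a c l m (?V Q2) \<rho>) \<le> eta (margL a c l r V \<rho>)"
    unfolding mix[symmetric] by (intro eta_concave[of "a*l"] psd_marg(1)[OF \<rho>] V' Q w)
  moreover have "w1 * eta (margR a c l m (?V Q1) \<rho>) + w2 * eta (margR a c l m (?V Q2) \<rho>) \<le> eta (margR a c l r V \<rho>)"
    unfolding mR[OF Q(1)] mR[OF Q(2)]
  proof (rule eta_compress_le[OF psd_marg(2)[OF \<rho> V] w])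
    have "complex_of_real w1 \<cdot>\<^sub>m (adj (kron Q1 (1\<^sub>m c)) * kron Q1 (1\<^sub>m c)) +
        complex_of_real w2 \<cdot>\<^sub>m (adj (kron Q2 (1\<^sub>m c)) * kron Q2 (1\<^sub>m c)) =
        kron (complex_of_real w1 \<cdot>\<^sub>m (adj Q1 * Q1) + complex_of_real w2 \<cdot>\<^sub>m (adj Q2 * Q2)) (1\<^sub>m c)"
      by (simp add: adj_kron kron_mult kron_add_left kron_smult_left)
    also have "\<dots> = 1\<^sub>m (r*c)" unfolding avg by simp
    finally show "complex_of_real w1 \<cdot>\<^sub>m (adj (kron Q1 (1\<^sub>m c)) * kron Q1 (1\<^sub>m c)) +
        complex_of_real w2 \<cdot>\<^sub>m (adj (kron Q2 (1\<^sub>m c)) * kron Q2 (1\<^sub>m c)) = 1\<^sub>m (r*c)" .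
  qed (auto intro!: carrier_matI)
  moreover have "xlnx (Re (mtrace ?X)) = w1 * xlnx (Re (mtrace ?X)) + w2 * xlnx (Re (mtrace ?X))"
    using w by (simp flip: distrib_right)
  ultimately show ?thesis by (simp add: cost_def tr algebra_simps)
qed

text \<open>Mirror image of \<open>cost_average_R\<close>: now the right marginals average and the
  left ones are compressed.\<close>

lemma cost_average_L:
  assumes \<rho>: "psd (a*d*c) \<rho>" and V: "V \<in> carrier_mat (l*r) d"
    and w: "0 \<le> w1" "0 \<le> w2" "w1 + w2 = 1"
    and Q: "Q1 \<in> carrier_mat m l" "Q2 \<in> carrier_mat m l"
    and avg: "complex_of_real w1 \<cdot>\<^sub>m (adj Q1 * Q1) + complex_of_real w2 \<cdot>\<^sub>m (adj Q2 * Q2) = 1\<^sub>m l"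
    and gram: "\<And>Q. Q = Q1 \<or> Q = Q2 \<Longrightarrow> adj (kron Q (1\<^sub>m r) * V) * (kron Q (1\<^sub>m r) * V) = adj V * V"
  shows "w1 * cost a c m r (kron Q1 (1\<^sub>m r) * V) \<rho> + w2 * cost a c m r (kron Q2 (1\<^sub>m r) * V) \<rho> \<le> cost a c l r V \<rho>"
proof -
  note [simp] = carrier_matD[OF V] carrier_matD[OF Q(1)] carrier_matD[OF Q(2)]
  let ?V = "\<lambda>Q. kron Q (1\<^sub>m r) * V"
  let ?X = "block_out a c V \<rho>"
  let ?K = "\<lambda>Q. kron (kron (1\<^sub>m a) (adj Q * Q)) (1\<^sub>m (r*c))"
  have V': "?V Q \<in> carrier_mat (m*r) d" if "Q \<in> carrier_mat m l" for Q
    using that by (auto intro!: carrier_matI)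
  have mR: "margR a c m r (?V Q) \<rho> = ptrL (a*l) (r*c) (?X * ?K Q)" if "Q \<in> carrier_mat m l" for Q
    using margR_kron[OF psdD(1)[OF \<rho>] V that one_carrier_mat] by simp
  have mL: "margL a c m r (?V Q) \<rho> = kron (1\<^sub>m a) Q * margL a c l r V \<rho> * adj (kron (1\<^sub>m a) Q)"
    if "Q \<in> carrier_mat m l" for Q
    using margL_kron[OF psdD(1)[OF \<rho>] V that one_carrier_mat] by (simp add: margL_def mult.assoc)
  have tr: "mtrace (block_out a c (?V Q) \<rho>) = mtrace ?X" if "Q = Q1 \<or> Q = Q2" for Q
    using gram[OF that] by (subst (1 2) mtrace_block_out[OF psdD(1)[OF \<rho>]]) auto
  have KQ: "?X * ?K Q \<in> carrier_mat (a*l*(r*c)) (a*l*(r*c))" if "Q \<in> carrier_mat m l" for Q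
    using that by (auto simp: mult.assoc intro!: carrier_matI)
  have "complex_of_real w1 \<cdot>\<^sub>m ?K Q1 + complex_of_real w2 \<cdot>\<^sub>m ?K Q2 =
      kron (kron (1\<^sub>m a) (complex_of_real w1 \<cdot>\<^sub>m (adj Q1 * Q1) + complex_of_real w2 \<cdot>\<^sub>m (adj Q2 * Q2))) (1\<^sub>m (r*c))"
    by (simp add: kron_add_left kron_add_right kron_smult_left kron_smult_right)
  also have "\<dots> = 1\<^sub>m (a*l*(r*c))" unfolding avg by simp
  finally have K: "complex_of_real w1 \<cdot>\<^sub>m ?K Q1 + complex_of_real w2 \<cdot>\<^sub>m ?K Q2 = 1\<^sub>m (a*l*(r*c))" .
  have "complex_of_real w1 \<cdot>\<^sub>m (?X * ?K Q1) + complex_of_real w2 \<cdot>\<^sub>m (?X * ?K Q2) = ?X"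
    using arg_cong[OF K, of "\<lambda>K. ?X * K"] by (simp add: mult_add_dim mult_smult_dim mult.assoc)
  then have mix: "complex_of_real w1 \<cdot>\<^sub>m margR a c m r (?V Q1) \<rho> + complex_of_real w2 \<cdot>\<^sub>m margR a c m r (?V Q2) \<rho>
      = margR a c l r V \<rho>"
    unfolding mR[OF Q(1)] mR[OF Q(2)] unfolding margR_def
    by (simp add: ptrL_smult[OF KQ[OF Q(1)], symmetric] ptrL_smult[OF KQ[OF Q(2)], symmetric]
        ptrL_add[symmetric] KQ Q del: index_mult_mat)
  have "w1 * eta (margR a c m r (?V Q1) \<rho>) + w2 * eta (margR a c m r (?V Q2) \<rho>) \<le> eta (margR a c l r V \<rho>)"
    unfolding mix[symmetric] by (intro eta_concave[of "r*c"] psd_marg(2)[OF \<rho>] V' Q w)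
  moreover have "w1 * eta (margL a c m r (?V Q1) \<rho>) + w2 * eta (margL a c m r (?V Q2) \<rho>) \<le> eta (margL a c l r V \<rho>)"
    unfolding mL[OF Q(1)] mL[OF Q(2)]
  proof (rule eta_compress_le[OF psd_marg(1)[OF \<rho> V] w])
    have "complex_of_real w1 \<cdot>\<^sub>m (adj (kron (1\<^sub>m a) Q1) * kron (1\<^sub>m a) Q1) +
        complex_of_real w2 \<cdot>\<^sub>m (adj (kron (1\<^sub>m a) Q2) * kron (1\<^sub>m a) Q2) =
        kron (1\<^sub>m a) (complex_of_real w1 \<cdot>\<^sub>m (adj Q1 * Q1) + complex_of_real w2 \<cdot>\<^sub>m (adj Q2 * Q2))"
      by (simp add: adj_kron kron_mult kron_add_right kron_smult_right)
    also have "\<dots> = 1\<^sub>m (a*l)" unfolding avg by simp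
    finally show "complex_of_real w1 \<cdot>\<^sub>m (adj (kron (1\<^sub>m a) Q1) * kron (1\<^sub>m a) Q1) +
        complex_of_real w2 \<cdot>\<^sub>m (adj (kron (1\<^sub>m a) Q2) * kron (1\<^sub>m a) Q2) = 1\<^sub>m (a*l)" .
  qed (auto intro!: carrier_matI)
  moreover have "xlnx (Re (mtrace ?X)) = w1 * xlnx (Re (mtrace ?X)) + w2 * xlnx (Re (mtrace ?X))"
    using w by (simp flip: distrib_right)
  ultimately show ?thesis by (simp add: cost_def tr algebra_simps)
qed

lemma average_one_plus:
  assumes "N \<in> carrier_mat n n" "w1 + w2 = (1::real)" "w1 * t1 + w2 * t2 = 0"
    and "A = 1\<^sub>m n + complex_of_real t1 \<cdot>\<^sub>m N" "B = 1\<^sub>m n + complex_of_real t2 \<cdot>\<^sub>m N"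
  shows "complex_of_real w1 \<cdot>\<^sub>m A + complex_of_real w2 \<cdot>\<^sub>m B = 1\<^sub>m n"
proof (rule eq_matI)
  fix i j assume "i < dim_row (1\<^sub>m n)" "j < dim_col (1\<^sub>m n)"
  then have ij: "i < n" "j < n" by auto
  have 1: "complex_of_real w1 + complex_of_real w2 = 1" "complex_of_real w1 * complex_of_real t1 + complex_of_real w2 * complex_of_real t2 = 0"
    using assms(2,3) by (simp_all flip: of_real_add of_real_mult)
  have "(complex_of_real w1 \<cdot>\<^sub>m A + complex_of_real w2 \<cdot>\<^sub>m B) $$ (i,j) =
     (complex_of_real w1 + complex_of_real w2) * 1\<^sub>m n $$ (i,j)
     + (complex_of_real w1 * complex_of_real t1 + complex_of_real w2 * complex_of_real t2) * N $$ (i,j)"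
    using ij carrier_matD[OF assms(1)] unfolding assms(4,5) by (simp add: algebra_simps)
  then show "(complex_of_real w1 \<cdot>\<^sub>m A + complex_of_real w2 \<cdot>\<^sub>m B) $$ (i,j) = 1\<^sub>m n $$ (i,j)"
    unfolding 1 by simp
qed (use carrier_matD[OF assms(1)] in \<open>simp_all add: assms(4,5)\<close>)

text \<open>\<open>\<Phi> N = 0\<close> keeps \<open>adj V * V\<close> fixed when \<open>V\<close>
  is replaced by \<open>kron (1\<^sub>m l) Q * V\<close> with \<open>adj Q * Q\<close> of the form
  \<open>1 + t N\<close>. There are two such \<open>Q\<close> whose Gram matrices average to the
  identity, and one of them does not raise the cost.\<close>

lemma reduce_R:
  assumes \<rho>: "psd (a*d*c) \<rho>" and V: "V \<in> carrier_mat (l * Suc m) d" and d: "0 < d" "d \<le> m"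
  obtains V' where "V' \<in> carrier_mat (l * m) d" "adj V' * V' = adj V * V"
    "cost a c l m V' \<rho> \<le> cost a c l (Suc m) V \<rho>"
proof -
  let ?r = "Suc m"
  note [simp] = carrier_matD[OF V]
  define \<Phi> where "\<Phi> N = adj V * kron (1\<^sub>m l) N * V" for N
  \<comment> \<open>Under the trace pairing \<open>K i j\<close> represents the functional that
    sends \<open>N\<close> to the entry \<open>(i,j)\<close> of \<open>\<Phi> N\<close>.\<close>
  define K where "K i j = ptrL l ?r (V * unit_mat d j i * adj V)" for i j
  have 1: "\<Phi> N $$ (i,j) = mtrace (K i j * N)" if N: "N \<in> carrier_mat ?r ?r" and ij: "i < d" "j < d" for N i j
  proof -
    note [simp] = carrier_matD[OF N]
    have "\<Phi> N $$ (i,j) = mtrace (\<Phi> N * unit_mat d j i)"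
      by (rule mtrace_mult_unit[symmetric]) (use ij in \<open>auto simp: \<Phi>_def intro!: carrier_matI\<close>)
    also have "\<Phi> N * unit_mat d j i = adj V * (kron (1\<^sub>m l) N * (V * unit_mat d j i))"
      by (simp add: \<Phi>_def mult_assoc_dim)
    also have "mtrace \<dots> = mtrace ((kron (1\<^sub>m l) N * (V * unit_mat d j i)) * adj V)" by (rule mtrace_comm) auto
    also have "(kron (1\<^sub>m l) N * (V * unit_mat d j i)) * adj V = kron (1\<^sub>m l) N * (V * unit_mat d j i * adj V)"
      by (simp add: mult_assoc_dim)
    also have "mtrace \<dots> = mtrace ((V * unit_mat d j i * adj V) * kron (1\<^sub>m l) N)" by (rule mtrace_comm) auto
    also have "\<dots> = mtrace (K i j * N)"
      unfolding K_def by (rule mtrace_ptrL_mult[symmetric, OF _ N]) (auto intro!: carrier_matI)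
    finally show ?thesis .
  qed
  have 2: "\<Phi> N \<in> carrier_mat d d" "\<Phi> (adj N) = adj (\<Phi> N)" if N: "N \<in> carrier_mat ?r ?r" for N
    using carrier_matD[OF N] by (auto simp: \<Phi>_def adj_mult adj_kron mult_assoc_dim intro!: carrier_matI)
  have K: "K i j \<in> carrier_mat ?r ?r" for i j by (simp add: K_def)
  obtain N where N: "N \<in> carrier_mat ?r ?r" "adj N = N" "N \<noteq> 0\<^sub>m ?r ?r" "mtrace N = 0" and \<Phi>N: "\<Phi> N = 0\<^sub>m d d"
    by (rule traceless_kernel[of d ?r K \<Phi>, OF d(1) _ K 1 2]) (use d in \<open>auto intro: that\<close>)
  obtain w1 w2 t1 t2 Q1 Q2 where w: "0 \<le> w1" "0 \<le> w2" "w1 + w2 = (1::real)" "w1 * t1 + w2 * t2 = 0"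
    and Q: "Q1 \<in> carrier_mat m ?r" "Q2 \<in> carrier_mat m ?r"
    and QQ: "adj Q1 * Q1 = 1\<^sub>m ?r + complex_of_real t1 \<cdot>\<^sub>m N" "adj Q2 * Q2 = 1\<^sub>m ?r + complex_of_real t2 \<cdot>\<^sub>m N"
    by (rule extremal_pair[OF N], rule that)
  have gram: "adj (kron (1\<^sub>m l) Q * V) * (kron (1\<^sub>m l) Q * V) = adj V * V"
    if Q: "Q \<in> carrier_mat m ?r" "adj Q * Q = 1\<^sub>m ?r + complex_of_real t \<cdot>\<^sub>m N" for Q t
  proof -
    note [simp] = carrier_matD[OF N(1)] carrier_matD[OF Q(1)]
    have "adj (kron (1\<^sub>m l) Q * V) * (kron (1\<^sub>m l) Q * V) = adj V * kron (1\<^sub>m l) (1\<^sub>m ?r + complex_of_real t \<cdot>\<^sub>m N) * V"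
      by (subst kron_mult_gram[OF V]) (auto simp: Q(2))
    also have "\<dots> = adj V * V + complex_of_real t \<cdot>\<^sub>m \<Phi> N"
      by (simp add: \<Phi>_def kron_add_right kron_smult_right mult_add_dim add_mult_dim mult_smult_dim smult_mult_dim)
    also have "\<dots> = adj V * V" unfolding \<Phi>N by (simp add: smult_zero_mat right_add_zero_mat[of _ d d] carrier_matI)
    finally show ?thesis .
  qed
  have "w1 * cost a c l m (kron (1\<^sub>m l) Q1 * V) \<rho> + w2 * cost a c l m (kron (1\<^sub>m l) Q2 * V) \<rho> \<le> cost a c l ?r V \<rho>"
    by (rule cost_average_R[OF \<rho> V w(1-3) Q average_one_plus[OF N(1) w(3,4) QQ]])
      (use gram[OF Q(1) QQ(1)] gram[OF Q(2) QQ(2)] in auto)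
  then consider "cost a c l m (kron (1\<^sub>m l) Q1 * V) \<rho> \<le> cost a c l ?r V \<rho>"
    | "cost a c l m (kron (1\<^sub>m l) Q2 * V) \<rho> \<le> cost a c l ?r V \<rho>"
    using convex_min_le w(1-3) by blast
  then show thesis
  proof cases
    case 1
    show ?thesis by (rule that[OF _ gram[OF Q(1) QQ(1)] 1]) (use carrier_matD[OF Q(1)] in \<open>auto intro!: carrier_matI\<close>)
  next
    case 2
    show ?thesis by (rule that[OF _ gram[OF Q(2) QQ(2)] 2]) (use carrier_matD[OF Q(2)] in \<open>auto intro!: carrier_matI\<close>)
  qed
qed

lemma reduce_L:
  assumes \<rho>: "psd (a*d*c) \<rho>" and V: "V \<in> carrier_mat (Suc m * r) d" and d: "0 < d" "d \<le> m"
  obtains V' where "V' \<in> carrier_mat (m * r) d" "adj V' * V' = adj V * V"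
    "cost a c m r V' \<rho> \<le> cost a c (Suc m) r V \<rho>"
proof -
  let ?l = "Suc m"
  have dV [simp]: "dim_row V = ?l * r" "dim_col V = d" using carrier_matD[OF V] by auto
  define \<Phi> where "\<Phi> N = adj V * kron N (1\<^sub>m r) * V" for N
  define K where "K i j = ptrR ?l r (V * unit_mat d j i * adj V)" for i j
  have 1: "\<Phi> N $$ (i,j) = mtrace (K i j * N)" if N: "N \<in> carrier_mat ?l ?l" and ij: "i < d" "j < d" for N i j
  proof -
    note [simp] = carrier_matD[OF N]
    have "\<Phi> N $$ (i,j) = mtrace (\<Phi> N * unit_mat d j i)"
      by (rule mtrace_mult_unit[symmetric]) (use ij in \<open>auto simp: \<Phi>_def intro!: carrier_matI\<close>)
    also have "\<Phi> N * unit_mat d j i = adj V * (kron N (1\<^sub>m r) * (V * unit_mat d j i))"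
      by (simp add: \<Phi>_def mult_assoc_dim)
    also have "mtrace \<dots> = mtrace ((kron N (1\<^sub>m r) * (V * unit_mat d j i)) * adj V)" by (rule mtrace_comm) auto
    also have "(kron N (1\<^sub>m r) * (V * unit_mat d j i)) * adj V = kron N (1\<^sub>m r) * (V * unit_mat d j i * adj V)"
      by (simp add: mult_assoc_dim)
    also have "mtrace \<dots> = mtrace ((V * unit_mat d j i * adj V) * kron N (1\<^sub>m r))" by (rule mtrace_comm) auto
    also have "\<dots> = mtrace (K i j * N)"
      unfolding K_def by (rule mtrace_ptrR_mult[symmetric, OF _ N]) (auto intro!: carrier_matI)
    finally show ?thesis .
  qed
  have 2: "\<Phi> N \<in> carrier_mat d d" "\<Phi> (adj N) = adj (\<Phi> N)" if N: "N \<in> carrier_mat ?l ?l" for N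
    using carrier_matD[OF N] by (auto simp: \<Phi>_def adj_mult adj_kron mult_assoc_dim intro!: carrier_matI)
  have K: "K i j \<in> carrier_mat ?l ?l" for i j by (simp add: K_def)
  obtain N where N: "N \<in> carrier_mat ?l ?l" "adj N = N" "N \<noteq> 0\<^sub>m ?l ?l" "mtrace N = 0" and \<Phi>N: "\<Phi> N = 0\<^sub>m d d"
    by (rule traceless_kernel[of d ?l K \<Phi>, OF d(1) _ K 1 2]) (use d in \<open>auto intro: that\<close>)
  obtain w1 w2 t1 t2 Q1 Q2 where w: "0 \<le> w1" "0 \<le> w2" "w1 + w2 = (1::real)" "w1 * t1 + w2 * t2 = 0"
    and Q: "Q1 \<in> carrier_mat m ?l" "Q2 \<in> carrier_mat m ?l"
    and QQ: "adj Q1 * Q1 = 1\<^sub>m ?l + complex_of_real t1 \<cdot>\<^sub>m N" "adj Q2 * Q2 = 1\<^sub>m ?l + complex_of_real t2 \<cdot>\<^sub>m N"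
    by (rule extremal_pair[OF N], rule that)
  have gram: "adj (kron Q (1\<^sub>m r) * V) * (kron Q (1\<^sub>m r) * V) = adj V * V"
    if Q: "Q \<in> carrier_mat m ?l" "adj Q * Q = 1\<^sub>m ?l + complex_of_real t \<cdot>\<^sub>m N" for Q t
  proof -
    note [simp] = carrier_matD[OF N(1)] carrier_matD[OF Q(1)]
    have "adj (kron Q (1\<^sub>m r) * V) * (kron Q (1\<^sub>m r) * V) = adj V * kron (1\<^sub>m ?l + complex_of_real t \<cdot>\<^sub>m N) (1\<^sub>m r) * V"
      by (subst kron_mult_gram[OF V]) (auto simp: Q(2))
    also have "\<dots> = adj V * V + complex_of_real t \<cdot>\<^sub>m \<Phi> N"
      by (simp add: \<Phi>_def kron_add_left kron_smult_left mult_add_dim add_mult_dim mult_smult_dim smult_mult_dim)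
    also have "\<dots> = adj V * V" unfolding \<Phi>N by (simp add: smult_zero_mat right_add_zero_mat[of _ d d] carrier_matI)
    finally show ?thesis .
  qed
  have "w1 * cost a c m r (kron Q1 (1\<^sub>m r) * V) \<rho> + w2 * cost a c m r (kron Q2 (1\<^sub>m r) * V) \<rho> \<le> cost a c ?l r V \<rho>"
    by (rule cost_average_L[OF \<rho> V w(1-3) Q average_one_plus[OF N(1) w(3,4) QQ]])
      (use gram[OF Q(1) QQ(1)] gram[OF Q(2) QQ(2)] in auto)
  then consider "cost a c m r (kron Q1 (1\<^sub>m r) * V) \<rho> \<le> cost a c ?l r V \<rho>"
    | "cost a c m r (kron Q2 (1\<^sub>m r) * V) \<rho> \<le> cost a c ?l r V \<rho>"
    using convex_min_le w(1-3) by blast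
  then show thesis
  proof cases
    case 1
    show ?thesis by (rule that[OF _ gram[OF Q(1) QQ(1)] 1]) (use carrier_matD[OF Q(1)] in \<open>auto intro!: carrier_matI\<close>)
  next
    case 2
    show ?thesis by (rule that[OF _ gram[OF Q(2) QQ(2)] 2]) (use carrier_matD[OF Q(2)] in \<open>auto intro!: carrier_matI\<close>)
  qed
qed

section \<open>Bringing both factors to dimension \<open>d\<close>\<close>

lemma isometry_one: "isometry n n (1\<^sub>m n)" by (simp add: isometry_def)

lemma isometry_exists:
  assumes "m \<le> n" obtains Q where "isometry m n Q"
proof -
  let ?Q = "mat n m (\<lambda>(i,j). if i = j then 1 else 0)"
  have "adj ?Q * ?Q = 1\<^sub>m m"
  proof (rule eq_matI)
    fix i j assume "i < dim_row (1\<^sub>m m)" "j < dim_col (1\<^sub>m m)"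
    then have ij: "i < m" "j < m" by auto
    have "(adj ?Q * ?Q) $$ (i,j) = (\<Sum>k<n. cnj (if k = i then 1 else 0) * (if k = j then 1 else 0))"
      using ij assms by (subst index_mult_sum) (auto intro!: sum.cong)
    also have "\<dots> = (\<Sum>k<n. if k = i then (if i = j then 1 else 0) else 0)"
      by (intro sum.cong) auto
    also have "\<dots> = 1\<^sub>m m $$ (i,j)" using ij assms by simp
    finally show "(adj ?Q * ?Q) $$ (i,j) = 1\<^sub>m m $$ (i,j)" .
  qed auto
  then show thesis by (intro that[of ?Q]) (simp add: isometry_def)
qed

text \<open>Large factors shrink one dimension at a time by \<open>reduce_R\<close>; once the
  dimension is at most \<open>d\<close>, an isometry pads it. Reaching \<open>d\<close> exactly
  gives all blocks the same shape.\<close>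

lemma resize_R:
  assumes \<rho>: "psd (a*d*c) \<rho>" and d: "0 < d" and V: "V \<in> carrier_mat (l * r) d"
  obtains V' where "V' \<in> carrier_mat (l * d) d" "adj V' * V' = adj V * V"
    "cost a c l d V' \<rho> \<le> cost a c l r V \<rho>"
proof -
  have "\<exists>V'\<in>carrier_mat (l * d) d. adj V' * V' = adj V * V \<and> cost a c l d V' \<rho> \<le> cost a c l r V \<rho>"
    using V
  proof (induction r arbitrary: V)
    case (Suc m)
    show ?case
    proof (cases "d \<le> m")
      case True
      obtain V1 where V1: "V1 \<in> carrier_mat (l * m) d" "adj V1 * V1 = adj V * V"
        "cost a c l m V1 \<rho> \<le> cost a c l (Suc m) V \<rho>"
        by (rule reduce_R[OF \<rho> Suc.prems d True], rule that)
      from Suc.IH[OF V1(1)] show ?thesis using V1(2,3) by fastforce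
    next
      case False
      then obtain Q where Q: "isometry (Suc m) d Q" using isometry_exists[of "Suc m" d] by auto
      show ?thesis
        using cost_isometry[OF \<rho> Suc.prems isometry_one Q] isometryD(1,2)[OF Q] carrier_matD[OF Suc.prems]
        by (intro bexI[of _ "kron (1\<^sub>m l) Q * V"]) (auto intro!: carrier_matI)
    qed
  next
    case 0
    obtain Q where Q: "isometry 0 d Q" using isometry_exists[of 0 d] by auto
    show ?case
      using cost_isometry[OF \<rho> 0 isometry_one Q] isometryD(1,2)[OF Q] carrier_matD[OF 0]
      by (intro bexI[of _ "kron (1\<^sub>m l) Q * V"]) (auto intro!: carrier_matI)
  qed
  then show thesis using that by blast
qed

lemma resize_L:
  assumes \<rho>: "psd (a*d*c) \<rho>" and d: "0 < d" and V: "V \<in> carrier_mat (l * r) d"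
  obtains V' where "V' \<in> carrier_mat (d * r) d" "adj V' * V' = adj V * V"
    "cost a c d r V' \<rho> \<le> cost a c l r V \<rho>"
proof -
  have "\<exists>V'\<in>carrier_mat (d * r) d. adj V' * V' = adj V * V \<and> cost a c d r V' \<rho> \<le> cost a c l r V \<rho>"
    using V
  proof (induction l arbitrary: V)
    case (Suc m)
    show ?case
    proof (cases "d \<le> m")
      case True
      obtain V1 where V1: "V1 \<in> carrier_mat (m * r) d" "adj V1 * V1 = adj V * V"
        "cost a c m r V1 \<rho> \<le> cost a c (Suc m) r V \<rho>"
        by (rule reduce_L[OF \<rho> Suc.prems d True], rule that)
      from Suc.IH[OF V1(1)] show ?thesis using V1(2,3) by fastforce
    next
      case False
      then obtain Q where Q: "isometry (Suc m) d Q" using isometry_exists[of "Suc m" d] by auto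
      show ?thesis
        using cost_isometry[OF \<rho> Suc.prems Q isometry_one] isometryD(1,2)[OF Q] carrier_matD[OF Suc.prems]
        by (intro bexI[of _ "kron Q (1\<^sub>m r) * V"]) (auto intro!: carrier_matI)
    qed
  next
    case 0
    obtain Q where Q: "isometry 0 d Q" using isometry_exists[of 0 d] by auto
    show ?case
      using cost_isometry[OF \<rho> 0 Q isometry_one] isometryD(1,2)[OF Q] carrier_matD[OF 0]
      by (intro bexI[of _ "kron Q (1\<^sub>m r) * V"]) (auto intro!: carrier_matI)
  qed
  then show thesis using that by blast
qed

lemma resize:
  assumes \<rho>: "psd (a*d*c) \<rho>" and d: "0 < d" and V: "V \<in> carrier_mat (l * r) d"
  obtains V' where "V' \<in> carrier_mat (d * d) d" "adj V' * V' = adj V * V"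
    "cost a c d d V' \<rho> \<le> cost a c l r V \<rho>"
proof -
  obtain V1 where V1: "V1 \<in> carrier_mat (l * d) d" "adj V1 * V1 = adj V * V"
    "cost a c l d V1 \<rho> \<le> cost a c l r V \<rho>" by (rule resize_R[OF \<rho> d V], rule that)
  obtain V2 where V2: "V2 \<in> carrier_mat (d * d) d" "adj V2 * V2 = adj V1 * V1"
    "cost a c d d V2 \<rho> \<le> cost a c l d V1 \<rho>" by (rule resize_L[OF \<rho> d V1(1)], rule that)
  show thesis by (rule that[OF V2(1)]) (use V1 V2 in auto)
qed

section \<open>Reduction of the number of blocks\<close>

lemma eta_smult:
  assumes M: "psd n M" and s: "0 \<le> s"
  shows "eta (complex_of_real s \<cdot>\<^sub>m M) = s * eta M + Re (mtrace M) * xlnx s"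
proof -
  obtain U d where U: "unitary_m n U" and Md: "M = U * rdiag n d * adj U"
    and d: "\<And>i. i < n \<Longrightarrow> 0 \<le> d i"
    by (rule psd_spectral[OF M], rule that)
  note [simp] = unitaryD[OF U]
  have "complex_of_real s \<cdot>\<^sub>m rdiag n d = rdiag n (\<lambda>i. s * d i)"
    by (rule eq_matI) (auto simp: rdiag_index)
  then have "complex_of_real s \<cdot>\<^sub>m M = U * rdiag n (\<lambda>i. s * d i) * adj U"
    unfolding Md by (simp add: mult_smult_dim smult_mult_dim flip: \<open>_ = rdiag n (\<lambda>i. s * d i)\<close>)
  then have "eta (complex_of_real s \<cdot>\<^sub>m M) = (\<Sum>i<n. xlnx (s * d i))" by (simp add: eta_diag[OF U])
  also have "\<dots> = (\<Sum>i<n. s * xlnx (d i) + d i * xlnx s)"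
    by (intro sum.cong) (auto simp: xlnx_mult s d)
  also have "\<dots> = s * eta M + Re (mtrace M) * xlnx s"
    unfolding Md eta_diag[OF U] mtrace_unitary_conj[OF U rdiag_carrier] mtrace_rdiag
    by (simp add: sum.distrib sum_distrib_left sum_distrib_right)
  finally show ?thesis .
qed

lemma extend_smult: "extend a c (s \<cdot>\<^sub>m V) = s \<cdot>\<^sub>m extend a c V"
  by (simp add: extend_def kron_smult_left kron_smult_right)

lemma smult_smult_mat: "(s :: 'a :: semigroup_mult) \<cdot>\<^sub>m (t \<cdot>\<^sub>m M) = (s * t) \<cdot>\<^sub>m M"
  by (rule eq_matI) (auto simp: mult.assoc)

lemma gram_scale:
  assumes "0 \<le> s"
  shows "adj (complex_of_real (sqrt s) \<cdot>\<^sub>m V) * (complex_of_real (sqrt s) \<cdot>\<^sub>m V) = complex_of_real s \<cdot>\<^sub>m (adj V * V)"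
  using assms
  by (simp add: adj_smult mult_smult_dim smult_mult_dim smult_smult_mat flip: of_real_mult)

lemma block_out_scale:
  assumes "0 \<le> s" "\<rho> \<in> carrier_mat (a*d*c) (a*d*c)" "dim_col V = d"
  shows "block_out a c (complex_of_real (sqrt s) \<cdot>\<^sub>m V) \<rho> = complex_of_real s \<cdot>\<^sub>m block_out a c V \<rho>"
  using carrier_matD[OF assms(2)] assms(1,3)
  by (simp add: block_out_def extend_smult adj_smult mult_smult_dim smult_mult_dim smult_smult_mat flip: of_real_mult)

text \<open>Scaling by \<open>s\<close> adds the trace of the block times \<open>xlnx s\<close> for
  each of the two marginals and removes it once through the trace term. One copy with positive sign
  remains, which makes the cost concave in \<open>s\<close>.\<close>

lemma cost_scale:
  assumes \<rho>: "psd (a*d*c) \<rho>" and V: "V \<in> carrier_mat (l*r) d" and s: "0 \<le> s"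
  shows "cost a c l r (complex_of_real (sqrt s) \<cdot>\<^sub>m V) \<rho> =
    s * cost a c l r V \<rho> + Re (mtrace (block_out a c V \<rho>)) * xlnx s"
proof -
  let ?X = "block_out a c V \<rho>"
  define q where "q = Re (mtrace ?X)"
  note X = psd_block_out'[OF \<rho> V]
  have q: "0 \<le> q" unfolding q_def by (rule mtrace_psd(1)[OF X])
  note eq = block_out_scale[OF s psdD(1)[OF \<rho>] carrier_matD(2)[OF V]]
  have L: "margL a c l r (complex_of_real (sqrt s) \<cdot>\<^sub>m V) \<rho> = complex_of_real s \<cdot>\<^sub>m margL a c l r V \<rho>"
    unfolding margL_def eq by (rule ptrR_smult[OF psdD(1)[OF X]])
  have R: "margR a c l r (complex_of_real (sqrt s) \<cdot>\<^sub>m V) \<rho> = complex_of_real s \<cdot>\<^sub>m margR a c l r V \<rho>"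
    unfolding margR_def eq by (rule ptrL_smult[OF psdD(1)[OF X]])
  have T: "Re (mtrace (complex_of_real s \<cdot>\<^sub>m ?X)) = s * q"
    using mtrace_smult[OF psdD(1)[OF X]] by (simp add: q_def)
  show ?thesis
    unfolding cost_def L R eq T eta_smult[OF psd_marg(1)[OF \<rho> V] s] eta_smult[OF psd_marg(2)[OF \<rho> V] s]
      mtrace_marg[OF V] xlnx_mult[OF s q] q_def[symmetric]
    by (simp add: algebra_simps)
qed

text \<open>The scaling law at \<open>s = 0\<close>. Absent blocks may therefore be represented by
  zero operators.\<close>

lemma cost_zero:
  assumes \<rho>: "psd (a*d*c) \<rho>" shows "cost a c l r (0\<^sub>m (l*r) d) \<rho> = 0"
  using cost_scale[OF \<rho> zero_carrier_mat, of 0 l r] by simp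

text \<open>The entries give \<open>d * d\<close> complex equations. Conjugating a solution gives
  another one because the matrices are Hermitian, so its real and imaginary parts are solutions, and
  one of them is nonzero.\<close>

lemma real_dependency:
  fixes K :: "nat \<Rightarrow> complex mat"
  assumes "finite J" "d * d < card J" and K: "\<And>j. j \<in> J \<Longrightarrow> K j \<in> carrier_mat d d \<and> adj (K j) = K j"
  obtains b :: "nat \<Rightarrow> real" where "\<exists>j\<in>J. b j \<noteq> 0"
    "\<And>c e. c < d \<Longrightarrow> e < d \<Longrightarrow> (\<Sum>j\<in>J. complex_of_real (b j) * K j $$ (c,e)) = 0"
proof -
  obtain a where a: "\<exists>j\<in>J. a j \<noteq> 0"
    and sol: "\<And>i. i < d * d \<Longrightarrow> (\<Sum>j\<in>J. a j * K j $$ (i div d, i mod d)) = 0"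
    using nontrivial_solution[OF assms(1,2), of "\<lambda>i j. K j $$ (i div d, i mod d)"] by auto
  have 1: "(\<Sum>j\<in>J. a j * K j $$ (c,e)) = 0" if "c < d" "e < d" for c e
    using sol[OF pair_index_less[OF that]] that by simp
  have 2: "(\<Sum>j\<in>J. cnj (a j) * K j $$ (c,e)) = 0" if ce: "c < d" "e < d" for c e
  proof -
    have "cnj (K j $$ (e,c)) = K j $$ (c,e)" if "j \<in> J" for j
      using K[OF that] ce adj_index[of c "K j" e] by auto
    then have "(\<Sum>j\<in>J. cnj (a j) * K j $$ (c,e)) = cnj (\<Sum>j\<in>J. a j * K j $$ (e,c))"
      by (auto simp: intro!: sum.cong)
    then show ?thesis using 1[OF ce(2,1)] by simp
  qed
  have re: "(\<Sum>j\<in>J. complex_of_real (Re (a j)) * K j $$ (c,e)) = 0" if "c < d" "e < d" for c e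
  proof -
    have "(\<Sum>j\<in>J. complex_of_real (Re (a j)) * K j $$ (c,e))
       = (\<Sum>j\<in>J. (a j * K j $$ (c,e) + cnj (a j) * K j $$ (c,e)) / 2)"
      by (intro sum.cong refl) (simp add: complex_add_cnj flip: distrib_right)
    also have "\<dots> = 0" using 1[OF that] 2[OF that] by (simp add: sum.distrib flip: sum_divide_distrib)
    finally show ?thesis .
  qed
  have im: "(\<Sum>j\<in>J. complex_of_real (Im (a j)) * K j $$ (c,e)) = 0" if "c < d" "e < d" for c e
  proof -
    have "(\<Sum>j\<in>J. complex_of_real (Im (a j)) * K j $$ (c,e))
       = (\<Sum>j\<in>J. (- \<i> / 2) * (a j * K j $$ (c,e) - cnj (a j) * K j $$ (c,e)))"
      by (intro sum.cong refl) (simp add: complex_eq_iff field_simps)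
    also have "\<dots> = 0" unfolding sum_distrib_left[symmetric] sum_subtractf using 1[OF that] 2[OF that] by simp
    finally show ?thesis .
  qed
  from a have "(\<exists>j\<in>J. Re (a j) \<noteq> 0) \<or> (\<exists>j\<in>J. Im (a j) \<noteq> 0)"
    by (auto simp: complex_eq_iff)
  then show thesis using that[of "\<lambda>j. Re (a j)"] that[of "\<lambda>j. Im (a j)"] re im by blast
qed

text \<open>Supplies the positive weights that \<open>boundary_segment\<close> asks for.\<close>

lemma mtrace_gram_pos:
  assumes "V \<in> carrier_mat n d" "V \<noteq> 0\<^sub>m n d" shows "0 < Re (mtrace (adj V * V))"
proof -
  note [simp] = carrier_matD[OF assms(1)]
  obtain i j where ij: "i < n" "j < d" "V $$ (i,j) \<noteq> 0"
    using assms by (metis carrier_matD eq_matI index_zero_mat)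
  have "0 < (cmod (V $$ (i,j)))\<^sup>2" using ij(3) by simp
  also have "\<dots> \<le> (\<Sum>k<n. (cmod (V $$ (k,j)))\<^sup>2)"
    by (rule member_le_sum) (use ij in auto)
  also have "\<dots> \<le> (\<Sum>j<d. \<Sum>k<n. (cmod (V $$ (k,j)))\<^sup>2)"
    by (rule member_le_sum[of j "{..<d}" "\<lambda>j. \<Sum>k<n. (cmod (V $$ (k,j)))\<^sup>2"]) (use ij in \<open>auto intro: sum_nonneg\<close>)
  also have "\<dots> = Re (mtrace (adj V * V))"
    unfolding mtrace_def by (simp add: adj_mult_self_diag del: index_mult_mat(1))
  finally show ?thesis .
qed

text \<open>A comparison of families that preserves the sum of effects and does not raise the cost.
  Index sets are arbitrary, so that a block can be removed without renumbering.\<close>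

definition family_le :: "nat \<Rightarrow> nat \<Rightarrow> nat \<Rightarrow> nat \<Rightarrow> nat \<Rightarrow> complex mat \<Rightarrow>
    nat set \<Rightarrow> (nat \<Rightarrow> complex mat) \<Rightarrow> nat set \<Rightarrow> (nat \<Rightarrow> complex mat) \<Rightarrow> bool" where
  "family_le a c l r d \<rho> J' V' J V \<longleftrightarrow> finite J' \<and> (\<forall>j\<in>J'. V' j \<in> carrier_mat (l*r) d) \<and>
    (\<forall>x<d. \<forall>y<d. (\<Sum>j\<in>J'. (adj (V' j) * V' j) $$ (x,y)) = (\<Sum>j\<in>J. (adj (V j) * V j) $$ (x,y))) \<and>
    (\<Sum>j\<in>J'. cost a c l r (V' j) \<rho>) \<le> (\<Sum>j\<in>J. cost a c l r (V j) \<rho>)"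

lemma family_le_trans:
  "family_le a c l r d \<rho> J1 V1 J2 V2 \<Longrightarrow> family_le a c l r d \<rho> J2 V2 J3 V3 \<Longrightarrow> family_le a c l r d \<rho> J1 V1 J3 V3"
  unfolding family_le_def by (auto intro: order_trans)

lemma family_le_drop:
  assumes \<rho>: "psd (a*d*c) \<rho>" and J: "finite J" "j0 \<in> J" and V: "\<And>j. j \<in> J \<Longrightarrow> V j \<in> carrier_mat (l*r) d"
    and z: "V j0 = 0\<^sub>m (l*r) d"
  shows "family_le a c l r d \<rho> (J - {j0}) V J V"
  unfolding family_le_def
proof (intro conjI allI impI ballI)
  fix x y assume "x < d" "y < d"
  then show "(\<Sum>j\<in>J-{j0}. (adj (V j) * V j) $$ (x,y)) = (\<Sum>j\<in>J. (adj (V j) * V j) $$ (x,y))"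
    using sum.remove[OF J, of "\<lambda>j. (adj (V j) * V j) $$ (x,y)"] by (simp add: z)
next
  show "(\<Sum>j\<in>J-{j0}. cost a c l r (V j) \<rho>) \<le> (\<Sum>j\<in>J. cost a c l r (V j) \<rho>)"
    using sum.remove[OF J, of "\<lambda>j. cost a c l r (V j) \<rho>"] by (simp add: z cost_zero[OF \<rho>])
qed (use J V in auto)

text \<open>Reweighting the blocks along a linear dependency of their Gram matrices keeps the
  Gram sum, and the total cost is concave in the weights; so some boundary point, where a block
  disappears, is at least as good.\<close>

lemma family_le_reweight:
  assumes \<rho>: "psd (a*d*c) \<rho>" and J: "finite J" and V: "\<And>j. j \<in> J \<Longrightarrow> V j \<in> carrier_mat (l*r) d"
    and big: "d * d < card J" and nz: "\<And>j. j \<in> J \<Longrightarrow> V j \<noteq> 0\<^sub>m (l*r) d"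
  obtains W j0 where "family_le a c l r d \<rho> J W J V" "j0 \<in> J" "W j0 = 0\<^sub>m (l*r) d"
proof -
  define K where "K j = adj (V j) * V j" for j
  have K: "K j \<in> carrier_mat d d \<and> adj (K j) = K j" if "j \<in> J" for j
    using carrier_matD[OF V[OF that]] by (auto simp: K_def adj_mult intro!: carrier_matI)
  obtain b where b: "\<exists>j\<in>J. b j \<noteq> 0"
    and dep: "\<And>x y. x < d \<Longrightarrow> y < d \<Longrightarrow> (\<Sum>j\<in>J. complex_of_real (b j) * K j $$ (x,y)) = 0"
    by (rule real_dependency[of J d K, OF J big]) (auto simp: K intro: that)
  have kpos: "\<forall>j\<in>J. 0 < Re (mtrace (K j))"
    unfolding K_def using mtrace_gram_pos V nz by blast
  have "(\<Sum>j\<in>J. Re (mtrace (K j)) * b j) = Re (\<Sum>j\<in>J. \<Sum>x<d. complex_of_real (b j) * K j $$ (x,x))"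
    unfolding Re_sum
  proof (intro sum.cong refl)
    fix j assume "j \<in> J"
    then have "dim_row (K j) = d" using K by auto
    then show "Re (mtrace (K j)) * b j = (\<Sum>x<d. Re (complex_of_real (b j) * K j $$ (x,x)))"
      by (simp add: mtrace_def sum_distrib_left sum_distrib_right mult.commute)
  qed
  also have "\<dots> = Re (\<Sum>x<d. \<Sum>j\<in>J. complex_of_real (b j) * K j $$ (x,x))"
    by (subst sum.swap) simp
  also have "\<dots> = 0" by (simp add: dep)
  finally have k0: "(\<Sum>j\<in>J. Re (mtrace (K j)) * b j) = 0" .
  obtain w1 w2 t1 t2 j1 j2 where w: "0 \<le> w1" "0 \<le> w2" "w1 + w2 = (1::real)" "w1 * t1 + w2 * t2 = 0"
    and j1: "j1 \<in> J" "1 + t1 * b j1 = 0" and p1: "\<And>j. j \<in> J \<Longrightarrow> 0 \<le> 1 + t1 * b j"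
    and j2: "j2 \<in> J" "1 + t2 * b j2 = 0" and p2: "\<And>j. j \<in> J \<Longrightarrow> 0 \<le> 1 + t2 * b j"
    by (rule boundary_segment[OF J kpos k0 b], rule that)
  define W where "W t j = complex_of_real (sqrt (1 + t * b j)) \<cdot>\<^sub>m V j" for t j
  define q where "q j = Re (mtrace (block_out a c (V j) \<rho>))" for j
  have q: "0 \<le> q j" if "j \<in> J" for j
    unfolding q_def by (rule mtrace_psd(1)[OF psd_block_out'[OF \<rho> V[OF that]]])
  have costW: "cost a c l r (W t j) \<rho> = (1 + t * b j) * cost a c l r (V j) \<rho> + q j * xlnx (1 + t * b j)"
    if "j \<in> J" "0 \<le> 1 + t * b j" for t j
    unfolding W_def q_def by (rule cost_scale[OF \<rho> V[OF that(1)] that(2)])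
  have W0: "W t j = 0\<^sub>m (l*r) d" if "j \<in> J" "1 + t * b j = 0" for t j
    unfolding W_def that(2) using carrier_matD[OF V[OF that(1)]] by (intro eq_matI) auto
  have le: "family_le a c l r d \<rho> J (W t) J V" if t: "\<And>j. j \<in> J \<Longrightarrow> 0 \<le> 1 + t * b j"
    "(\<Sum>j\<in>J. cost a c l r (W t j) \<rho>) \<le> (\<Sum>j\<in>J. cost a c l r (V j) \<rho>)" for t
    unfolding family_le_def
  proof (intro conjI allI impI ballI)
    show "W t j \<in> carrier_mat (l*r) d" if "j \<in> J" for j using V[OF that] by (simp add: W_def)
    fix x y assume xy: "x < d" "y < d"
    have "(\<Sum>j\<in>J. (adj (W t j) * W t j) $$ (x,y)) = (\<Sum>j\<in>J. K j $$ (x,y) + complex_of_real t * (complex_of_real (b j) * K j $$ (x,y)))"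
    proof (intro sum.cong refl)
      fix j assume j: "j \<in> J"
      have Kd: "dim_row (K j) = d" "dim_col (K j) = d" using K[OF j] by auto
      have "adj (W t j) * W t j = complex_of_real (1 + t * b j) \<cdot>\<^sub>m K j"
        unfolding W_def gram_scale[OF t(1)[OF j]] K_def ..
      then show "(adj (W t j) * W t j) $$ (x,y) = K j $$ (x,y) + complex_of_real t * (complex_of_real (b j) * K j $$ (x,y))"
        using xy Kd by (simp add: algebra_simps)
    qed
    also have "\<dots> = (\<Sum>j\<in>J. K j $$ (x,y))"
      by (simp add: sum.distrib dep[OF xy] flip: sum_distrib_left)
    finally show "(\<Sum>j\<in>J. (adj (W t j) * W t j) $$ (x,y)) = (\<Sum>j\<in>J. (adj (V j) * V j) $$ (x,y))"
      unfolding K_def .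
  qed (use J t(2) in auto)
  have "w1 * cost a c l r (W t1 j) \<rho> + w2 * cost a c l r (W t2 j) \<rho> \<le> cost a c l r (V j) \<rho>" if j: "j \<in> J" for j
  proof -
    have e: "w1 * (1 + t1 * b j) + w2 * (1 + t2 * b j) = 1"
    proof -
      have "w1 * (1 + t1 * b j) + w2 * (1 + t2 * b j) = (w1 + w2) + (w1 * t1 + w2 * t2) * b j"
        by (simp add: algebra_simps)
      then show ?thesis using w by simp
    qed
    \<comment> \<open>The scaling factors average to 1, where \<open>xlnx\<close> vanishes; hence
      the extra terms average to something nonpositive.\<close>
    have "w1 * xlnx (1 + t1 * b j) + w2 * xlnx (1 + t2 * b j) \<le> xlnx (w1 * (1 + t1 * b j) + w2 * (1 + t2 * b j))"
      by (rule xlnx_concave2[OF w(1-3) p1[OF j] p2[OF j]])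
    also have "\<dots> = 0" unfolding e by (simp add: xlnx_def)
    finally have "q j * (w1 * xlnx (1 + t1 * b j) + w2 * xlnx (1 + t2 * b j)) \<le> 0"
      by (rule mult_nonneg_nonpos[OF q[OF j]])
    moreover have "w1 * cost a c l r (W t1 j) \<rho> + w2 * cost a c l r (W t2 j) \<rho> =
        (w1 * (1 + t1 * b j) + w2 * (1 + t2 * b j)) * cost a c l r (V j) \<rho>
        + q j * (w1 * xlnx (1 + t1 * b j) + w2 * xlnx (1 + t2 * b j))"
      unfolding costW[OF j p1[OF j]] costW[OF j p2[OF j]] by (simp add: algebra_simps)
    ultimately show ?thesis unfolding e by simp
  qed
  then have "(\<Sum>j\<in>J. w1 * cost a c l r (W t1 j) \<rho> + w2 * cost a c l r (W t2 j) \<rho>) \<le> (\<Sum>j\<in>J. cost a c l r (V j) \<rho>)"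
    by (rule sum_mono)
  then have "w1 * (\<Sum>j\<in>J. cost a c l r (W t1 j) \<rho>) + w2 * (\<Sum>j\<in>J. cost a c l r (W t2 j) \<rho>)
      \<le> (\<Sum>j\<in>J. cost a c l r (V j) \<rho>)"
    by (simp add: sum.distrib sum_distrib_left)
  from convex_min_le[OF this w(1-3)] show thesis
  proof
    assume "(\<Sum>j\<in>J. cost a c l r (W t1 j) \<rho>) \<le> (\<Sum>j\<in>J. cost a c l r (V j) \<rho>)"
    from that[OF le[OF p1 this] j1(1) W0[OF j1]] show thesis .
  next
    assume "(\<Sum>j\<in>J. cost a c l r (W t2 j) \<rho>) \<le> (\<Sum>j\<in>J. cost a c l r (V j) \<rho>)"
    from that[OF le[OF p2 this] j2(1) W0[OF j2]] show thesis .
  qed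
qed

text \<open>Induction on the number of blocks: above \<open>d * d\<close>, a zero block is deleted,
  or reweighting first creates one.\<close>

lemma reduce_family:
  assumes \<rho>: "psd (a*d*c) \<rho>" and J: "finite J" and V: "\<And>j. j \<in> J \<Longrightarrow> V j \<in> carrier_mat (l*r) d"
  shows "\<exists>J' V'. card J' \<le> d * d \<and> family_le a c l r d \<rho> J' V' J V"
  using J V
proof (induction "card J" arbitrary: J V rule: less_induct)
  case less
  have drop: ?case if W: "family_le a c l r d \<rho> J W J V" and j0: "j0 \<in> J" "W j0 = 0\<^sub>m (l*r) d" for j0 W
  proof -
    have Wc: "W j \<in> carrier_mat (l*r) d" if "j \<in> J" for j using W that by (simp add: family_le_def)
    have "card (J - {j0}) < card J" using j0 less.prems(1) by (meson card_Diff1_less)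
    moreover have "finite (J - {j0})" using less.prems(1) by simp
    ultimately have "\<exists>J' V'. card J' \<le> d * d \<and> family_le a c l r d \<rho> J' V' (J - {j0}) W"
      using less.hyps[of "J - {j0}" W] Wc by blast
    then obtain J' V' where *: "card J' \<le> d * d" "family_le a c l r d \<rho> J' V' (J - {j0}) W" by blast
    have "family_le a c l r d \<rho> J' V' J V"
      by (rule family_le_trans[OF *(2) family_le_trans[OF family_le_drop[of a d c \<rho> J j0 W l r, OF \<rho> less.prems(1) j0(1) Wc j0(2)] W]])
    then show ?thesis using *(1) by blast
  qed
  have refl: "family_le a c l r d \<rho> J V J V" using less.prems by (simp add: family_le_def)
  show ?case
  proof (cases "card J \<le> d * d")
    case True
    then show ?thesis using refl by blast
  next
    case False
    then have big: "d * d < card J" by simp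
    show ?thesis
    proof (cases "\<exists>j\<in>J. V j = 0\<^sub>m (l*r) d")
      case True
      then show ?thesis using drop[OF refl] by blast
    next
      case nz: False
      obtain W j0 where "family_le a c l r d \<rho> J W J V" "j0 \<in> J" "W j0 = 0\<^sub>m (l*r) d"
        by (rule family_le_reweight[OF \<rho> less.prems(1) less.prems(2) big]) (use nz that in auto)
      then show ?thesis by (rule drop)
    qed
  qed
qed

text \<open>The candidates after reduction: measurement operators of one fixed shape whose effects
  sum to the identity. Zero operators are allowed, so families with fewer blocks are
  included.\<close>

definition feasible :: "nat \<Rightarrow> (nat \<Rightarrow> complex mat) \<Rightarrow> bool" where
  "feasible d V \<longleftrightarrow> (\<forall>j<d*d. V j \<in> carrier_mat (d*d) d) \<and>
    (\<forall>x<d. \<forall>y<d. (\<Sum>j<d*d. (adj (V j) * V j) $$ (x,y)) = (if x = y then 1 else 0))"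

definition total_cost :: "nat \<Rightarrow> nat \<Rightarrow> nat \<Rightarrow> (nat \<Rightarrow> complex mat) \<Rightarrow> complex mat \<Rightarrow> real" where
  "total_cost a c d V \<rho> = (\<Sum>j<d*d. cost a c d d (V j) \<rho>)"

text \<open>The blocks are first resized one by one and then reduced in number, because
  \<open>reduce_family\<close> works with a common shape.\<close>

lemma feasible_below:
  fixes k :: nat
  assumes \<rho>: "psd (a*d*c) \<rho>" and d: "0 < d"
    and V: "\<And>j. j < k \<Longrightarrow> V j \<in> carrier_mat (l j * r j) d"
    and res: "\<And>x y. x < d \<Longrightarrow> y < d \<Longrightarrow> (\<Sum>j<k. (adj (V j) * V j) $$ (x,y)) = (if x = y then 1 else 0)"
  obtains V' where "feasible d V'" "total_cost a c d V' \<rho> \<le> (\<Sum>j<k. cost a c (l j) (r j) (V j) \<rho>)"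
proof -
  have "\<forall>j\<in>{..<k}. \<exists>V'. V' \<in> carrier_mat (d*d) d \<and> adj V' * V' = adj (V j) * V j \<and>
      cost a c d d V' \<rho> \<le> cost a c (l j) (r j) (V j) \<rho>"
  proof
    fix j assume "j \<in> {..<k}"
    then have "V j \<in> carrier_mat (l j * r j) d" using V by simp
    from resize[OF \<rho> d this] show "\<exists>V'. V' \<in> carrier_mat (d*d) d \<and> adj V' * V' = adj (V j) * V j \<and>
      cost a c d d V' \<rho> \<le> cost a c (l j) (r j) (V j) \<rho>" by blast
  qed
  then obtain V1 where V1: "\<forall>j\<in>{..<k}. V1 j \<in> carrier_mat (d*d) d \<and> adj (V1 j) * V1 j = adj (V j) * V j \<and>
      cost a c d d (V1 j) \<rho> \<le> cost a c (l j) (r j) (V j) \<rho>" by (rule bchoice[THEN exE])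
  have "\<exists>J V2. card J \<le> d * d \<and> family_le a c d d d \<rho> J V2 {..<k} V1"
    by (rule reduce_family[OF \<rho> finite_lessThan]) (use V1 in auto)
  then obtain J V2 where J2: "card J \<le> d * d" and le: "family_le a c d d d \<rho> J V2 {..<k} V1" by blast
  have J: "finite J" "card J \<le> d * d" and V2: "\<forall>j\<in>J. V2 j \<in> carrier_mat (d*d) d"
    and G: "\<forall>x<d. \<forall>y<d. (\<Sum>j\<in>J. (adj (V2 j) * V2 j) $$ (x,y)) = (\<Sum>j<k. (adj (V1 j) * V1 j) $$ (x,y))"
    and C: "(\<Sum>j\<in>J. cost a c d d (V2 j) \<rho>) \<le> (\<Sum>j<k. cost a c d d (V1 j) \<rho>)"
    using J2 le unfolding family_le_def by auto
  obtain f where f: "bij_betw f {..<card J} J" using ex_bij_betw_nat_finite[OF J(1)] by (auto simp: lessThan_atLeast0)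
  \<comment> \<open>Renumbering by \<open>f\<close> and padding with zero operators gives exactly
    \<open>d * d\<close> of them, at no cost by \<open>cost_zero\<close>.\<close>
  define V3 where "V3 i = (if i < card J then V2 (f i) else 0\<^sub>m (d*d) d)" for i
  have reindex: "(\<Sum>i<d*d. g (V3 i)) = (\<Sum>j\<in>J. g (V2 j))" if "g (0\<^sub>m (d*d) d) = 0"
    for g :: "complex mat \<Rightarrow> 'z::comm_monoid_add"
  proof -
    have "(\<Sum>i<d*d. g (V3 i)) = (\<Sum>i<card J. g (V3 i))"
      by (intro sum.mono_neutral_right) (use J that in \<open>auto simp: V3_def\<close>)
    also have "\<dots> = (\<Sum>i<card J. g (V2 (f i)))" by (intro sum.cong) (auto simp: V3_def)
    also have "\<dots> = (\<Sum>j\<in>J. g (V2 j))" by (rule sum.reindex_bij_betw[OF f])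
    finally show ?thesis .
  qed
  have "feasible d V3"
    unfolding feasible_def
  proof (intro conjI allI impI)
    show "V3 j \<in> carrier_mat (d*d) d" if "j < d*d" for j
      using V2 bij_betwE[OF f] by (auto simp: V3_def)
    fix x y assume xy: "x < d" "y < d"
    have "(\<Sum>j<d*d. (adj (V3 j) * V3 j) $$ (x,y)) = (\<Sum>j\<in>J. (adj (V2 j) * V2 j) $$ (x,y))"
      by (rule reindex[of "\<lambda>M. (adj M * M) $$ (x,y)"]) (use xy in simp)
    also have "\<dots> = (\<Sum>j<k. (adj (V j) * V j) $$ (x,y))" using G xy V1 by simp
    finally show "(\<Sum>j<d*d. (adj (V3 j) * V3 j) $$ (x,y)) = (if x = y then 1 else 0)" using res[OF xy] by simp
  qed
  moreover have "total_cost a c d V3 \<rho> \<le> (\<Sum>j<k. cost a c (l j) (r j) (V j) \<rho>)"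
  proof -
    have "total_cost a c d V3 \<rho> = (\<Sum>j\<in>J. cost a c d d (V2 j) \<rho>)"
      unfolding total_cost_def by (rule reindex[of "\<lambda>M. cost a c d d M \<rho>"]) (rule cost_zero[OF \<rho>])
    also have "\<dots> \<le> (\<Sum>j<k. cost a c d d (V1 j) \<rho>)" by (rule C)
    also have "\<dots> \<le> (\<Sum>j<k. cost a c (l j) (r j) (V j) \<rho>)" by (rule sum_mono) (use V1 in auto)
    finally show ?thesis .
  qed
  ultimately show thesis by (rule that)
qed

section \<open>Compactness and continuity\<close>

text \<open>Bolzano-Weierstrass one coordinate at a time, each time refining the subsequence found
  so far.\<close>

lemma convergent_subsequence_finite:
  fixes f :: "nat \<Rightarrow> 'i \<Rightarrow> complex"
  assumes "finite I" "\<And>n i. i \<in> I \<Longrightarrow> cmod (f n i) \<le> B"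
  shows "\<exists>s g. strict_mono (s :: nat \<Rightarrow> nat) \<and> (\<forall>i\<in>I. (\<lambda>n. f (s n) i) \<longlonglongrightarrow> g i)"
  using assms
proof (induction I)
  case empty
  show ?case by (intro exI[of _ id]) (auto intro: strict_monoI)
next
  case (insert i I)
  then obtain s g where s: "strict_mono (s :: nat \<Rightarrow> nat)" and g: "\<forall>i\<in>I. (\<lambda>n. f (s n) i) \<longlonglongrightarrow> g i"
    by (metis insertCI)
  have "compact (cball (0::complex) B)" by (rule compact_cball)
  moreover have "\<forall>n. f (s n) i \<in> cball 0 B" using insert.prems by (auto simp: dist_norm)
  ultimately have "\<exists>x\<in>cball 0 B. \<exists>t. strict_mono t \<and> ((\<lambda>n. f (s n) i) \<circ> t) \<longlonglongrightarrow> x"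
    unfolding compact_def by (elim allE[of _ "\<lambda>n. f (s n) i"] impE)
  then obtain x t where t: "strict_mono t" "((\<lambda>n. f (s n) i) \<circ> t) \<longlonglongrightarrow> x" by blast
  have "(\<lambda>n. f ((s \<circ> t) n) i') \<longlonglongrightarrow> (g(i := x)) i'" if "i' \<in> insert i I" for i'
  proof (cases "i' = i")
    case False
    then show ?thesis using LIMSEQ_subseq_LIMSEQ[OF bspec[OF g, of i'] t(1)] that by (auto simp: o_def)
  qed (use t(2) in \<open>auto simp: o_def\<close>)
  moreover have "strict_mono (s \<circ> t)" using s t(1) by (rule strict_mono_o)
  ultimately show ?case by blast
qed

text \<open>The diagonal entry \<open>x\<close> of the sum of effects is 1, and it is the sum of the
  squared moduli of all entries in column \<open>x\<close> of all the operators.\<close>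

lemma feasible_bound:
  assumes "feasible d V" "j < d*d" "m < d*d" "x < d" shows "cmod (V j $$ (m,x)) \<le> 1"
proof -
  have c: "V i \<in> carrier_mat (d*d) d" if "i < d*d" for i using assms(1) that by (simp add: feasible_def)
  have "complex_of_real (\<Sum>i<d*d. \<Sum>k<d*d. (cmod (V i $$ (k,x)))\<^sup>2) = (\<Sum>i<d*d. (adj (V i) * V i) $$ (x,x))"
    unfolding of_real_sum[of _ "{..<d*d}"]
  proof (intro sum.cong refl)
    fix i assume "i \<in> {..<d*d}"
    then have [simp]: "dim_row (V i) = d*d" "dim_col (V i) = d" using c by auto
    show "(\<Sum>k<d*d. complex_of_real ((cmod (V i $$ (k,x)))\<^sup>2)) = (adj (V i) * V i) $$ (x,x)"
      using assms(4) by (subst adj_mult_self_diag) auto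
  qed
  also have "\<dots> = 1" using assms(1,4) by (simp add: feasible_def)
  finally have one: "(\<Sum>i<d*d. \<Sum>k<d*d. (cmod (V i $$ (k,x)))\<^sup>2) = 1" by (simp only: of_real_eq_1_iff)
  have "(cmod (V j $$ (m,x)))\<^sup>2 \<le> (\<Sum>k<d*d. (cmod (V j $$ (k,x)))\<^sup>2)"
    by (rule member_le_sum[of m "{..<d*d}" "\<lambda>k. (cmod (V j $$ (k,x)))\<^sup>2"]) (use assms in auto)
  also have "\<dots> \<le> (\<Sum>i<d*d. \<Sum>k<d*d. (cmod (V i $$ (k,x)))\<^sup>2)"
    by (rule member_le_sum[of j "{..<d*d}" "\<lambda>i. \<Sum>k<d*d. (cmod (V i $$ (k,x)))\<^sup>2"]) (use assms in \<open>auto intro: sum_nonneg\<close>)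
  finally show ?thesis unfolding one by (simp add: power_le_one_iff abs_square_le_1)
qed

text \<open>Bounded entries yield a convergent subsequence, and its limit is feasible because the
  constraint is an equation between continuous functions.\<close>

lemma feasible_compact:
  assumes V: "\<And>n. feasible d (V n)"
  obtains s L where "strict_mono (s :: nat \<Rightarrow> nat)" "feasible d L"
    "\<forall>j<d*d. mlim (d*d) d (\<lambda>n. V (s n) j) (L j)"
proof -
  have c: "V n j \<in> carrier_mat (d*d) d" if "j < d*d" for n j using V[of n] that by (simp add: feasible_def)
  let ?I = "{..<d*d} \<times> {..<d*d} \<times> {..<d}"
  have "\<exists>s g. strict_mono (s :: nat \<Rightarrow> nat) \<and>
      (\<forall>i\<in>?I. (\<lambda>n. (\<lambda>n (j,m,x). V n j $$ (m,x)) (s n) i) \<longlonglongrightarrow> g i)"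
    by (rule convergent_subsequence_finite[where B = 1]) (auto intro: feasible_bound[OF V])
  then obtain s g where s: "strict_mono (s :: nat \<Rightarrow> nat)"
    and g: "\<forall>i\<in>?I. (\<lambda>n. (\<lambda>n (j,m,x). V n j $$ (m,x)) (s n) i) \<longlonglongrightarrow> g i" by blast
  define L where "L j = mat (d*d) d (\<lambda>(m,x). g (j,m,x))" for j
  have lim: "mlim (d*d) d (\<lambda>n. V (s n) j) (L j)" if j: "j < d*d" for j
    unfolding mlim_def
  proof (intro conjI allI impI)
    fix m x assume "m < d*d" "x < d"
    then show "(\<lambda>n. V (s n) j $$ (m,x)) \<longlonglongrightarrow> L j $$ (m,x)"
      using g j by (auto simp: L_def)
  qed (use c[OF j] in \<open>auto simp: L_def\<close>)
  have "feasible d L"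
    unfolding feasible_def
  proof (intro conjI allI impI)
    fix x y assume xy: "x < d" "y < d"
    have "(\<lambda>n. \<Sum>j<d*d. (adj (V (s n) j) * V (s n) j) $$ (x,y)) \<longlonglongrightarrow> (\<Sum>j<d*d. (adj (L j) * L j) $$ (x,y))"
      by (intro tendsto_sum mlimD(5)[OF mlim_mult[OF mlim_adj[OF lim] lim]] xy) auto
    moreover have "(\<Sum>j<d*d. (adj (V (s n) j) * V (s n) j) $$ (x,y)) = (if x = y then 1 else 0)" for n
      using V[of "s n"] xy by (simp add: feasible_def)
    ultimately have "(\<lambda>n::nat. if x = y then 1 else 0) \<longlonglongrightarrow> (\<Sum>j<d*d. (adj (L j) * L j) $$ (x,y))" by simp
    then show "(\<Sum>j<d*d. (adj (L j) * L j) $$ (x,y)) = (if x = y then 1 else 0)"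
      using LIMSEQ_unique tendsto_const by blast
  qed (simp add: L_def)
  then show thesis using that s lim by blast
qed

lemma mlim_block_out:
  assumes "mlim n d V W" "mlim (a*d*c) (a*d*c) R \<rho>"
  shows "mlim (a*n*c) (a*n*c) (\<lambda>k. block_out a c (V k) (R k)) (block_out a c W \<rho>)"
proof -
  have E: "mlim (a*n*c) (a*d*c) (\<lambda>k. extend a c (V k)) (extend a c W)"
    unfolding extend_def by (intro mlim_kron mlim_const assms(1)) auto
  show ?thesis unfolding block_out_def
    by (rule mlim_mult[OF mlim_mult[OF E assms(2)] mlim_adj[OF E]])
qed

text \<open>Both arguments vary: in the lower half of \<open>tendsto_min_cost\<close> the minimisers
  move together with the state.\<close>

lemma tendsto_cost:
  assumes V: "mlim (l*r) d V W" and R: "mlim (a*d*c) (a*d*c) R \<rho>" and psd: "\<And>k. psd (a*d*c) (R k)" "psd (a*d*c) \<rho>"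
  shows "(\<lambda>k. cost a c l r (V k) (R k)) \<longlonglongrightarrow> cost a c l r W \<rho>"
proof -
  have Vc: "V k \<in> carrier_mat (l*r) d" "W \<in> carrier_mat (l*r) d" for k using V by (auto simp: mlim_def)
  have X: "mlim (a*l*(r*c)) (a*l*(r*c)) (\<lambda>k. block_out a c (V k) (R k)) (block_out a c W \<rho>)"
    using mlim_block_out[OF V R] by (simp add: mult.assoc)
  have t: "(\<lambda>k. Re (mtrace (block_out a c (V k) (R k)))) \<longlonglongrightarrow> Re (mtrace (block_out a c W \<rho>))"
    by (rule tendsto_Re[OF mlim_mtrace[OF X]])
  show ?thesis
    unfolding cost_def
  proof (intro tendsto_diff tendsto_add)
    show "(\<lambda>k. eta (margL a c l r (V k) (R k))) \<longlonglongrightarrow> eta (margL a c l r W \<rho>)"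
      by (rule tendsto_eta[OF _ psd_marg(1)[OF psd(1) Vc(1)] psd_marg(1)[OF psd(2) Vc(2)]])
        (simp add: margL_def mlim_ptrR[OF X])
    show "(\<lambda>k. eta (margR a c l r (V k) (R k))) \<longlonglongrightarrow> eta (margR a c l r W \<rho>)"
      by (rule tendsto_eta[OF _ psd_marg(2)[OF psd(1) Vc(1)] psd_marg(2)[OF psd(2) Vc(2)]])
        (simp add: margR_def mlim_ptrL[OF X])
    show "(\<lambda>k. xlnx (Re (mtrace (block_out a c (V k) (R k))))) \<longlonglongrightarrow> xlnx (Re (mtrace (block_out a c W \<rho>)))"
      by (rule tendsto_xlnx[OF t mtrace_psd(1)[OF psd_block_out'[OF psd(1) Vc(1)]]
            mtrace_psd(1)[OF psd_block_out'[OF psd(2) Vc(2)]]])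
  qed
qed

lemma tendsto_total_cost:
  assumes "\<forall>j<d*d. mlim (d*d) d (\<lambda>k. V k j) (W j)" "mlim (a*d*c) (a*d*c) R \<rho>"
    "\<And>k. psd (a*d*c) (R k)" "psd (a*d*c) \<rho>"
  shows "(\<lambda>k. total_cost a c d (V k) (R k)) \<longlonglongrightarrow> total_cost a c d W \<rho>"
  unfolding total_cost_def by (intro tendsto_sum tendsto_cost[of d d d] assms(2-4)) (use assms(1) in auto)

text \<open>An isometry into dimension \<open>d * d\<close> is placed in block 0, which exists
  because \<open>0 < d\<close>; all other blocks are zero.\<close>

lemma feasible_exists:
  assumes d: "0 < d" obtains V where "feasible d V"
proof -
  obtain Q where Q: "isometry d (d*d) Q" using isometry_exists[of d "d*d"] d by auto
  define V where "V j = (if j = 0 then Q else 0\<^sub>m (d*d) d)" for j :: nat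
  have "feasible d V"
    unfolding feasible_def
  proof (intro conjI allI impI)
    show "V j \<in> carrier_mat (d*d) d" for j using isometryD(4)[OF Q] by (simp add: V_def)
    fix x y assume xy: "x < d" "y < d"
    have "(\<Sum>j<d*d. (adj (V j) * V j) $$ (x,y)) = (\<Sum>j<d*d. if j = 0 then 1\<^sub>m d $$ (x,y) else 0)"
      by (intro sum.cong) (use xy isometryD(3)[OF Q] in \<open>auto simp: V_def\<close>)
    also have "\<dots> = (if x = y then 1 else 0)" using xy d by simp
    finally show "(\<Sum>j<d*d. (adj (V j) * V j) $$ (x,y)) = (if x = y then 1 else 0)" .
  qed
  then show thesis by (rule that)
qed

definition min_cost :: "nat \<Rightarrow> nat \<Rightarrow> nat \<Rightarrow> complex mat \<Rightarrow> real" where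
  "min_cost a c d \<rho> = Inf {total_cost a c d V \<rho> | V. feasible d V}"

text \<open>The set of attainable costs is sequentially compact and nonempty, hence has a least
  element, which is its infimum.\<close>

lemma min_cost_attained:
  assumes \<rho>: "psd (a*d*c) \<rho>" and d: "0 < d"
  shows "\<exists>V. feasible d V \<and> total_cost a c d V \<rho> = min_cost a c d \<rho> \<and>
     (\<forall>W. feasible d W \<longrightarrow> min_cost a c d \<rho> \<le> total_cost a c d W \<rho>)"
proof -
  let ?S = "{total_cost a c d V \<rho> | V. feasible d V}"
  have "compact ?S"
    unfolding compact_def
  proof (intro allI impI)
    fix f :: "nat \<Rightarrow> real" assume "\<forall>n. f n \<in> ?S"
    then have "\<forall>n. \<exists>V. f n = total_cost a c d V \<rho> \<and> feasible d V" by blast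
    then obtain V where V: "\<And>n. f n = total_cost a c d (V n) \<rho>" "\<And>n. feasible d (V n)" by metis
    obtain s L where s: "strict_mono (s :: nat \<Rightarrow> nat)" "feasible d L"
      "\<forall>j<d*d. mlim (d*d) d (\<lambda>n. V (s n) j) (L j)"
      by (rule feasible_compact[OF V(2)], rule that)
    have "(f \<circ> s) \<longlonglongrightarrow> total_cost a c d L \<rho>"
      unfolding o_def V(1)
      by (rule tendsto_total_cost[OF s(3) mlim_const[OF psdD(1)[OF \<rho>]] \<rho> \<rho>])
    then show "\<exists>l\<in>?S. \<exists>r. strict_mono r \<and> (f \<circ> r) \<longlonglongrightarrow> l" using s by blast
  qed
  moreover have "?S \<noteq> {}" using feasible_exists[OF d] by blast
  ultimately obtain m where m: "m \<in> ?S" "\<forall>t\<in>?S. m \<le> t" using compact_attains_inf by blast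
  then have eq: "min_cost a c d \<rho> = m" unfolding min_cost_def by (intro cInf_eq_minimum) auto
  obtain V where V: "feasible d V" "m = total_cost a c d V \<rho>" using m(1) by blast
  have "m \<le> total_cost a c d W \<rho>" if "feasible d W" for W using m(2) that by blast
  then show ?thesis unfolding eq using V by (intro exI[of _ V]) simp
qed

text \<open>Above: a minimiser for the limit stays a competitor along the sequence. Below: otherwise
  minimisers along a bad subsequence would accumulate at a feasible family whose cost at the limit
  is too small.\<close>

lemma tendsto_min_cost:
  assumes R: "mlim (a*d*c) (a*d*c) R \<rho>" and psd: "\<And>k. psd (a*d*c) (R k)" "psd (a*d*c) \<rho>" and d: "0 < d"
  shows "(\<lambda>k. min_cost a c d (R k)) \<longlonglongrightarrow> min_cost a c d \<rho>"
proof (rule order_tendstoI)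
  fix u assume u: "min_cost a c d \<rho> < u"
  obtain V where V: "feasible d V" "total_cost a c d V \<rho> = min_cost a c d \<rho>"
    using min_cost_attained[OF psd(2) d] by blast
  have Vc: "V j \<in> carrier_mat (d*d) d" if "j < d*d" for j using V(1) that by (simp add: feasible_def)
  have "(\<lambda>k. total_cost a c d V (R k)) \<longlonglongrightarrow> min_cost a c d \<rho>"
    unfolding V(2)[symmetric] by (rule tendsto_total_cost[OF _ R psd]) (simp add: mlim_const Vc)
  then have "\<forall>\<^sub>F k in sequentially. total_cost a c d V (R k) < u" using u by (rule order_tendstoD)
  then show "\<forall>\<^sub>F k in sequentially. min_cost a c d (R k) < u"
  proof eventually_elim
    case (elim k)
    have "min_cost a c d (R k) \<le> total_cost a c d V (R k)" using min_cost_attained[OF psd(1) d] V(1) by blast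
    then show ?case using elim by simp
  qed
next
  fix u assume u: "u < min_cost a c d \<rho>"
  show "\<forall>\<^sub>F k in sequentially. u < min_cost a c d (R k)"
  proof (rule ccontr)
    assume "\<not> ?thesis"
    then obtain r where r: "strict_mono (r :: nat \<Rightarrow> nat)" "\<And>k. \<not> u < min_cost a c d (R (r k))"
      using not_eventually_sequentiallyD by blast
    have "\<forall>k. \<exists>V. feasible d V \<and> total_cost a c d V (R (r k)) = min_cost a c d (R (r k))"
      using min_cost_attained[OF psd(1) d] by blast
    then obtain V where V: "\<And>k. feasible d (V k)"
      "\<And>k. total_cost a c d (V k) (R (r k)) = min_cost a c d (R (r k))" by metis
    obtain s L where s: "strict_mono (s :: nat \<Rightarrow> nat)" "feasible d L"
      "\<forall>j<d*d. mlim (d*d) d (\<lambda>n. V (s n) j) (L j)"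
      by (rule feasible_compact[OF V(1)], rule that)
    have rs: "strict_mono (r \<circ> s)" using r(1) s(1) by (rule strict_mono_o)
    have "mlim (a*d*c) (a*d*c) (\<lambda>n. R (r (s n))) \<rho>"
      using R LIMSEQ_subseq_LIMSEQ[OF _ rs] unfolding mlim_def o_def by blast
    from tendsto_total_cost[OF s(3) this psd]
    have "(\<lambda>n. min_cost a c d (R (r (s n)))) \<longlonglongrightarrow> total_cost a c d L \<rho>" by (simp only: V(2))
    then have "total_cost a c d L \<rho> \<le> u"
      by (rule LIMSEQ_le_const2) (use r(2) in \<open>auto simp: not_less\<close>)
    moreover have "min_cost a c d \<rho> \<le> total_cost a c d L \<rho>"
      using min_cost_attained[OF psd(2) d] s(2) by blast
    ultimately show False using u by simp
  qed
qed

section \<open>Relative entropy to a Markov state\<close>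

lemma msum_dim [simp]: "dim_row (msum n k F) = n" "dim_col (msum n k F) = n"
  by (auto simp: msum_def)

lemma msum_index: "i < n \<Longrightarrow> j < n \<Longrightarrow> msum n k F $$ (i,j) = (\<Sum>a<k. F a $$ (i,j))"
  by (simp add: msum_def)

lemma msum_cong: "(\<And>j. j < k \<Longrightarrow> F j = G j) \<Longrightarrow> msum n k F = msum n k G"
  by (rule eq_matI) (auto simp: msum_index intro!: sum.cong)

lemma mtrace_mult_msum:
  assumes A: "A \<in> carrier_mat n n" and F: "\<And>j. j < k \<Longrightarrow> F j \<in> carrier_mat n n"
  shows "mtrace (A * msum n k F) = (\<Sum>j<k. mtrace (A * F j))"
proof -
  note [simp] = carrier_matD[OF A]
  have "mtrace (A * msum n k F) = (\<Sum>x<n. \<Sum>y<n. \<Sum>j<k. A $$ (x,y) * F j $$ (y,x))"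
    by (subst mtrace_mult) (auto simp: msum_index sum_distrib_left)
  also have "\<dots> = (\<Sum>x<n. \<Sum>j<k. \<Sum>y<n. A $$ (x,y) * F j $$ (y,x))"
    by (intro sum.cong refl sum.swap)
  also have "\<dots> = (\<Sum>j<k. \<Sum>x<n. \<Sum>y<n. A $$ (x,y) * F j $$ (y,x))" by (rule sum.swap)
  also have "\<dots> = (\<Sum>j<k. mtrace (A * F j))"
  proof (intro sum.cong refl)
    fix j assume "j \<in> {..<k}"
    then have "dim_row (F j) = n" "dim_col (F j) = n" using F by auto
    then show "(\<Sum>x<n. \<Sum>y<n. A $$ (x,y) * F j $$ (y,x)) = mtrace (A * F j)" by (simp add: mtrace_mult)
  qed
  finally show ?thesis .
qed

lemma msum_mult_index:
  assumes V: "dim_row V = n" and F: "\<And>j. j < k \<Longrightarrow> F j \<in> carrier_mat n n" and xy: "x < n" "y < dim_col V"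
  shows "(msum n k F * V) $$ (x,y) = (\<Sum>j<k. (F j * V) $$ (x,y))"
proof -
  have "(msum n k F * V) $$ (x,y) = (\<Sum>z<n. \<Sum>j<k. F j $$ (x,z) * V $$ (z,y))"
    using V xy by (subst index_mult_sum) (auto simp: msum_index sum_distrib_right)
  also have "\<dots> = (\<Sum>j<k. \<Sum>z<n. F j $$ (x,z) * V $$ (z,y))" by (rule sum.swap)
  also have "\<dots> = (\<Sum>j<k. (F j * V) $$ (x,y))"
  proof (intro sum.cong refl)
    fix j assume "j \<in> {..<k}"
    then have "dim_row (F j) = n" "dim_col (F j) = n" using F by auto
    then show "(\<Sum>z<n. F j $$ (x,z) * V $$ (z,y)) = (F j * V) $$ (x,y)"
      using V xy by (subst index_mult_sum) auto
  qed
  finally show ?thesis .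
qed

lemma msum_mult_single:
  assumes V: "dim_row V = n" and F: "\<And>j. j < k \<Longrightarrow> F j \<in> carrier_mat n n" and i: "i < k"
    and z: "\<And>j. j < k \<Longrightarrow> j \<noteq> i \<Longrightarrow> F j * V = 0\<^sub>m n (dim_col V)"
  shows "msum n k F * V = F i * V"
proof (rule eq_matI)
  have Fi: "dim_row (F i) = n" "dim_col (F i) = n" using F[OF i] by auto
  show "dim_row (msum n k F * V) = dim_row (F i * V)" "dim_col (msum n k F * V) = dim_col (F i * V)"
    using Fi by auto
  fix x y assume "x < dim_row (F i * V)" "y < dim_col (F i * V)"
  then have xy: "x < n" "y < dim_col V" using Fi by auto
  have "(\<Sum>j<k. (F j * V) $$ (x,y)) = (\<Sum>j<k. if j = i then (F i * V) $$ (x,y) else 0)"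
    by (intro sum.cong refl) (use z xy in auto)
  then show "(msum n k F * V) $$ (x,y) = (F i * V) $$ (x,y)"
    using msum_mult_index[OF V F xy] i by simp
qed

lemma adj_msum:
  assumes "\<And>j. j < k \<Longrightarrow> F j \<in> carrier_mat n n"
  shows "adj (msum n k F) = msum n k (\<lambda>j. adj (F j))"
  using carrier_matD[OF assms] by (intro eq_matI) (auto simp: msum_index intro!: sum.cong)

lemma extend_msum:
  assumes F: "\<And>j. j < k \<Longrightarrow> F j \<in> carrier_mat n n"
  shows "msum (a*n*c) k (\<lambda>j. extend a c (F j)) = extend a c (msum n k F)"
proof (rule eq_matI)
  fix x y assume "x < dim_row (extend a c (msum n k F))" "y < dim_col (extend a c (msum n k F))"
  then have xy: "x < a * n * c" "y < a * n * c" by auto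
  note xy' = less_mult_div_mod[OF xy(1)] less_mult_div_mod[OF xy(2)]
  note xy'' = less_mult_div_mod[OF xy'(1)] less_mult_div_mod[OF xy'(3)]
  have ex: "extend a c M $$ (x,y) = 1\<^sub>m a $$ (x div c div n, y div c div n) * M $$ (x div c mod n, y div c mod n) * 1\<^sub>m c $$ (x mod c, y mod c)"
    if "dim_row M = n" "dim_col M = n" for M
    using that xy xy' unfolding extend_def by (simp add: kron_index)
  have "msum (a*n*c) k (\<lambda>j. extend a c (F j)) $$ (x,y) =
      (\<Sum>j<k. 1\<^sub>m a $$ (x div c div n, y div c div n) * F j $$ (x div c mod n, y div c mod n) * 1\<^sub>m c $$ (x mod c, y mod c))"
    unfolding msum_index[OF xy] by (intro sum.cong refl ex) (use carrier_matD[OF F] in auto)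
  also have "\<dots> = extend a c (msum n k F) $$ (x,y)"
    using xy'' by (subst ex) (auto simp: msum_index sum_distrib_left sum_distrib_right)
  finally show "msum (a*n*c) k (\<lambda>j. extend a c (F j)) $$ (x,y) = extend a c (msum n k F) $$ (x,y)" .
qed auto

lemma kron_rdiag: "kron (rdiag m a) (rdiag n b) = rdiag (m*n) (\<lambda>i. a (i div n) * b (i mod n))"
proof (rule eq_matI)
  fix i j assume "i < dim_row (rdiag (m*n) (\<lambda>i. a (i div n) * b (i mod n)))"
    "j < dim_col (rdiag (m*n) (\<lambda>i. a (i div n) * b (i mod n)))"
  then have ij: "i < m * n" "j < m * n" by auto
  have "i = j" if "i div n = j div n" "i mod n = j mod n" using that by (metis div_mult_mod_eq)
  then show "kron (rdiag m a) (rdiag n b) $$ (i,j) = rdiag (m*n) (\<lambda>i. a (i div n) * b (i mod n)) $$ (i,j)"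
    using ij less_mult_div_mod[OF ij(1)] less_mult_div_mod[OF ij(2)] by (auto simp: kron_index rdiag_index)
qed auto

text \<open>With \<open>M = G * adj G\<close> the diagonal entry is the squared norm of a column of
  \<open>adj G * U\<close>, so that column is zero and \<open>M\<close> annihilates column
  \<open>i\<close> of \<open>U\<close>.\<close>

lemma psd_zero_diag:
  assumes M: "psd n M" and U: "U \<in> carrier_mat n m" and i: "i < m" "Re ((adj U * M * U) $$ (i,i)) = 0" and x: "x < n"
  shows "(M * U) $$ (x,i) = 0"
proof -
  obtain G where G: "G \<in> carrier_mat n n" "M = G * adj G" by (rule psd_sqrt[OF M], rule that)
  note [simp] = carrier_matD[OF G(1)] carrier_matD[OF U]
  have "adj U * M * U = adj (adj G * U) * (adj G * U)" unfolding G(2) by (simp add: adj_mult mult_assoc_dim)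
  then have "(\<Sum>k<n. (cmod ((adj G * U) $$ (k,i)))\<^sup>2) = 0"
    using i adj_mult_self_diag[of i "adj G * U"] by (simp del: index_mult_mat(1))
  then have z: "\<forall>k<n. (adj G * U) $$ (k,i) = 0"
    by (subst (asm) sum_nonneg_eq_0_iff) (auto simp del: index_mult_mat(1))
  have "M * U = G * (adj G * U)" unfolding G(2) by (simp add: mult_assoc_dim)
  then show ?thesis using x i(1) z by (simp add: index_mult_sum[of x G i "adj G * U"] del: index_mult_mat(1))
qed

text \<open>The function inside \<open>mlog\<close>. With value 0 at eigenvalue 0,
  \<open>mlog\<close> of a positive matrix is the logarithm on its support.\<close>

definition ln0 :: "real \<Rightarrow> real" where "ln0 x = (if x > 0 then ln x else 0)"

lemma mlog_ln0: "mlog M = mat_fun ln0 M"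
  by (simp add: mlog_def ln0_def[abs_def])

lemma mtrace_mult_mlog_self:
  assumes M: "psd n M" shows "Re (mtrace (M * mlog M)) = - eta M"
proof -
  obtain U d where U: "unitary_m n U" and Md: "M = U * rdiag n d * adj U"
    and d: "\<And>i. i < n \<Longrightarrow> 0 \<le> d i"
    by (rule psd_spectral[OF M], rule that)
  note [simp] = unitaryD[OF U]
  have "rdiag n d * (rdiag n (ln0 \<circ> d) * adj U) = rdiag n (\<lambda>i. - xlnx (d i)) * adj U"
  proof -
    have "rdiag n d * rdiag n (ln0 \<circ> d) = rdiag n (\<lambda>i. - xlnx (d i))"
      unfolding rdiag_mult_rdiag by (rule eq_matI) (auto simp: rdiag_index ln0_def xlnx_def dest!: d)
    then show ?thesis by (subst mult_assoc_dim[symmetric]) auto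
  qed
  then have "M * mlog M = U * rdiag n (\<lambda>i. - xlnx (d i)) * adj U"
    unfolding mlog_ln0 Md mat_fun_diag[OF U] by (simp add: mult_assoc_dim mult_adj_cancel)
  then have "mtrace (M * mlog M) = complex_of_real (\<Sum>i<n. - xlnx (d i))"
    by (simp only: mtrace_unitary_conj[OF U rdiag_carrier] mtrace_rdiag)
  then show ?thesis unfolding Md eta_diag[OF U] by (simp add: sum_negf)
qed

text \<open>A Markov decomposition together with eigenbases of the factor states, and a positive
  \<open>R\<close> to compare with. The eigenbases are parameters: the lower bound takes those of a
  given Markov state, the attainment builds the factor states from those of the marginals.\<close>

locale markov_diag =
  fixes dX dY dZ k :: nat and l r :: "nat \<Rightarrow> nat" and W :: "nat \<Rightarrow> complex mat" and p :: "nat \<Rightarrow> real"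
    and \<sigma> \<tau> :: "nat \<Rightarrow> complex mat" and \<mu> :: "complex mat"
    and S T :: "nat \<Rightarrow> complex mat" and s t :: "nat \<Rightarrow> nat \<Rightarrow> real" and R :: "complex mat"
  assumes md: "markov_decomp dX dY dZ k l r W p \<sigma> \<tau> \<mu>"
    and S: "\<And>j. j < k \<Longrightarrow> unitary_m (dX * l j) (S j)"
    and T: "\<And>j. j < k \<Longrightarrow> unitary_m (r j * dZ) (T j)"
    and \<sigma>: "\<And>j. j < k \<Longrightarrow> \<sigma> j = S j * rdiag (dX * l j) (s j) * adj (S j)"
    and \<tau>: "\<And>j. j < k \<Longrightarrow> \<tau> j = T j * rdiag (r j * dZ) (t j) * adj (T j)"
    and R: "psd (dX * dY * dZ) R"
begin

definition n where "n = dX * dY * dZ"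
definition m where "m j = (dX * l j) * (r j * dZ)"
definition E where "E j = extend dX dZ (W j)"
definition ST where "ST j = kron (S j) (T j)"
definition U where "U j = E j * ST j"
text \<open>Eigenvalue of \<open>\<mu>\<close> for column \<open>i\<close> of \<open>U j\<close>;
  quotient and remainder of \<open>i\<close> pick the eigenvalues of the two factors.\<close>

definition ev where "ev j i = p j * (s j (i div (r j * dZ)) * t j (i mod (r j * dZ)))"
definition Y where "Y j = adj (E j) * R * E j"
text \<open>Diagonal of \<open>R\<close> in the eigenbasis of \<open>\<mu>\<close>. The later
  \<open>xa\<close> and \<open>xb\<close> turn out to be its two marginals in block
  \<open>j\<close>.\<close>

definition x where "x j i = Re ((adj (U j) * R * U j) $$ (i,i))"
definition q where "q j = Re (mtrace (Y j))"
definition xa where "xa j a = Re ((adj (S j) * ptrR (dX * l j) (r j * dZ) (Y j) * S j) $$ (a,a))"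
definition xb where "xb j b = Re ((adj (T j) * ptrL (dX * l j) (r j * dZ) (Y j) * T j) $$ (b,b))"

lemma R': "psd n R" using R by (simp add: n_def)

lemma W_isometry: "j < k \<Longrightarrow> isometry (l j * r j) dY (W j)"
  and W_orth: "i < k \<Longrightarrow> j < k \<Longrightarrow> i \<noteq> j \<Longrightarrow> adj (W i) * W j = 0\<^sub>m (l i * r i) (l j * r j)"
  and W_sum: "msum dY k (\<lambda>j. W j * adj (W j)) = 1\<^sub>m dY"
  and p_nonneg: "j < k \<Longrightarrow> 0 \<le> p j" and p_sum: "(\<Sum>j<k. p j) = 1"
  and \<sigma>_density: "j < k \<Longrightarrow> density (dX * l j) (\<sigma> j)"
  and \<tau>_density: "j < k \<Longrightarrow> density (r j * dZ) (\<tau> j)"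
  and \<mu>_eq: "\<mu> = msum n k (\<lambda>j. complex_of_real (p j) \<cdot>\<^sub>m (E j * kron (\<sigma> j) (\<tau> j) * adj (E j)))"
  using md unfolding markov_decomp_def E_def extend_def n_def Let_def by auto

lemma E_dim: assumes "j < k" shows "dim_row (E j) = n" "dim_col (E j) = m j"
  using isometryD(1,2)[OF W_isometry[OF assms]] by (auto simp: E_def n_def m_def mult.assoc)

lemma ST_dim: assumes "j < k" shows "dim_row (ST j) = m j" "dim_col (ST j) = m j"
  using unitaryD(1,2)[OF S[OF assms]] unitaryD(1,2)[OF T[OF assms]] by (auto simp: ST_def m_def)

lemma ST_unitary: assumes "j < k" shows "unitary_m (m j) (ST j)"
  using unitaryD[OF S[OF assms]] unitaryD[OF T[OF assms]]
  by (auto simp: unitary_m_def isometry_def ST_def adj_kron kron_mult m_def intro!: carrier_matI)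

lemma U_dim: assumes "j < k" shows "dim_row (U j) = n" "dim_col (U j) = m j"
  using E_dim[OF assms] ST_dim[OF assms] by (auto simp: U_def)

lemma U_carrier: "j < k \<Longrightarrow> U j \<in> carrier_mat n (m j)"
  using U_dim by (auto intro!: carrier_matI)

lemma E_gram: assumes "i < k" "j < k" shows "adj (E i) * E j = (if i = j then 1\<^sub>m (m j) else 0\<^sub>m (m i) (m j))"
proof -
  note Wi = isometryD[OF W_isometry[OF assms(1)]] and Wj = isometryD[OF W_isometry[OF assms(2)]]
  have "adj (E i) * E j = extend dX dZ (adj (W i) * W j)"
    using Wi Wj by (simp add: E_def adj_extend extend_mult)
  moreover have "extend dX dZ (0\<^sub>m (l i * r i) (l j * r j)) = 0\<^sub>m (m i) (m j)"
    by (rule eq_matI) (auto simp: extend_def kron_index m_def less_mult_div_mod mult.assoc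
        less_mult_div_mod(2)[of _ dX] less_mult_div_mod(1)[of _ _ dZ])
  ultimately show ?thesis
    using Wj W_orth[OF assms] by (auto simp: m_def mult.assoc)
qed

lemma E_mult_U: assumes "i < k" "j < k" shows "adj (E i) * U j = (if i = j then ST j else 0\<^sub>m (m i) (m j))"
proof -
  have "adj (E i) * U j = (adj (E i) * E j) * ST j"
    unfolding U_def by (rule mult_assoc_dim[symmetric]) (use assms E_dim ST_dim in auto)
  then show ?thesis using E_gram[OF assms] ST_dim[OF assms(2)] by auto
qed

lemma \<sigma>\<tau>_diag: assumes j: "j < k"
  shows "complex_of_real (p j) \<cdot>\<^sub>m kron (\<sigma> j) (\<tau> j) = ST j * rdiag (m j) (ev j) * adj (ST j)"
proof -
  note [simp] = unitaryD[OF S[OF j]] unitaryD[OF T[OF j]]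
  have "kron (\<sigma> j) (\<tau> j) = ST j * kron (rdiag (dX * l j) (s j)) (rdiag (r j * dZ) (t j)) * adj (ST j)"
    unfolding \<sigma>[OF j] \<tau>[OF j] ST_def by (simp add: kron_mult adj_kron)
  then have eq: "complex_of_real (p j) \<cdot>\<^sub>m kron (\<sigma> j) (\<tau> j) =
      ST j * (complex_of_real (p j) \<cdot>\<^sub>m rdiag (m j) (\<lambda>i. s j (i div (r j * dZ)) * t j (i mod (r j * dZ)))) * adj (ST j)"
    unfolding kron_rdiag using ST_dim[OF j] by (simp add: mult_smult_dim smult_mult_dim m_def)
  have "complex_of_real (p j) \<cdot>\<^sub>m rdiag (m j) (\<lambda>i. s j (i div (r j * dZ)) * t j (i mod (r j * dZ))) = rdiag (m j) (ev j)"
    by (rule eq_matI) (auto simp: rdiag_index ev_def)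
  then show ?thesis unfolding eq by simp
qed

lemma \<mu>_summand: assumes j: "j < k"
  shows "complex_of_real (p j) \<cdot>\<^sub>m (E j * kron (\<sigma> j) (\<tau> j) * adj (E j)) = U j * rdiag (m j) (ev j) * adj (U j)"
proof -
  note [simp] = ST_dim[OF j] E_dim[OF j]
  have "dim_row (kron (\<sigma> j) (\<tau> j)) = m j" "dim_col (kron (\<sigma> j) (\<tau> j)) = m j"
    using unitaryD(1,2)[OF S[OF j]] unitaryD(1,2)[OF T[OF j]] by (auto simp: \<sigma>[OF j] \<tau>[OF j] m_def)
  then have "complex_of_real (p j) \<cdot>\<^sub>m (E j * kron (\<sigma> j) (\<tau> j) * adj (E j))
      = E j * (complex_of_real (p j) \<cdot>\<^sub>m kron (\<sigma> j) (\<tau> j)) * adj (E j)"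
    by (simp add: mult_smult_dim smult_mult_dim)
  also have "\<dots> = U j * rdiag (m j) (ev j) * adj (U j)"
    unfolding \<sigma>\<tau>_diag[OF j] U_def by (simp add: adj_mult mult_assoc_dim)
  finally show ?thesis .
qed

lemma \<mu>_U_sum: "\<mu> = msum n k (\<lambda>j. U j * rdiag (m j) (ev j) * adj (U j))"
  unfolding \<mu>_eq by (rule msum_cong) (rule \<mu>_summand)

lemma U_gram: assumes "i < k" "j < k" shows "adj (U i) * U j = (if i = j then 1\<^sub>m (m j) else 0\<^sub>m (m i) (m j))"
proof -
  have "adj (U i) * U j = adj (ST i) * (adj (E i) * U j)"
    unfolding U_def[of i] using E_dim ST_dim U_dim assms by (simp add: adj_mult mult_assoc_dim)
  then show ?thesis
    unfolding E_mult_U[OF assms] using unitaryD[OF ST_unitary[OF assms(2)]] ST_dim[OF assms(1)] by auto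
qed

text \<open>The columns of all \<open>U j\<close> together form an orthonormal basis: the unitaries
  \<open>ST j\<close> cancel, and the completeness of \<open>W\<close> extends to the three
  systems.\<close>

lemma U_sum: "msum n k (\<lambda>j. U j * adj (U j)) = 1\<^sub>m n"
proof -
  have "msum n k (\<lambda>j. U j * adj (U j)) = msum n k (\<lambda>j. extend dX dZ (W j * adj (W j)))"
  proof (rule msum_cong)
    fix j assume j: "j < k"
    note [simp] = unitaryD[OF ST_unitary[OF j]] E_dim[OF j]
    have "U j * adj (U j) = E j * adj (E j)"
      unfolding U_def by (simp add: adj_mult mult_assoc_dim mult_adj_cancel')
    then show "U j * adj (U j) = extend dX dZ (W j * adj (W j))"
      by (simp add: E_def adj_extend extend_mult)
  qed
  also have "\<dots> = extend dX dZ (msum dY k (\<lambda>j. W j * adj (W j)))"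
    unfolding n_def by (rule extend_msum) (use isometryD[OF W_isometry] in \<open>auto intro!: carrier_matI\<close>)
  also have "\<dots> = 1\<^sub>m n" unfolding W_sum by (simp add: n_def)
  finally show ?thesis .
qed

lemma \<mu>_carrier: "\<mu> \<in> carrier_mat n n" "adj \<mu> = \<mu>"
proof -
  show "\<mu> \<in> carrier_mat n n" unfolding \<mu>_U_sum by (auto intro!: carrier_matI)
  have "adj \<mu> = msum n k (\<lambda>j. adj (U j * rdiag (m j) (ev j) * adj (U j)))"
    unfolding \<mu>_U_sum by (rule adj_msum) (use U_dim in \<open>auto intro!: carrier_matI\<close>)
  also have "\<dots> = \<mu>" unfolding \<mu>_U_sum
    by (rule msum_cong) (use U_dim in \<open>simp add: adj_mult mult_assoc_dim\<close>)
  finally show "adj \<mu> = \<mu>" .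
qed

text \<open>The other summands vanish on \<open>U j\<close> by orthogonality, so its columns are
  eigenvectors of \<open>\<mu>\<close>.\<close>

lemma \<mu>_mult_U: assumes j: "j < k" shows "\<mu> * U j = U j * rdiag (m j) (ev j)"
proof -
  have "\<mu> * U j = U j * rdiag (m j) (ev j) * adj (U j) * U j"
    unfolding \<mu>_U_sum
  proof (rule msum_mult_single[OF U_dim(1)[OF j] _ j])
    fix i assume i: "i < k" "i \<noteq> j"
    have "U i * rdiag (m i) (ev i) * adj (U i) * U j = U i * rdiag (m i) (ev i) * (adj (U i) * U j)"
      using U_dim[OF i(1)] U_dim[OF j] by (simp add: mult_assoc_dim)
    then show "U i * rdiag (m i) (ev i) * adj (U i) * U j = 0\<^sub>m n (dim_col (U j))"
      using U_gram[OF i(1) j] i U_dim[OF i(1)] U_dim[OF j] by simp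
  qed (use U_dim in \<open>auto intro!: carrier_matI\<close>)
  also have "\<dots> = U j * rdiag (m j) (ev j) * (adj (U j) * U j)"
    using U_dim[OF j] by (simp add: mult_assoc_dim)
  finally show ?thesis using U_gram[OF j j] U_dim[OF j] by (simp add: mult_assoc_dim)
qed

text \<open>Inserting the resolution of the identity \<open>U_sum\<close> turns the trace into a
  diagonal sum, since \<open>mlog \<mu>\<close> acts on the columns of \<open>U j\<close> through
  their eigenvalues.\<close>

lemma mtrace_mlog:
  "Re (mtrace (R * mlog \<mu>)) = (\<Sum>j<k. \<Sum>i<m j. x j i * ln0 (ev j i))"
proof -
  note Rc = psdD[OF R'] and N = carrier_matD[OF mat_fun_carrier[OF \<mu>_carrier, of ln0]]
  have "mtrace (R * mlog \<mu>) = mtrace (R * mat_fun ln0 \<mu> * msum n k (\<lambda>j. U j * adj (U j)))"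
    unfolding U_sum mlog_ln0 using Rc N by simp
  also have "\<dots> = (\<Sum>j<k. mtrace (R * mat_fun ln0 \<mu> * (U j * adj (U j))))"
    by (rule mtrace_mult_msum) (use Rc N U_dim in \<open>auto intro!: carrier_matI\<close>)
  also have "\<dots> = (\<Sum>j<k. \<Sum>i<m j. (adj (U j) * R * U j) $$ (i,i) * ln0 (ev j i))"
  proof (intro sum.cong refl)
    fix j assume "j \<in> {..<k}"
    then have j: "j < k" by simp
    note [simp] = U_dim[OF j] Rc(3,4) N
    have "mtrace (R * mat_fun ln0 \<mu> * (U j * adj (U j))) = mtrace ((R * (mat_fun ln0 \<mu> * U j)) * adj (U j))"
      by (simp add: mult_assoc_dim)
    also have "\<dots> = mtrace (adj (U j) * (R * (mat_fun ln0 \<mu> * U j)))" by (rule mtrace_comm) auto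
    also have "mat_fun ln0 \<mu> * U j = U j * rdiag (m j) (ln0 \<circ> ev j)"
      by (rule mat_fun_intertwine[OF \<mu>_carrier _ _ \<mu>_mult_U[OF j]]) auto
    also have "adj (U j) * (R * (U j * rdiag (m j) (ln0 \<circ> ev j))) = adj (U j) * R * U j * rdiag (m j) (ln0 \<circ> ev j)"
      by (simp add: mult_assoc_dim)
    also have "mtrace \<dots> = (\<Sum>i<m j. (adj (U j) * R * U j) $$ (i,i) * ln0 (ev j i))"
      by (simp add: mtrace_def mult_rdiag_index del: index_mult_mat(1))
    finally show "mtrace (R * mat_fun ln0 \<mu> * (U j * adj (U j))) = (\<Sum>i<m j. (adj (U j) * R * U j) $$ (i,i) * ln0 (ev j i))" .
  qed
  finally show ?thesis by (simp add: x_def)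
qed

lemma x_nonneg: "j < k \<Longrightarrow> i < m j \<Longrightarrow> 0 \<le> x j i"
  unfolding x_def by (rule psd_diag_nonneg[OF R' U_carrier])

lemma Y_psd: assumes "j < k" shows "psd (m j) (Y j)"
proof -
  have "E j \<in> carrier_mat n (m j)" using E_dim[OF assms] by (auto intro!: carrier_matI)
  then show ?thesis using psd_sandwich[OF R', of "adj (E j)" "m j"] unfolding Y_def by simp
qed

lemma Y_carrier: "j < k \<Longrightarrow> Y j \<in> carrier_mat ((dX * l j) * (r j * dZ)) ((dX * l j) * (r j * dZ))"
  using psdD(1)[OF Y_psd] by (simp add: m_def)

lemma U_R_U: assumes j: "j < k" shows "adj (U j) * R * U j = kron (adj (S j)) (adj (T j)) * Y j * adj (kron (adj (S j)) (adj (T j)))"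
proof -
  note [simp] = E_dim[OF j] ST_dim[OF j] psdD(3,4)[OF R']
  have "adj (U j) * R * U j = adj (ST j) * Y j * ST j"
    by (simp add: U_def Y_def adj_mult mult_assoc_dim)
  then show ?thesis by (simp add: ST_def adj_kron)
qed

lemma mat_diag_sum:
  assumes "a < dX * l j" shows "ptrR (dX * l j) (r j * dZ) M $$ (a,a) = (\<Sum>b<r j * dZ. M $$ (a * (r j * dZ) + b, a * (r j * dZ) + b))"
  using assms by (simp add: ptrR_def)

text \<open>The unitary \<open>T j\<close> acts on the factor that is traced out and drops from the
  marginal, leaving a sum over its index \<open>b\<close>.\<close>

lemma xa_eq: assumes j: "j < k" and a: "a < dX * l j"
  shows "xa j a = (\<Sum>b<r j * dZ. x j (a * (r j * dZ) + b))"
proof -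
  note [simp] = unitaryD[OF S[OF j]] unitaryD[OF T[OF j]]
  note Yc = Y_carrier[OF j]
  have "ptrR (dX * l j) (r j * dZ) (adj (U j) * R * U j) = adj (S j) * ptrR (dX * l j) (r j * dZ) (Y j) * S j"
    unfolding U_R_U[OF j]
    by (subst ptrR_sandwich[OF Yc]) (use carrier_matD[OF Yc] in \<open>auto intro!: carrier_matI\<close>)
  then show ?thesis
    unfolding xa_def x_def using mat_diag_sum[OF a, of "adj (U j) * R * U j"] by (simp del: index_mult_mat(1))
qed

lemma xb_eq: assumes j: "j < k" and b: "b < r j * dZ"
  shows "xb j b = (\<Sum>a<dX * l j. x j (a * (r j * dZ) + b))"
proof -
  note [simp] = unitaryD[OF S[OF j]] unitaryD[OF T[OF j]]
  note Yc = Y_carrier[OF j]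
  have eq: "ptrL (dX * l j) (r j * dZ) (adj (U j) * R * U j) = adj (T j) * ptrL (dX * l j) (r j * dZ) (Y j) * T j"
    unfolding U_R_U[OF j]
    by (subst ptrL_sandwich[OF Yc]) (use carrier_matD[OF Yc] in \<open>auto intro!: carrier_matI\<close>)
  have "ptrL (dX * l j) (r j * dZ) M $$ (b,b) = (\<Sum>a<dX * l j. M $$ (a * (r j * dZ) + b, a * (r j * dZ) + b))" for M
    using b by (simp add: ptrL_def)
  then show ?thesis unfolding xb_def x_def eq[symmetric] by (simp del: index_mult_mat(1))
qed

lemma q_eq: assumes j: "j < k" shows "q j = (\<Sum>i<m j. x j i)"
proof -
  note [simp] = E_dim[OF j] ST_dim[OF j] psdD(3,4)[OF Y_psd[OF j]] psdD(3,4)[OF R']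
  have "mtrace (adj (U j) * R * U j) = mtrace (adj (ST j) * Y j * adj (adj (ST j)))"
    by (simp add: U_def Y_def adj_mult mult_assoc_dim)
  also have "\<dots> = mtrace (Y j)"
    by (rule mtrace_unitary_conj) (use unitaryD[OF ST_unitary[OF j]] in \<open>auto simp: unitary_m_def isometry_def intro!: carrier_matI\<close>)
  finally have "q j = Re (mtrace (adj (U j) * R * U j))" by (simp add: q_def)
  then show ?thesis using U_dim[OF j] by (simp add: x_def mtrace_def del: index_mult_mat(1))
qed

lemma q_sum_a: "j < k \<Longrightarrow> q j = (\<Sum>a<dX * l j. xa j a)"
  unfolding q_eq m_def sum_prod_nat[where m = "dX * l j" and n = "r j * dZ"] by (intro sum.cong refl) (simp add: xa_eq)

lemma q_sum_b: "j < k \<Longrightarrow> q j = (\<Sum>b<r j * dZ. xb j b)"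
  unfolding q_eq m_def sum_prod_nat[where m = "dX * l j" and n = "r j * dZ"] by (subst sum.swap) (intro sum.cong refl, simp add: xb_eq)

lemma q_nonneg: "j < k \<Longrightarrow> 0 \<le> q j"
  unfolding q_eq by (intro sum_nonneg) (auto intro: x_nonneg)

lemma q_sum: "(\<Sum>j<k. q j) = Re (mtrace R)"
proof -
  note Rc = psdD[OF R']
  have "mtrace R = mtrace (R * msum n k (\<lambda>j. U j * adj (U j)))"
    unfolding U_sum using Rc by simp
  also have "\<dots> = (\<Sum>j<k. mtrace (R * (U j * adj (U j))))"
    by (rule mtrace_mult_msum) (use Rc U_dim in \<open>auto intro!: carrier_matI\<close>)
  also have "\<dots> = (\<Sum>j<k. mtrace (adj (U j) * R * U j))"
  proof (intro sum.cong refl)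
    fix j assume "j \<in> {..<k}"
    then have [simp]: "dim_row (U j) = n" "dim_col (U j) = m j" using U_dim by auto
    have "mtrace (R * (U j * adj (U j))) = mtrace ((R * U j) * adj (U j))" using Rc by (simp add: mult_assoc_dim)
    also have "\<dots> = mtrace (adj (U j) * (R * U j))" by (rule mtrace_comm) (use Rc in auto)
    finally show "mtrace (R * (U j * adj (U j))) = mtrace (adj (U j) * R * U j)" using Rc by (simp add: mult_assoc_dim)
  qed
  also have "Re \<dots> = (\<Sum>j<k. q j)"
    unfolding Re_sum by (intro sum.cong refl) (simp add: q_eq x_def mtrace_def U_dim del: index_mult_mat(1))
  finally show ?thesis by simp
qed

lemma s_nonneg: assumes j: "j < k" and a: "a < dX * l j" shows "0 \<le> s j a"
proof -
  note u = unitaryD[OF S[OF j]]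
  have "adj (S j) * \<sigma> j * S j = rdiag (dX * l j) (s j)"
    unfolding \<sigma>[OF j] using u by (simp add: mult_assoc_dim mult_adj_cancel)
  moreover have "psd (dX * l j) (\<sigma> j)" using \<sigma>_density[OF j] by (simp add: density_def)
  ultimately show ?thesis
    using psd_diag_nonneg[OF _ carrier_matI[OF u(1,2)] a, of "\<sigma> j"] a by (simp add: rdiag_index)
qed

lemma t_nonneg: assumes j: "j < k" and b: "b < r j * dZ" shows "0 \<le> t j b"
proof -
  note u = unitaryD[OF T[OF j]]
  have "adj (T j) * \<tau> j * T j = rdiag (r j * dZ) (t j)"
    unfolding \<tau>[OF j] using u by (simp add: mult_assoc_dim mult_adj_cancel)
  moreover have "psd (r j * dZ) (\<tau> j)" using \<tau>_density[OF j] by (simp add: density_def)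
  ultimately show ?thesis
    using psd_diag_nonneg[OF _ carrier_matI[OF u(1,2)] b, of "\<tau> j"] b by (simp add: rdiag_index)
qed

lemma s_sum: assumes j: "j < k" shows "(\<Sum>a<dX * l j. s j a) = 1"
  using \<sigma>_density[OF j] mtrace_unitary_conj[OF S[OF j] rdiag_carrier, of "s j"]
  by (simp add: density_def \<sigma>[OF j, symmetric] mtrace_rdiag flip: of_real_sum)

lemma t_sum: assumes j: "j < k" shows "(\<Sum>b<r j * dZ. t j b) = 1"
  using \<tau>_density[OF j] mtrace_unitary_conj[OF T[OF j] rdiag_carrier, of "t j"]
  by (simp add: density_def \<tau>[OF j, symmetric] mtrace_rdiag flip: of_real_sum)

lemma ev_pair: "b < r j * dZ \<Longrightarrow> ev j (a * (r j * dZ) + b) = p j * (s j a * t j b)"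
  by (simp add: ev_def div_mod_pair)

text \<open>The logarithm of a product of \<open>p\<close>, \<open>s\<close> and \<open>t\<close>
  splits where all three are positive. At a zero eigenvalue it need not split, but there the support
  condition makes \<open>x\<close> vanish.\<close>

lemma mtrace_mlog_split:
  assumes supp: "\<And>j i. j < k \<Longrightarrow> i < m j \<Longrightarrow> ev j i = 0 \<Longrightarrow> x j i = 0"
  shows "Re (mtrace (R * mlog \<mu>)) =
    (\<Sum>j<k. q j * ln (p j) + (\<Sum>a<dX * l j. xa j a * ln (s j a)) + (\<Sum>b<r j * dZ. xb j b * ln (t j b)))"
  unfolding mtrace_mlog
proof (intro sum.cong refl)
  fix j assume "j \<in> {..<k}"
  then have j: "j < k" by simp
  let ?x = "\<lambda>a b. x j (a * (r j * dZ) + b)"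
  have "(\<Sum>i<m j. x j i * ln0 (ev j i)) = (\<Sum>a<dX * l j. \<Sum>b<r j * dZ. ?x a b * ln (p j) + ?x a b * ln (s j a) + ?x a b * ln (t j b))"
    unfolding m_def sum_prod_nat[where m = "dX * l j" and n = "r j * dZ"]
  proof (intro sum.cong refl)
    fix a b assume "a \<in> {..<dX * l j}" "b \<in> {..<r j * dZ}"
    then have ab: "a < dX * l j" "b < r j * dZ" by auto
    have i: "a * (r j * dZ) + b < m j" unfolding m_def by (rule pair_index_less[OF ab])
    show "?x a b * ln0 (ev j (a * (r j * dZ) + b)) = ?x a b * ln (p j) + ?x a b * ln (s j a) + ?x a b * ln (t j b)"
    proof (cases "ev j (a * (r j * dZ) + b) = 0")
      case True
      then show ?thesis using supp[OF j i] by simp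
    next
      case False
      then have "0 < p j" "0 < s j a" "0 < t j b"
        using p_nonneg[OF j] s_nonneg[OF j ab(1)] t_nonneg[OF j ab(2)] unfolding ev_pair[OF ab(2)] by (auto simp: less_le)
      then show ?thesis unfolding ev_pair[OF ab(2)] by (simp add: ln0_def ln_mult algebra_simps)
    qed
  qed
  also have "\<dots> = (\<Sum>a<dX * l j. xa j a * ln (p j) + xa j a * ln (s j a)) + (\<Sum>a<dX * l j. \<Sum>b<r j * dZ. ?x a b * ln (t j b))"
    unfolding sum.distrib[symmetric]
    by (intro sum.cong refl) (simp add: xa_eq[OF j] sum.distrib sum_distrib_right)
  also have "(\<Sum>a<dX * l j. \<Sum>b<r j * dZ. ?x a b * ln (t j b)) = (\<Sum>b<r j * dZ. xb j b * ln (t j b))"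
    by (subst sum.swap) (intro sum.cong refl, simp add: xb_eq[OF j] sum_distrib_right)
  also have "(\<Sum>a<dX * l j. xa j a * ln (p j) + xa j a * ln (s j a)) = q j * ln (p j) + (\<Sum>a<dX * l j. xa j a * ln (s j a))"
    by (simp add: sum.distrib q_sum_a[OF j] sum_distrib_right)
  finally show "(\<Sum>i<m j. x j i * ln0 (ev j i)) = q j * ln (p j) + (\<Sum>a<dX * l j. xa j a * ln (s j a)) + (\<Sum>b<r j * dZ. xb j b * ln (t j b))" .
qed

end

text \<open>\<open>VA\<close> and \<open>VC\<close> act on opposite sides of the cut, so they
  conjugate the marginals by isometries and leave the entropies alone. This removes the enlargement
  of the outer systems.\<close>

lemma local_isometry_marg:
  assumes \<rho>: "psd (a*d*c) \<rho>" and V: "V \<in> carrier_mat (l*r) d"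
    and VA: "isometry a a' VA" and VC: "isometry c c' VC"
    and Y: "Y = kron (kron VA V) VC * \<rho> * adj (kron (kron VA V) VC)"
  shows "eta (ptrR (a'*l) (r*c') Y) = eta (margL a c l r V \<rho>)"
    "eta (ptrL (a'*l) (r*c') Y) = eta (margR a c l r V \<rho>)"
    "mtrace Y = mtrace (block_out a c V \<rho>)"
proof -
  note [simp] = isometryD(1-3)[OF VA] isometryD(1-3)[OF VC] carrier_matD[OF V] psdD(3,4)[OF \<rho>]
  define S where "S = kron VA (1\<^sub>m l)"
  define T where "T = kron (1\<^sub>m r) VC"
  have S: "isometry (a*l) (a'*l) S" and T: "isometry (r*c) (r*c') T"
    by (auto simp: S_def T_def isometry_def adj_kron kron_mult intro!: carrier_matI)
  note [simp] = isometryD(1-3)[OF S] isometryD(1-3)[OF T]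
  let ?X = "block_out a c V \<rho>"
  note X = psd_block_out'[OF \<rho> V]
  have ST: "kron S T = kron (kron VA (1\<^sub>m (l*r))) VC"
    unfolding S_def T_def by (simp only: kron_assoc kron_one[symmetric])
  have "kron (kron VA V) VC = kron S T * extend a c V"
    unfolding ST extend_def by (simp add: kron_mult)
  then have Y': "Y = kron S T * ?X * adj (kron S T)"
    unfolding Y block_out_def by (simp add: adj_mult mult_assoc_dim mult.assoc)
  have X1: "?X * 1\<^sub>m (a*l*(r*c)) = ?X" using psdD[OF X] by simp
  have "ptrR (a'*l) (r*c') Y = S * margL a c l r V \<rho> * adj S"
    unfolding Y' ptrR_sandwich[OF psdD(1)[OF X] isometryD(4)[OF S] isometryD(4)[OF T]] by (simp add: X1 margL_def)
  then show "eta (ptrR (a'*l) (r*c') Y) = eta (margL a c l r V \<rho>)"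
    by (simp add: eta_isometry[OF psd_marg(1)[OF \<rho> V] S])
  have "ptrL (a'*l) (r*c') Y = T * margR a c l r V \<rho> * adj T"
    unfolding Y' ptrL_sandwich[OF psdD(1)[OF X] isometryD(4)[OF S] isometryD(4)[OF T]] by (simp add: X1 margR_def)
  then show "eta (ptrL (a'*l) (r*c') Y) = eta (margR a c l r V \<rho>)"
    by (simp add: eta_isometry[OF psd_marg(2)[OF \<rho> V] T])
  have "mtrace Y = mtrace (kron S T * (?X * adj (kron S T)))"
    unfolding Y' using psdD[OF X] by (simp add: mult_assoc_dim)
  also have "\<dots> = mtrace ((?X * adj (kron S T)) * kron S T)" by (rule mtrace_comm) (use psdD[OF X] in auto)
  also have "(?X * adj (kron S T)) * kron S T = ?X * 1\<^sub>m (a*l*(r*c))"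
    using psdD[OF X] by (simp add: mult_assoc_dim adj_kron kron_mult)
  finally show "mtrace Y = mtrace ?X" unfolding X1 .
qed

lemma isometry_kron:
  assumes "isometry a b V" "isometry c d W" shows "isometry (a*c) (b*d) (kron V W)"
  using isometryD[OF assms(1)] isometryD[OF assms(2)]
  by (auto simp: isometry_def adj_kron kron_mult intro!: carrier_matI)

lemma mtrace_isometry:
  assumes V: "isometry m n V" and X: "X \<in> carrier_mat m m" shows "mtrace (V * X * adj V) = mtrace X"
proof -
  note [simp] = isometryD(1-3)[OF V] carrier_matD[OF X]
  have "mtrace (V * X * adj V) = mtrace (V * (X * adj V))" by (simp add: mult_assoc_dim)
  also have "\<dots> = mtrace ((X * adj V) * V)" by (rule mtrace_comm) auto
  finally show ?thesis by (simp add: mult_assoc_dim)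
qed

section \<open>Support condition, Gibbs bound and the case of equality\<close>

context markov_diag
begin

text \<open>A column of \<open>U j\<close> with eigenvalue 0 lies in the kernel of
  \<open>\<mu>\<close>, hence in that of \<open>R\<close>.\<close>

lemma support_imp:
  assumes ker: "\<forall>v \<in> carrier_vec n. \<mu> *\<^sub>v v = 0\<^sub>v n \<longrightarrow> R *\<^sub>v v = 0\<^sub>v n"
    and j: "j < k" and i: "i < m j" and z: "ev j i = 0"
  shows "x j i = 0"
proof -
  note d = U_dim[OF j] carrier_matD[OF \<mu>_carrier(1)] psdD(3,4)[OF R']
  have v: "col (U j) i \<in> carrier_vec n" using d i by (metis col_dim)
  have "\<mu> *\<^sub>v col (U j) i = 0\<^sub>v n"
  proof (rule eq_vecI)
    fix y assume "y < dim_vec (0\<^sub>v n)"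
    then have y: "y < n" by simp
    have "(\<mu> *\<^sub>v col (U j) i) $ y = (\<mu> * U j) $$ (y,i)" using y i d by simp
    also have "\<dots> = 0" unfolding \<mu>_mult_U[OF j] using y i d z by (simp add: mult_rdiag_index del: index_mult_mat(1))
    finally show "(\<mu> *\<^sub>v col (U j) i) $ y = 0\<^sub>v n $ y" using y by simp
  qed (use d in simp)
  then have Rv: "R *\<^sub>v col (U j) i = 0\<^sub>v n" using ker v by blast
  have RU: "(R * U j) $$ (y,i) = 0" if "y < n" for y
  proof -
    have "(R * U j) $$ (y,i) = (R *\<^sub>v col (U j) i) $ y" using that i d by simp
    then show ?thesis unfolding Rv using that by simp
  qed
  have "(adj (U j) * R * U j) $$ (i,i) = (adj (U j) * (R * U j)) $$ (i,i)" using d by (simp add: mult_assoc_dim)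
  also have "\<dots> = 0" using d i RU by (simp add: index_mult_sum[of i "adj (U j)" i "R * U j"] del: index_mult_mat(1))
  finally show ?thesis by (simp add: x_def)
qed

text \<open>Expand \<open>v\<close> in the eigenbasis. Coefficients at nonzero eigenvalues vanish
  because \<open>\<mu>\<close> kills \<open>v\<close>; at zero eigenvalues the diagonal entry of the
  positive \<open>R\<close> vanishes, so \<open>R\<close> kills the basis vector.\<close>

lemma imp_support:
  assumes supp: "\<And>j i. j < k \<Longrightarrow> i < m j \<Longrightarrow> ev j i = 0 \<Longrightarrow> x j i = 0"
    and v: "v \<in> carrier_vec n" "\<mu> *\<^sub>v v = 0\<^sub>v n"
  shows "R *\<^sub>v v = 0\<^sub>v n"
proof -
  define V where "V = mat n 1 (\<lambda>(i,_). v $ i)"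
  have dV [simp]: "dim_row V = n" "dim_col V = 1" by (auto simp: V_def)
  note d [simp] = carrier_matD[OF \<mu>_carrier(1)] psdD(3,4)[OF R']
  have colV: "col V 0 = v" using v(1) by (intro eq_vecI) (auto simp: V_def)
  have \<mu>V: "\<mu> * V = 0\<^sub>m n 1"
  proof (rule eq_matI)
    fix i j assume "i < dim_row (0\<^sub>m n 1)" "j < dim_col (0\<^sub>m n 1)"
    then show "(\<mu> * V) $$ (i,j) = 0\<^sub>m n 1 $$ (i,j)"
      using arg_cong[OF v(2), of "\<lambda>u. u $ i"] colV by simp
  qed auto
  have zero: "R * (U j * (adj (U j) * V)) = 0\<^sub>m n 1" if j: "j < k" for j
  proof -
    note [simp] = U_dim[OF j]
    have "adj (U j) * \<mu> = rdiag (m j) (ev j) * adj (U j)"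
      using arg_cong[OF \<mu>_mult_U[OF j], of adj] by (simp add: adj_mult \<mu>_carrier(2))
    then have "rdiag (m j) (ev j) * (adj (U j) * V) = adj (U j) * \<mu> * V" by (simp add: mult_assoc_dim)
    also have "\<dots> = 0\<^sub>m (m j) 1" by (simp add: mult_assoc_dim \<mu>V)
    finally have ev0: "complex_of_real (ev j i) * (adj (U j) * V) $$ (i,0) = 0" if "i < m j" for i
      using that rdiag_mult_index[of i "m j" 0 "adj (U j) * V" "ev j"] by (simp del: index_mult_mat(1))
    have "R * (U j * (adj (U j) * V)) = (R * U j) * (adj (U j) * V)" by (simp add: mult_assoc_dim)
    also have "\<dots> = 0\<^sub>m n 1"
    proof (rule eq_matI)
      fix y z assume "y < dim_row (0\<^sub>m n 1)" "z < dim_col (0\<^sub>m n 1)"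
      then have y: "y < n" and z: "z = 0" by auto
      have h: "(R * U j) $$ (y,i) * (adj (U j) * V) $$ (i,0) = 0" if i: "i < m j" for i
      proof (cases "ev j i = 0")
        case True
        then have "(R * U j) $$ (y,i) = 0"
          using psd_zero_diag[OF R' U_carrier[OF j] i _ y] supp[OF j i] by (simp add: x_def del: index_mult_mat(1))
        then show ?thesis by simp
      next
        case False
        then show ?thesis using ev0[OF i] by simp
      qed
      have "(R * U j * (adj (U j) * V)) $$ (y,0) = (\<Sum>i<m j. (R * U j) $$ (y,i) * (adj (U j) * V) $$ (i,0))"
        using y by (simp add: index_mult_sum[of y "R * U j" 0 "adj (U j) * V"] del: index_mult_mat(1))
      also have "\<dots> = 0" by (rule sum.neutral) (use h in blast)
      finally show "(R * U j * (adj (U j) * V)) $$ (y,z) = 0\<^sub>m n 1 $$ (y,z)"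
        unfolding z using y by simp
    qed auto
    finally show ?thesis .
  qed
  have VU: "V = msum n k (\<lambda>j. U j * adj (U j)) * V" unfolding U_sum by simp
  have RV: "(R * V) $$ (y,0) = 0" if y: "y < n" for y
  proof -
    have "(R * V) $$ (y,0) = (\<Sum>z<n. R $$ (y,z) * V $$ (z,0))"
      using y by (simp add: index_mult_sum del: index_mult_mat(1))
    also have "\<dots> = (\<Sum>z<n. \<Sum>j<k. R $$ (y,z) * (U j * adj (U j) * V) $$ (z,0))"
    proof (intro sum.cong refl)
      fix z assume "z \<in> {..<n}"
      then have "V $$ (z,0) = (\<Sum>j<k. (U j * adj (U j) * V) $$ (z,0))"
        by (subst VU, subst msum_mult_index) (use U_dim in \<open>auto intro!: carrier_matI\<close>)
      then show "R $$ (y,z) * V $$ (z,0) = (\<Sum>j<k. R $$ (y,z) * (U j * adj (U j) * V) $$ (z,0))"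
        by (simp add: sum_distrib_left)
    qed
    also have "\<dots> = (\<Sum>j<k. \<Sum>z<n. R $$ (y,z) * (U j * adj (U j) * V) $$ (z,0))" by (rule sum.swap)
    also have "\<dots> = (\<Sum>j<k. 0)"
    proof (intro sum.cong refl)
      fix j assume "j \<in> {..<k}"
      then have j: "j < k" by simp
      note [simp] = U_dim[OF j]
      have "(\<Sum>z<n. R $$ (y,z) * (U j * adj (U j) * V) $$ (z,0)) = (R * (U j * adj (U j) * V)) $$ (y,0)"
        using y by (simp add: index_mult_sum[of y R 0 "U j * adj (U j) * V"] del: index_mult_mat(1))
      also have "R * (U j * adj (U j) * V) = 0\<^sub>m n 1" using zero[OF j] by (simp add: mult_assoc_dim)
      finally show "(\<Sum>z<n. R $$ (y,z) * (U j * adj (U j) * V) $$ (z,0)) = 0" using y by simp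
    qed
    finally show ?thesis by simp
  qed
  show ?thesis
  proof (rule eq_vecI)
    fix y assume "y < dim_vec (0\<^sub>v n)"
    then have y: "y < n" by simp
    then show "(R *\<^sub>v v) $ y = 0\<^sub>v n $ y" using RV[OF y] colV by simp
  qed simp
qed

text \<open>The sum of the block costs, taken on the enlarged systems with the compressions
  \<open>Y j\<close> of \<open>R\<close>.\<close>

definition D where "D = (\<Sum>j<k. eta (ptrR (dX * l j) (r j * dZ) (Y j)) + eta (ptrL (dX * l j) (r j * dZ) (Y j)) - xlnx (q j))"

lemma xa_nonneg: "j < k \<Longrightarrow> a < dX * l j \<Longrightarrow> 0 \<le> xa j a"
  unfolding xa_eq by (intro sum_nonneg x_nonneg) (auto simp: m_def pair_index_less)

lemma xb_nonneg: "j < k \<Longrightarrow> b < r j * dZ \<Longrightarrow> 0 \<le> xb j b"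
  unfolding xb_eq by (intro sum_nonneg x_nonneg) (auto simp: m_def pair_index_less)

text \<open>Gibbs is applied three times: to the block weights \<open>q\<close> against
  \<open>p\<close>, and in each block to the diagonals of the two marginals against \<open>s\<close>
  and \<open>t\<close>. Passing from \<open>eta\<close> to a diagonal goes in the same
  direction.\<close>

lemma mtrace_mlog_le:
  assumes supp: "\<And>j i. j < k \<Longrightarrow> i < m j \<Longrightarrow> ev j i = 0 \<Longrightarrow> x j i = 0" and tr: "mtrace R = 1"
  shows "D \<le> - Re (mtrace (R * mlog \<mu>))"
proof -
  have supp': "x j (a * (r j * dZ) + b) = 0"
    if "j < k" "a < dX * l j" "b < r j * dZ" "p j = 0 \<or> s j a = 0 \<or> t j b = 0" for j a b
    using supp[OF that(1), of "a * (r j * dZ) + b"] that ev_pair[OF that(3)] pair_index_less[OF that(2,3)]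
    by (auto simp: m_def)
  have A: "eta (ptrR (dX * l j) (r j * dZ) (Y j)) - xlnx (q j) \<le> - (\<Sum>a<dX * l j. xa j a * ln (s j a))"
    if j: "j < k" for j
  proof -
    have "eta (ptrR (dX * l j) (r j * dZ) (Y j)) \<le> (\<Sum>a<dX * l j. xlnx (xa j a))"
      unfolding xa_def by (rule eta_le_diag[OF psd_ptrR S[OF j]]) (use Y_psd[OF j] in \<open>simp add: m_def\<close>)
    moreover have "(\<Sum>a<dX * l j. xlnx (xa j a)) - xlnx (\<Sum>a<dX * l j. xa j a) \<le> - (\<Sum>a<dX * l j. xa j a * ln (s j a))"
    proof (rule gibbs)
      show "xa j a = 0" if "a \<in> {..<dX * l j}" "s j a = 0" for a
        using that j supp' by (auto simp: xa_eq intro!: sum.neutral)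
    qed (use j s_sum in \<open>auto intro: xa_nonneg s_nonneg\<close>)
    ultimately show ?thesis unfolding q_sum_a[OF j] by linarith
  qed
  have B: "eta (ptrL (dX * l j) (r j * dZ) (Y j)) - xlnx (q j) \<le> - (\<Sum>b<r j * dZ. xb j b * ln (t j b))"
    if j: "j < k" for j
  proof -
    have "eta (ptrL (dX * l j) (r j * dZ) (Y j)) \<le> (\<Sum>b<r j * dZ. xlnx (xb j b))"
      unfolding xb_def by (rule eta_le_diag[OF psd_ptrL T[OF j]]) (use Y_psd[OF j] in \<open>simp add: m_def\<close>)
    moreover have "(\<Sum>b<r j * dZ. xlnx (xb j b)) - xlnx (\<Sum>b<r j * dZ. xb j b) \<le> - (\<Sum>b<r j * dZ. xb j b * ln (t j b))"
    proof (rule gibbs)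
      show "xb j b = 0" if "b \<in> {..<r j * dZ}" "t j b = 0" for b
        using that j supp' by (auto simp: xb_eq intro!: sum.neutral)
    qed (use j t_sum in \<open>auto intro: xb_nonneg t_nonneg\<close>)
    ultimately show ?thesis unfolding q_sum_b[OF j] by linarith
  qed
  have "(\<Sum>j<k. xlnx (q j)) - xlnx (\<Sum>j<k. q j) \<le> - (\<Sum>j<k. q j * ln (p j))"
  proof (rule gibbs)
    show "q j = 0" if "j \<in> {..<k}" "p j = 0" for j
    proof -
      have j: "j < k" using that by simp
      have "xa j a = 0" if "a < dX * l j" for a
        using that j \<open>p j = 0\<close> supp' by (auto simp: xa_eq intro!: sum.neutral)
      then show ?thesis unfolding q_sum_a[OF j] by simp
    qed
  qed (use p_sum in \<open>auto intro: q_nonneg p_nonneg\<close>)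
  then have C: "(\<Sum>j<k. xlnx (q j)) \<le> - (\<Sum>j<k. q j * ln (p j))"
    unfolding q_sum tr by (simp add: xlnx_def)
  \<comment> \<open>Each use of Gibbs inside a block needs its own \<open>xlnx (q j)\<close>
    subtracted; the copy in excess of the one in \<open>D\<close> is compensated by the entropy of
    the block weights.\<close>
  have "D = (\<Sum>j<k. xlnx (q j)) + (\<Sum>j<k. (eta (ptrR (dX * l j) (r j * dZ) (Y j)) - xlnx (q j)) + (eta (ptrL (dX * l j) (r j * dZ) (Y j)) - xlnx (q j)))"
    unfolding D_def sum.distrib[symmetric] by (intro sum.cong) auto
  also have "\<dots> \<le> - (\<Sum>j<k. q j * ln (p j)) + (\<Sum>j<k. - (\<Sum>a<dX * l j. xa j a * ln (s j a)) + - (\<Sum>b<r j * dZ. xb j b * ln (t j b)))"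
    by (intro add_mono C sum_mono A B) auto
  also have "\<dots> = - Re (mtrace (R * mlog \<mu>))"
    by (subst mtrace_mlog_split, rule supp) (auto simp: sum.distrib sum_negf sum_subtractf)
  finally show ?thesis .
qed

lemma rel_entropy_eq:
  "rel_entropy R \<mu> = (if (\<forall>v \<in> carrier_vec n. \<mu> *\<^sub>v v = 0\<^sub>v n \<longrightarrow> R *\<^sub>v v = 0\<^sub>v n)
     then ereal (- eta R - Re (mtrace (R * mlog \<mu>))) else \<infinity>)"
proof -
  note d = psdD[OF R']
  have "mlog M \<in> carrier_mat n n" if "M \<in> carrier_mat n n" "adj M = M" for M
    unfolding mlog_ln0 by (rule mat_fun_carrier[OF that])
  then have L: "mlog R \<in> carrier_mat n n" "mlog \<mu> \<in> carrier_mat n n" using d \<mu>_carrier by auto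
  have "R * (mlog R - mlog \<mu>) = R * mlog R - R * mlog \<mu>"
    by (rule mult_minus_distrib_mat[OF d(1) L])
  then have "mtrace (R * (mlog R - mlog \<mu>)) = mtrace (R * mlog R) - mtrace (R * mlog \<mu>)"
    using mtrace_minus[of "R * mlog R" n "R * mlog \<mu>"] d(1) L by (metis mult_carrier_mat)
  then show ?thesis using d(3) by (simp add: rel_entropy_def mtrace_mult_mlog_self[OF R'])
qed

lemma rel_entropy_ge:
  assumes "mtrace R = 1" shows "ereal (- eta R + D) \<le> rel_entropy R \<mu>"
proof (cases "\<forall>v \<in> carrier_vec n. \<mu> *\<^sub>v v = 0\<^sub>v n \<longrightarrow> R *\<^sub>v v = 0\<^sub>v n")
  case True
  have "D \<le> - Re (mtrace (R * mlog \<mu>))"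
    by (rule mtrace_mlog_le[OF _ assms]) (rule support_imp[OF True])
  then show ?thesis unfolding rel_entropy_eq if_P[OF True] by simp
next
  case False
  show ?thesis unfolding rel_entropy_eq if_not_P[OF False] by simp
qed

text \<open>Equality in all three uses of Gibbs: the weights are \<open>q\<close>, and the marginals
  are \<open>q\<close> times the factor states. The bases diagonalise the marginals, so nothing is
  lost on the diagonals either.\<close>

lemma rel_entropy_eq_D:
  assumes pq: "\<And>j. j < k \<Longrightarrow> p j = q j"
    and YS: "\<And>j. j < k \<Longrightarrow> ptrR (dX * l j) (r j * dZ) (Y j) = S j * rdiag (dX * l j) (\<lambda>a. q j * s j a) * adj (S j)"
    and YT: "\<And>j. j < k \<Longrightarrow> ptrL (dX * l j) (r j * dZ) (Y j) = T j * rdiag (r j * dZ) (\<lambda>b. q j * t j b) * adj (T j)"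
  shows "rel_entropy R \<mu> = ereal (- eta R + D)"
proof -
  have xa: "xa j a = q j * s j a" if j: "j < k" and a: "a < dX * l j" for j a
  proof -
    have "adj (S j) * ptrR (dX * l j) (r j * dZ) (Y j) * S j = rdiag (dX * l j) (\<lambda>a. q j * s j a)"
      unfolding YS[OF j] using unitaryD[OF S[OF j]] by (simp add: mult_assoc_dim mult_adj_cancel)
    then show ?thesis using a by (simp add: xa_def rdiag_index)
  qed
  have xb: "xb j b = q j * t j b" if j: "j < k" and b: "b < r j * dZ" for j b
  proof -
    have "adj (T j) * ptrL (dX * l j) (r j * dZ) (Y j) * T j = rdiag (r j * dZ) (\<lambda>b. q j * t j b)"
      unfolding YT[OF j] using unitaryD[OF T[OF j]] by (simp add: mult_assoc_dim mult_adj_cancel)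
    then show ?thesis using b by (simp add: xb_def rdiag_index)
  qed
  have supp: "x j i = 0" if j: "j < k" and i: "i < m j" and z: "ev j i = 0" for j i
  proof -
    define a b where "a = i div (r j * dZ)" and "b = i mod (r j * dZ)"
    have ab: "a < dX * l j" "b < r j * dZ"
      unfolding a_def b_def by (rule less_mult_div_mod[OF i[unfolded m_def]])+
    have abi: "i = a * (r j * dZ) + b" by (simp only: a_def b_def div_mult_mod_eq)
    \<comment> \<open>\<open>ev\<close> vanishes only if \<open>q\<close>, \<open>s\<close> or
      \<open>t\<close> does; then a marginal of the nonnegative \<open>x\<close> vanishes, and so
      does every summand of it.\<close>
    have "xa j a = 0 \<or> xb j b = 0"
      using z pq[OF j] unfolding xa[OF j ab(1)] xb[OF j ab(2)] abi ev_pair[OF ab(2)] by auto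
    then show ?thesis
    proof
      assume "xa j a = 0"
      then have "\<forall>b'\<in>{..<r j * dZ}. x j (a * (r j * dZ) + b') = 0"
        unfolding xa_eq[OF j ab(1)]
        by (subst (asm) sum_nonneg_eq_0_iff) (auto intro!: x_nonneg[OF j] simp: m_def pair_index_less ab(1))
      then show ?thesis using ab unfolding abi by simp
    next
      assume "xb j b = 0"
      then have "\<forall>a'\<in>{..<dX * l j}. x j (a' * (r j * dZ) + b) = 0"
        unfolding xb_eq[OF j ab(2)]
        by (subst (asm) sum_nonneg_eq_0_iff) (auto intro!: x_nonneg[OF j] simp: m_def pair_index_less ab(2))
      then show ?thesis using ab unfolding abi by simp
    qed
  qed
  have etaS: "eta (ptrR (dX * l j) (r j * dZ) (Y j)) = xlnx (q j) - (\<Sum>a<dX * l j. xa j a * ln (s j a))" if j: "j < k" for j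
  proof -
    have "eta (ptrR (dX * l j) (r j * dZ) (Y j)) = (\<Sum>a<dX * l j. q j * xlnx (s j a) + s j a * xlnx (q j))"
      unfolding YS[OF j] eta_diag[OF S[OF j]] by (intro sum.cong) (auto simp: xlnx_mult q_nonneg j s_nonneg)
    also have "\<dots> = (\<Sum>a<dX * l j. q j * xlnx (s j a)) + xlnx (q j)"
      by (simp add: sum.distrib s_sum[OF j] flip: sum_distrib_right)
    also have "(\<Sum>a<dX * l j. q j * xlnx (s j a)) = - (\<Sum>a<dX * l j. xa j a * ln (s j a))"
      unfolding sum_negf[symmetric] by (intro sum.cong) (auto simp: xa[OF j] xlnx_def)
    finally show ?thesis by simp
  qed
  have etaT: "eta (ptrL (dX * l j) (r j * dZ) (Y j)) = xlnx (q j) - (\<Sum>b<r j * dZ. xb j b * ln (t j b))" if j: "j < k" for j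
  proof -
    have "eta (ptrL (dX * l j) (r j * dZ) (Y j)) = (\<Sum>b<r j * dZ. q j * xlnx (t j b) + t j b * xlnx (q j))"
      unfolding YT[OF j] eta_diag[OF T[OF j]] by (intro sum.cong) (auto simp: xlnx_mult q_nonneg j t_nonneg)
    also have "\<dots> = (\<Sum>b<r j * dZ. q j * xlnx (t j b)) + xlnx (q j)"
      by (simp add: sum.distrib t_sum[OF j] flip: sum_distrib_right)
    also have "(\<Sum>b<r j * dZ. q j * xlnx (t j b)) = - (\<Sum>b<r j * dZ. xb j b * ln (t j b))"
      unfolding sum_negf[symmetric] by (intro sum.cong) (auto simp: xb[OF j] xlnx_def)
    finally show ?thesis by simp
  qed
  have "D = (\<Sum>j<k. - (q j * ln (p j) + (\<Sum>a<dX * l j. xa j a * ln (s j a)) + (\<Sum>b<r j * dZ. xb j b * ln (t j b))))"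
    unfolding D_def by (intro sum.cong) (auto simp: etaS etaT pq xlnx_def)
  also have "\<dots> = - Re (mtrace (R * mlog \<mu>))"
    by (subst mtrace_mlog_split, rule supp) (auto simp: sum.distrib sum_negf sum_subtractf)
  finally have eq: "D = - Re (mtrace (R * mlog \<mu>))" .
  have "\<forall>v \<in> carrier_vec n. \<mu> *\<^sub>v v = 0\<^sub>v n \<longrightarrow> R *\<^sub>v v = 0\<^sub>v n"
    by (intro ballI impI imp_support) (use supp in blast)+
  then show ?thesis unfolding rel_entropy_eq eq by simp
qed

end

text \<open>Normalisation must survive trace 0: then \<open>M\<close> is 0 and any distribution
  serves, here the point mass at index 0, which exists because \<open>0 < n\<close>.\<close>

lemma normalized_spectral:
  assumes M: "psd n M" and n: "0 < n"
  obtains U d where "unitary_m n U" "\<And>i. i < n \<Longrightarrow> 0 \<le> d i" "(\<Sum>i<n. d i) = 1"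
    "M = U * rdiag n (\<lambda>i. Re (mtrace M) * d i) * adj U"
proof -
  obtain U e where U: "unitary_m n U" and Me: "M = U * rdiag n e * adj U" and e: "\<And>i. i < n \<Longrightarrow> 0 \<le> e i"
    by (rule psd_spectral[OF M], rule that)
  define q where "q = Re (mtrace M)"
  have q: "q = (\<Sum>i<n. e i)"
    unfolding q_def Me mtrace_unitary_conj[OF U rdiag_carrier] mtrace_rdiag by simp
  show thesis
  proof (cases "q = 0")
    case True
    then have "\<forall>i\<in>{..<n}. e i = 0" unfolding q by (subst (asm) sum_nonneg_eq_0_iff) (auto intro: e)
    then have "rdiag n e = rdiag n (\<lambda>i. q * (if i = 0 then 1 else 0))"
      using True by (intro eq_matI) (auto simp: rdiag_index)
    then have "M = U * rdiag n (\<lambda>i. q * (if i = 0 then 1 else 0)) * adj U" unfolding Me by simp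
    then show ?thesis
      by (intro that[of U "\<lambda>i. if i = 0 then 1 else 0"]) (use U n in \<open>auto simp: q_def\<close>)
  next
    case False
    then have qp: "0 < q" using e unfolding q by (metis lessThan_iff less_le sum_nonneg)
    have "rdiag n e = rdiag n (\<lambda>i. q * (e i / q))" using False by simp
    then have eq: "M = U * rdiag n (\<lambda>i. q * (e i / q)) * adj U" unfolding Me by simp
    show ?thesis
    proof (rule that[OF U])
      show "M = U * rdiag n (\<lambda>i. Re (mtrace M) * (e i / q)) * adj U" using eq unfolding q_def[symmetric] .
      show "(\<Sum>i<n. e i / q) = 1" using qp unfolding sum_divide_distrib[symmetric] q[symmetric] by simp
      show "0 \<le> e i / q" if "i < n" for i using e[OF that] qp by simp
    qed
  qed
qed

lemma density_diag:
  assumes U: "unitary_m n U" and d: "\<And>i. i < n \<Longrightarrow> 0 \<le> d i" "(\<Sum>i<n. d i) = 1"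
  shows "density n (U * rdiag n d * adj U)"
proof -
  note [simp] = unitaryD[OF U]
  have "rdiag n d = rdiag n (\<lambda>i. sqrt (d i)) * adj (rdiag n (\<lambda>i. sqrt (d i)))"
    unfolding adj_rdiag rdiag_mult_rdiag by (rule eq_matI) (auto simp: rdiag_index d(1) simp flip: of_real_mult)
  then have "psd n (rdiag n d)" using psd_gram[OF rdiag_carrier, of n "\<lambda>i. sqrt (d i)"] by simp
  then have "psd n (U * rdiag n d * adj U)" by (rule psd_sandwich) (auto intro!: carrier_matI)
  then show ?thesis
    unfolding density_def mtrace_unitary_conj[OF U rdiag_carrier] mtrace_rdiag d(2) by simp
qed

section \<open>Attainment and continuity of the infimum\<close>

lemma densityD: "density n \<rho> \<Longrightarrow> psd n \<rho>" "density n \<rho> \<Longrightarrow> mtrace \<rho> = 1"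
  by (auto simp: density_def)

lemma density_dim_pos: assumes "density n \<rho>" shows "0 < n"
proof (rule ccontr)
  assume "\<not> 0 < n"
  then have "mtrace \<rho> = 0" using psdD(3)[OF densityD(1)[OF assms]] by (simp add: mtrace_def)
  then show False using densityD(2)[OF assms] by simp
qed

lemma density_spectral_family:
  assumes "\<forall>j<k. density (n j) (\<sigma> j)"
  obtains S s where "\<And>j. j < k \<Longrightarrow> unitary_m (n j) (S j)"
    "\<And>j. j < k \<Longrightarrow> \<sigma> j = S j * rdiag (n j) (s j) * adj (S j)"
proof -
  have "\<forall>j. \<exists>U d. j < k \<longrightarrow> unitary_m (n j) U \<and> \<sigma> j = U * rdiag (n j) d * adj U"
  proof
    fix j
    show "\<exists>U d. j < k \<longrightarrow> unitary_m (n j) U \<and> \<sigma> j = U * rdiag (n j) d * adj U"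
    proof (cases "j < k")
      case True
      obtain U d where "unitary_m (n j) U" "\<sigma> j = U * rdiag (n j) d * adj U"
        by (rule psd_spectral[OF densityD(1)], use assms True in blast, rule that)
      then show ?thesis by blast
    qed simp
  qed
  then have "\<exists>S s. \<forall>j. j < k \<longrightarrow> unitary_m (n j) (S j) \<and> \<sigma> j = S j * rdiag (n j) (s j) * adj (S j)"
    by (simp only: choice_iff)
  then show thesis using that by blast
qed

lemma embed3_state:
  assumes \<rho>: "density (dA * dB * dC) \<rho>" and V: "isometry dA dX VA" "isometry dB dY VB" "isometry dC dZ VC"
  shows "psd (dX * dY * dZ) (embed3 VA VB VC \<rho>)" "mtrace (embed3 VA VB VC \<rho>) = 1" "eta (embed3 VA VB VC \<rho>) = eta \<rho>"
proof -
  note K = isometry_kron[OF isometry_kron[OF V(1,2)] V(3)]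
  note p = densityD[OF \<rho>]
  show "psd (dX * dY * dZ) (embed3 VA VB VC \<rho>)"
    unfolding embed3_def Let_def by (rule psd_sandwich[OF p(1) isometryD(4)[OF K]])
  show "mtrace (embed3 VA VB VC \<rho>) = 1"
    unfolding embed3_def Let_def mtrace_isometry[OF K psdD(1)[OF p(1)]] by (rule p(2))
  show "eta (embed3 VA VB VC \<rho>) = eta \<rho>"
    unfolding embed3_def Let_def by (rule eta_isometry[OF p(1) K])
qed

text \<open>The completeness of the \<open>W j\<close> is sandwiched between \<open>adj VB\<close>
  and \<open>VB\<close>, and \<open>VB\<close> is an isometry, so the compressed operators are again
  a measurement.\<close>

lemma compressed_resolution:
  assumes VB: "isometry dB dY VB" and W: "\<And>j. j < k \<Longrightarrow> W j \<in> carrier_mat dY (w j)"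
    and sum: "msum dY k (\<lambda>j. W j * adj (W j)) = 1\<^sub>m dY" and xy: "x < dB" "y < dB"
  shows "(\<Sum>j<k. (adj (adj (W j) * VB) * (adj (W j) * VB)) $$ (x,y)) = (if x = y then 1 else 0)"
proof -
  note [simp] = isometryD(1-3)[OF VB]
  have WW: "W j * adj (W j) \<in> carrier_mat dY dY" if "j < k" for j
    using carrier_matD[OF W[OF that]] by (auto intro!: carrier_matI)
  have "(\<Sum>j<k. (adj (adj (W j) * VB) * (adj (W j) * VB)) $$ (x,y)) =
      (\<Sum>j<k. \<Sum>z<dY. adj VB $$ (x,z) * (W j * adj (W j) * VB) $$ (z,y))"
  proof (intro sum.cong refl)
    fix j assume "j \<in> {..<k}"
    then have [simp]: "dim_row (W j) = dY" "dim_col (W j) = w j" using W by auto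
    have "adj (adj (W j) * VB) * (adj (W j) * VB) = adj VB * (W j * adj (W j) * VB)"
      by (simp add: adj_mult mult_assoc_dim)
    then show "(adj (adj (W j) * VB) * (adj (W j) * VB)) $$ (x,y) =
        (\<Sum>z<dY. adj VB $$ (x,z) * (W j * adj (W j) * VB) $$ (z,y))"
      using xy by (simp add: index_mult_sum[of x "adj VB" y "W j * adj (W j) * VB"] del: index_mult_mat(1))
  qed
  also have "\<dots> = (\<Sum>z<dY. \<Sum>j<k. adj VB $$ (x,z) * (W j * adj (W j) * VB) $$ (z,y))" by (rule sum.swap)
  also have "\<dots> = (\<Sum>z<dY. adj VB $$ (x,z) * VB $$ (z,y))"
  proof (intro sum.cong refl)
    fix z assume "z \<in> {..<dY}"
    then have z: "z < dY" by simp
    have "VB $$ (z,y) = (msum dY k (\<lambda>j. W j * adj (W j)) * VB) $$ (z,y)" unfolding sum by simp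
    also have "\<dots> = (\<Sum>j<k. (W j * adj (W j) * VB) $$ (z,y))"
      by (rule msum_mult_index[OF _ WW]) (use z xy in auto)
    finally show "(\<Sum>j<k. adj VB $$ (x,z) * (W j * adj (W j) * VB) $$ (z,y)) = adj VB $$ (x,z) * VB $$ (z,y)"
      by (simp add: sum_distrib_left)
  qed
  also have "\<dots> = (adj VB * VB) $$ (x,y)" using xy by (subst index_mult_sum) auto
  also have "\<dots> = (if x = y then 1 else 0)" using xy by simp
  finally show ?thesis .
qed

text \<open>For an arbitrary competitor, Gibbs gives the bound by \<open>D\<close>, local isometries
  turn \<open>D\<close> into costs on the original systems, and the reductions reach the feasible
  shape without raising the cost.\<close>

lemma rel_entropy_lower_bound:
  assumes \<rho>: "density (dA * dB * dC) \<rho>" and V: "isometry dA dX VA" "isometry dB dY VB" "isometry dC dZ VC"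
    and \<mu>: "markov_state dX dY dZ \<mu>"
  shows "ereal (- eta \<rho> + min_cost dA dC dB \<rho>) \<le> rel_entropy (embed3 VA VB VC \<rho>) \<mu>"
proof -
  obtain k l r W p \<sigma> \<tau> where md: "markov_decomp dX dY dZ k l r W p \<sigma> \<tau> \<mu>"
    using \<mu> by (auto simp: markov_state_def)
  have dens: "\<forall>j<k. density (dX * l j) (\<sigma> j)" "\<forall>j<k. density (r j * dZ) (\<tau> j)"
    using md by (auto simp: markov_decomp_def)
  obtain S s where S: "\<And>j. j < k \<Longrightarrow> unitary_m (dX * l j) (S j)"
    "\<And>j. j < k \<Longrightarrow> \<sigma> j = S j * rdiag (dX * l j) (s j) * adj (S j)"
    by (rule density_spectral_family[OF dens(1)], rule that)
  obtain T t where T: "\<And>j. j < k \<Longrightarrow> unitary_m (r j * dZ) (T j)"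
    "\<And>j. j < k \<Longrightarrow> \<tau> j = T j * rdiag (r j * dZ) (t j) * adj (T j)"
    by (rule density_spectral_family[OF dens(2)], rule that)
  note R = embed3_state[OF \<rho> V]
  interpret M: markov_diag dX dY dZ k l r W p \<sigma> \<tau> \<mu> S T s t "embed3 VA VB VC \<rho>"
    by unfold_locales (use md S T R(1) in auto)
  note p = densityD(1)[OF \<rho>]
  have dB: "0 < dB" using density_dim_pos[OF \<rho>] by (auto intro: gr0I)
  define B where "B j = adj (W j) * VB" for j
  have Wd: "dim_row (W j) = dY" "dim_col (W j) = l j * r j" if "j < k" for j
    using isometryD(1,2)[OF M.W_isometry[OF that]] by auto
  have B: "B j \<in> carrier_mat (l j * r j) dB" if "j < k" for j
    using Wd[OF that] isometryD(1,2)[OF V(2)] by (auto simp: B_def intro!: carrier_matI)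
  have Y: "M.Y j = kron (kron VA (B j)) VC * \<rho> * adj (kron (kron VA (B j)) VC)" if j: "j < k" for j
  proof -
    note [simp] = isometryD(1,2)[OF V(1)] isometryD(1,2)[OF V(2)] isometryD(1,2)[OF V(3)] Wd[OF j] psdD(3,4)[OF p]
    \<comment> \<open>The block isometry acts only on the middle system, so its adjoint merges with
      \<open>VB\<close> into \<open>B j\<close> and leaves \<open>VA\<close> and \<open>VC\<close>
      untouched.\<close>
    have "kron (kron VA (B j)) VC = adj (M.E j) * kron (kron VA VB) VC"
      by (simp add: B_def M.E_def extend_def adj_kron kron_mult)
    then show ?thesis
      unfolding M.Y_def unfolding embed3_def Let_def using M.E_dim[OF j] by (simp add: M.n_def adj_mult mult_assoc_dim)
  qed
  have "M.D = (\<Sum>j<k. cost dA dC (l j) (r j) (B j) \<rho>)"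
    unfolding M.D_def
  proof (intro sum.cong refl)
    fix j assume "j \<in> {..<k}"
    then have j: "j < k" by simp
    show "eta (ptrR (dX * l j) (r j * dZ) (M.Y j)) + eta (ptrL (dX * l j) (r j * dZ) (M.Y j)) - xlnx (M.q j)
      = cost dA dC (l j) (r j) (B j) \<rho>"
      using local_isometry_marg[OF p B[OF j] V(1,3) Y[OF j]] by (simp add: M.q_def cost_def)
  qed
  moreover obtain V' where "feasible dB V'" "total_cost dA dC dB V' \<rho> \<le> (\<Sum>j<k. cost dA dC (l j) (r j) (B j) \<rho>)"
  proof (rule feasible_below[OF p dB, of k B l r])
    show "(\<Sum>j<k. (adj (B j) * B j) $$ (x,y)) = (if x = y then 1 else 0)" if "x < dB" "y < dB" for x y
      unfolding B_def
      by (rule compressed_resolution[OF V(2) isometryD(4)[OF M.W_isometry] M.W_sum that])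
  qed (use B that in auto)
  moreover have "min_cost dA dC dB \<rho> \<le> total_cost dA dC dB V' \<rho>" if "feasible dB V'" for V'
    using min_cost_attained[OF p dB] that by blast
  ultimately have "min_cost dA dC dB \<rho> \<le> M.D" by fastforce
  then have "ereal (- eta \<rho> + min_cost dA dC dB \<rho>) \<le> ereal (- eta (embed3 VA VB VC \<rho>) + M.D)"
    by (simp add: R(3))
  also have "\<dots> \<le> rel_entropy (embed3 VA VB VC \<rho>) \<mu>" by (rule M.rel_entropy_ge[OF R(2)])
  finally show ?thesis .
qed

section \<open>Building a Markov state from a measurement\<close>

definition block_embed :: "nat \<Rightarrow> nat \<Rightarrow> nat \<Rightarrow> complex mat" where
  "block_embed k D j = mat (k * D) D (\<lambda>(i,m). if i = j * D + m then 1 else 0)"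

lemma block_embed_dim [simp]: "dim_row (block_embed k D j) = k * D" "dim_col (block_embed k D j) = D"
  by (auto simp: block_embed_def)

lemma adj_block_embed_mult:
  assumes M: "dim_row M = k * D" and j: "j < k" and m: "m < D" "y < dim_col M"
  shows "(adj (block_embed k D j) * M) $$ (m,y) = M $$ (j * D + m, y)"
proof -
  have jm: "j * D + m < k * D" by (rule pair_index_less[OF j m(1)])
  have "(adj (block_embed k D j) * M) $$ (m,y) = (\<Sum>i<k*D. cnj (if i = j * D + m then 1 else 0) * M $$ (i,y))"
    using M m by (subst index_mult_sum) (auto simp: block_embed_def intro!: sum.cong)
  also have "\<dots> = (\<Sum>i<k*D. if i = j * D + m then M $$ (i,y) else 0)"
    by (intro sum.cong) auto
  also have "\<dots> = M $$ (j * D + m, y)" using jm by simp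
  finally show ?thesis .
qed

lemma block_embed_gram:
  assumes "i < k" "j < k"
  shows "adj (block_embed k D i) * block_embed k D j = (if i = j then 1\<^sub>m D else 0\<^sub>m D D)"
proof (rule eq_matI)
  fix x y assume "x < dim_row (if i = j then 1\<^sub>m D else 0\<^sub>m D D)" "y < dim_col (if i = j then 1\<^sub>m D else 0\<^sub>m D D)"
  then have xy: "x < D" "y < D" by (auto split: if_splits)
  have "(i * D + x = j * D + y) = (i = j \<and> x = y)"
    using div_mod_pair[OF xy(1), of i] div_mod_pair[OF xy(2), of j] by metis
  then show "(adj (block_embed k D i) * block_embed k D j) $$ (x,y) = (if i = j then 1\<^sub>m D else 0\<^sub>m D D) $$ (x,y)"
    using xy pair_index_less[OF assms(1) xy(1)]
    by (subst adj_block_embed_mult[OF _ assms(1)]) (auto simp: block_embed_def)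
qed (auto split: if_splits)

lemma block_embed_sum: "msum (k*D) k (\<lambda>j. block_embed k D j * adj (block_embed k D j)) = 1\<^sub>m (k*D)"
proof (rule eq_matI)
  fix x y assume "x < dim_row (1\<^sub>m (k*D))" "y < dim_col (1\<^sub>m (k*D))"
  then have xy: "x < k*D" "y < k*D" by auto
  have "msum (k*D) k (\<lambda>j. block_embed k D j * adj (block_embed k D j)) $$ (x,y) =
      (\<Sum>j<k. \<Sum>m<D. if j * D + m = x then (if x = y then 1 else 0) else 0)"
    unfolding msum_index[OF xy]
  proof (intro sum.cong refl)
    fix j
    have "(block_embed k D j * adj (block_embed k D j)) $$ (x,y) =
        (\<Sum>m<D. (if x = j * D + m then 1 else 0) * cnj (if y = j * D + m then 1 else 0))"
      using xy by (subst index_mult_sum) (auto simp: block_embed_def intro!: sum.cong)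
    also have "\<dots> = (\<Sum>m<D. if j * D + m = x then (if x = y then 1 else 0) else 0)"
      by (intro sum.cong) auto
    finally show "(block_embed k D j * adj (block_embed k D j)) $$ (x,y) = \<dots>" .
  qed
  also have "\<dots> = (\<Sum>z<k*D. if z = x then (if x = y then 1 else 0) else 0)"
    by (rule sum_prod_nat[symmetric])
  also have "\<dots> = 1\<^sub>m (k*D) $$ (x,y)" using xy by simp
  finally show "msum (k*D) k (\<lambda>j. block_embed k D j * adj (block_embed k D j)) $$ (x,y) = 1\<^sub>m (k*D) $$ (x,y)" .
qed auto

text \<open>Naimark dilation: the operators stacked on top of each other form one operator into the
  direct sum, from which \<open>block_embed\<close> recovers them.\<close>

definition stack :: "nat \<Rightarrow> nat \<Rightarrow> nat \<Rightarrow> (nat \<Rightarrow> complex mat) \<Rightarrow> complex mat" where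
  "stack k D d V = mat (k * D) d (\<lambda>(i,y). V (i div D) $$ (i mod D, y))"

lemma stack_dim [simp]: "dim_row (stack k D d V) = k * D" "dim_col (stack k D d V) = d"
  by (auto simp: stack_def)

lemma adj_block_embed_stack:
  assumes "j < k" "V j \<in> carrier_mat D d" shows "adj (block_embed k D j) * stack k D d V = V j"
proof (rule eq_matI)
  fix m y assume "m < dim_row (V j)" "y < dim_col (V j)"
  then have my: "m < D" "y < d" using assms(2) by auto
  then show "(adj (block_embed k D j) * stack k D d V) $$ (m,y) = V j $$ (m,y)"
    using pair_index_less[OF assms(1) my(1)] div_mod_pair[OF my(1), of j]
    by (subst adj_block_embed_mult[OF _ assms(1)]) (auto simp: stack_def)
qed (use assms(2) in auto)

text \<open>Inner products of columns add up over the blocks, so effects that sum to the identity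
  make the stacked operator an isometry.\<close>

lemma stack_isometry:
  assumes V: "\<And>j. j < k \<Longrightarrow> V j \<in> carrier_mat D d"
    and res: "\<forall>x<d. \<forall>y<d. (\<Sum>j<k. (adj (V j) * V j) $$ (x,y)) = (if x = y then 1 else 0)"
  shows "isometry d (k*D) (stack k D d V)"
proof -
  have "adj (stack k D d V) * stack k D d V = 1\<^sub>m d"
  proof (rule eq_matI)
    fix x y assume "x < dim_row (1\<^sub>m d)" "y < dim_col (1\<^sub>m d)"
    then have xy: "x < d" "y < d" by auto
    have "(adj (stack k D d V) * stack k D d V) $$ (x,y) = (\<Sum>j<k. \<Sum>m<D. cnj (V j $$ (m,x)) * V j $$ (m,y))"
      using xy by (subst index_mult_sum)
        (auto simp: stack_def sum_prod_nat pair_index_less div_mod_pair intro!: sum.cong)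
    also have "\<dots> = (\<Sum>j<k. (adj (V j) * V j) $$ (x,y))"
    proof (intro sum.cong refl)
      fix j assume "j \<in> {..<k}"
      then have "dim_row (V j) = D" "dim_col (V j) = d" using V by auto
      then show "(\<Sum>m<D. cnj (V j $$ (m,x)) * V j $$ (m,y)) = (adj (V j) * V j) $$ (x,y)"
        using xy by (subst index_mult_sum) auto
    qed
    finally show "(adj (stack k D d V) * stack k D d V) $$ (x,y) = 1\<^sub>m d $$ (x,y)" using res xy by simp
  qed auto
  then show ?thesis by (auto simp: isometry_def intro!: carrier_matI)
qed

lemma normalized_spectral_family:
  assumes "\<forall>j<k. psd n (M j)" "0 < n"
  obtains S s where "\<And>j. j < k \<Longrightarrow> unitary_m n (S j)" "\<And>j i. j < k \<Longrightarrow> i < n \<Longrightarrow> 0 \<le> s j i"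
    "\<And>j. j < k \<Longrightarrow> (\<Sum>i<n. s j i) = (1::real)"
    "\<And>j. j < k \<Longrightarrow> M j = S j * rdiag n (\<lambda>i. Re (mtrace (M j)) * s j i) * adj (S j)"
proof -
  have "\<forall>j. \<exists>U d. j < k \<longrightarrow> unitary_m n U \<and> (\<forall>i<n. 0 \<le> d i) \<and> (\<Sum>i<n. d i) = 1 \<and>
      M j = U * rdiag n (\<lambda>i. Re (mtrace (M j)) * d i) * adj U"
  proof
    fix j
    show "\<exists>U d. j < k \<longrightarrow> unitary_m n U \<and> (\<forall>i<n. 0 \<le> d i) \<and> (\<Sum>i<n. d i) = 1 \<and>
      M j = U * rdiag n (\<lambda>i. Re (mtrace (M j)) * d i) * adj U"
    proof (cases "j < k")
      case True
      then have Mj: "psd n (M j)" using assms(1) by blast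
      obtain U d where "unitary_m n U" "\<And>i. i < n \<Longrightarrow> 0 \<le> d i" "(\<Sum>i<n. d i) = 1"
        "M j = U * rdiag n (\<lambda>i. Re (mtrace (M j)) * d i) * adj U"
        by (rule normalized_spectral[OF Mj assms(2)], rule that)
      then show ?thesis by blast
    qed simp
  qed
  then have "\<exists>S s. \<forall>j. j < k \<longrightarrow> unitary_m n (S j) \<and> (\<forall>i<n. 0 \<le> s j i) \<and> (\<Sum>i<n. s j i) = 1 \<and>
      M j = S j * rdiag n (\<lambda>i. Re (mtrace (M j)) * s j i) * adj (S j)"
    by (simp only: choice_iff)
  then show thesis using that by blast
qed

text \<open>Effects summing to the identity make the block traces a probability distribution, as
  \<open>markov_decomp\<close> demands of the weights.\<close>

lemma block_probabilities_sum:
  assumes \<rho>: "density (a*d*c) \<rho>" and V: "feasible d V"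
  shows "(\<Sum>j<d*d. Re (mtrace (block_out a c (V j) \<rho>))) = 1"
proof -
  note p = densityD(1)[OF \<rho>]
  have Vc: "dim_row (V j) = d*d" "dim_col (V j) = d" if "j < d*d" for j
    using V that by (auto simp: feasible_def)
  have G: "msum d (d*d) (\<lambda>j. adj (V j) * V j) = 1\<^sub>m d"
    by (rule eq_matI) (use V in \<open>auto simp: feasible_def msum_index\<close>)
  have "(\<Sum>j<d*d. mtrace (block_out a c (V j) \<rho>)) = (\<Sum>j<d*d. mtrace (\<rho> * extend a c (adj (V j) * V j)))"
    by (intro sum.cong refl mtrace_block_out[OF psdD(1)[OF p]]) (use Vc in auto)
  also have "\<dots> = mtrace (\<rho> * msum (a*d*c) (d*d) (\<lambda>j. extend a c (adj (V j) * V j)))"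
    by (rule mtrace_mult_msum[symmetric, OF psdD(1)[OF p]]) (use Vc in \<open>auto intro!: carrier_matI\<close>)
  also have "msum (a*d*c) (d*d) (\<lambda>j. extend a c (adj (V j) * V j)) = 1\<^sub>m (a*d*c)"
    by (subst extend_msum) (use Vc G in \<open>auto intro!: carrier_matI\<close>)
  also have "mtrace (\<rho> * 1\<^sub>m (a*d*c)) = 1" using psdD[OF p] densityD(2)[OF \<rho>] by simp
  finally have "(\<Sum>j<d*d. mtrace (block_out a c (V j) \<rho>)) = 1" .
  then show ?thesis using Re_sum[of "\<lambda>j. mtrace (block_out a c (V j) \<rho>)" "{..<d*d}"] by simp
qed

text \<open>The enlarged middle system consists of \<open>d * d\<close> blocks of dimension
  \<open>d * d\<close>. Weights and factor states come from the traces and normalised marginals of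
  the outputs, which is the case of equality.\<close>

lemma rel_entropy_attained:
  assumes \<rho>: "density (dA * d * dC) \<rho>" and V: "feasible d V"
  obtains VB W p \<sigma> \<tau> \<mu> where "isometry d (d*d*(d*d)) VB"
    "markov_decomp dA (d*d*(d*d)) dC (d*d) (\<lambda>_. d) (\<lambda>_. d) W p \<sigma> \<tau> \<mu>"
    "rel_entropy (embed3 (1\<^sub>m dA) VB (1\<^sub>m dC) \<rho>) \<mu> = ereal (- eta \<rho> + total_cost dA dC d V \<rho>)"
proof -
  let ?D = "d*d"
  note p = densityD(1)[OF \<rho>]
  have pos: "0 < dA * d" "0 < d * dC" using density_dim_pos[OF \<rho>] by (auto intro: gr0I)
  have Vc: "V j \<in> carrier_mat (d*d) d" if "j < d*d" for j using V that by (simp add: feasible_def)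
  define VB where "VB = stack ?D ?D d V"
  have VB: "isometry d (?D*?D) VB"
    unfolding VB_def by (rule stack_isometry) (use V in \<open>auto simp: feasible_def\<close>)
  define W where "W = block_embed ?D ?D"
  define X where "X j = block_out dA dC (V j) \<rho>" for j
  define q where "q j = Re (mtrace (X j))" for j
  have psdL: "\<forall>j<?D. psd (dA*d) (margL dA dC d d (V j) \<rho>)" and psdR: "\<forall>j<?D. psd (d*dC) (margR dA dC d d (V j) \<rho>)"
    using psd_marg[OF p Vc] by auto
  have trq: "Re (mtrace (margL dA dC d d (V j) \<rho>)) = q j" "Re (mtrace (margR dA dC d d (V j) \<rho>)) = q j" if "j < ?D" for j
    using mtrace_marg[OF Vc[OF that]] by (simp_all add: q_def X_def)
  obtain S s where S: "\<And>j. j < ?D \<Longrightarrow> unitary_m (dA*d) (S j)" "\<And>j i. j < ?D \<Longrightarrow> i < dA*d \<Longrightarrow> 0 \<le> s j i"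
    "\<And>j. j < ?D \<Longrightarrow> (\<Sum>i<dA*d. s j i) = (1::real)"
    "\<And>j. j < ?D \<Longrightarrow> margL dA dC d d (V j) \<rho> = S j * rdiag (dA*d) (\<lambda>i. Re (mtrace (margL dA dC d d (V j) \<rho>)) * s j i) * adj (S j)"
    by (rule normalized_spectral_family[OF psdL pos(1)], rule that)
  obtain T t where T: "\<And>j. j < ?D \<Longrightarrow> unitary_m (d*dC) (T j)" "\<And>j i. j < ?D \<Longrightarrow> i < d*dC \<Longrightarrow> 0 \<le> t j i"
    "\<And>j. j < ?D \<Longrightarrow> (\<Sum>i<d*dC. t j i) = (1::real)"
    "\<And>j. j < ?D \<Longrightarrow> margR dA dC d d (V j) \<rho> = T j * rdiag (d*dC) (\<lambda>i. Re (mtrace (margR dA dC d d (V j) \<rho>)) * t j i) * adj (T j)"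
    by (rule normalized_spectral_family[OF psdR pos(2)], rule that)
  define \<sigma> where "\<sigma> j = S j * rdiag (dA*d) (s j) * adj (S j)" for j
  define \<tau> where "\<tau> j = T j * rdiag (d*dC) (t j) * adj (T j)" for j
  define \<mu> where "\<mu> = msum (dA * (?D*?D) * dC) ?D (\<lambda>j.
           let E = kron (kron (1\<^sub>m dA) (W j)) (1\<^sub>m dC)
           in complex_of_real (q j) \<cdot>\<^sub>m (E * kron (\<sigma> j) (\<tau> j) * adj E))"
  have md: "markov_decomp dA (?D*?D) dC ?D (\<lambda>_. d) (\<lambda>_. d) W q \<sigma> \<tau> \<mu>"
    unfolding markov_decomp_def
  proof (intro conjI allI impI)
    show "isometry (d*d) (?D*?D) (W j)" if "j < ?D" for j
      using block_embed_gram[OF that that, of ?D] by (auto simp: isometry_def W_def intro!: carrier_matI)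
    show "adj (W i) * W j = 0\<^sub>m (d*d) (d*d)" if "i < ?D" "j < ?D" "i \<noteq> j" for i j
      using block_embed_gram[OF that(1,2), of ?D] that(3) by (simp add: W_def)
    show "msum (?D*?D) ?D (\<lambda>j. W j * adj (W j)) = 1\<^sub>m (?D*?D)" unfolding W_def by (rule block_embed_sum)
    show "0 \<le> q j" if "j < ?D" for j
      unfolding q_def X_def by (rule mtrace_psd(1)[OF psd_block_out[OF p Vc[OF that]]])
    show "(\<Sum>j<?D. q j) = 1" unfolding q_def X_def by (rule block_probabilities_sum[OF \<rho> V])
    show "density (dA*d) (\<sigma> j)" if "j < ?D" for j unfolding \<sigma>_def by (rule density_diag) (use S that in auto)
    show "density (d*dC) (\<tau> j)" if "j < ?D" for j unfolding \<tau>_def by (rule density_diag) (use T that in auto)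
    show "\<mu> = msum (dA * (?D*?D) * dC) ?D (\<lambda>j.
           let E = kron (kron (1\<^sub>m dA) (W j)) (1\<^sub>m dC)
           in complex_of_real (q j) \<cdot>\<^sub>m (E * kron (\<sigma> j) (\<tau> j) * adj E))" by (rule \<mu>_def)
  qed
  note R = embed3_state[OF \<rho> isometry_one VB isometry_one]
  interpret M: markov_diag dA "?D*?D" dC ?D "\<lambda>_. d" "\<lambda>_. d" W q \<sigma> \<tau> \<mu> S T s t "embed3 (1\<^sub>m dA) VB (1\<^sub>m dC) \<rho>"
    by unfold_locales (use md S(1) T(1) R(1) in \<open>auto simp: \<sigma>_def \<tau>_def\<close>)
  have Y: "M.Y j = X j" if j: "j < ?D" for j
  proof -
    note [simp] = isometryD(1,2)[OF VB] psdD(3,4)[OF p]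
    have Wd [simp]: "dim_row (W j) = ?D*?D" "dim_col (W j) = ?D" by (auto simp: W_def)
    have "adj (W j) * VB = V j"
      unfolding W_def VB_def by (rule adj_block_embed_stack[of j ?D V ?D d, OF j Vc[OF j]])
    then have "extend dA dC (V j) = adj (M.E j) * extend dA dC VB"
      by (simp add: M.E_def adj_extend flip: extend_mult)
    then show ?thesis
      unfolding M.Y_def X_def block_out_def unfolding embed3_def Let_def extend_def[of dA dC VB, symmetric]
      using M.E_dim[OF j] by (simp add: M.n_def adj_mult mult_assoc_dim)
  qed
  have Mq: "M.q j = q j" if "j < ?D" for j using Y[OF that] by (simp add: M.q_def q_def)
  have ptr: "ptrR (dA*d) (d*dC) (M.Y j) = margL dA dC d d (V j) \<rho>" "ptrL (dA*d) (d*dC) (M.Y j) = margR dA dC d d (V j) \<rho>"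
    if "j < ?D" for j
    unfolding Y[OF that] X_def margL_def margR_def by (rule refl)+
  have "rel_entropy (embed3 (1\<^sub>m dA) VB (1\<^sub>m dC) \<rho>) \<mu> = ereal (- eta (embed3 (1\<^sub>m dA) VB (1\<^sub>m dC) \<rho>) + M.D)"
  proof (rule M.rel_entropy_eq_D)
    fix j assume j: "j < ?D"
    show "q j = M.q j" by (rule Mq[OF j, symmetric])
    show "ptrR (dA*d) (d*dC) (M.Y j) = S j * rdiag (dA*d) (\<lambda>a. M.q j * s j a) * adj (S j)"
      unfolding ptr[OF j] Mq[OF j] using S(4)[OF j] unfolding trq[OF j] .
    show "ptrL (dA*d) (d*dC) (M.Y j) = T j * rdiag (d*dC) (\<lambda>b. M.q j * t j b) * adj (T j)"
      unfolding ptr[OF j] Mq[OF j] using T(4)[OF j] unfolding trq[OF j] .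
  qed
  also have "M.D = total_cost dA dC d V \<rho>"
    unfolding M.D_def total_cost_def
    by (intro sum.cong refl) (simp add: ptr Mq cost_def q_def X_def)
  finally have "rel_entropy (embed3 (1\<^sub>m dA) VB (1\<^sub>m dC) \<rho>) \<mu> = ereal (- eta \<rho> + total_cost dA dC d V \<rho>)"
    by (simp add: R(3))
  then show thesis using that[OF VB md] by blast
qed

text \<open>The stacked minimiser is a competitor whose value equals the lower bound valid for all
  competitors.\<close>

lemma Delta_eq:
  assumes \<rho>: "density (dA * dB * dC) \<rho>"
  shows "Delta dA dB dC \<rho> = ereal (- eta \<rho> + min_cost dA dC dB \<rho>)"
    "\<exists>VB W p \<sigma> \<tau> \<mu>. isometry dB (dB*dB*(dB*dB)) VB \<and>
      markov_decomp dA (dB*dB*(dB*dB)) dC (dB*dB) (\<lambda>_. dB) (\<lambda>_. dB) W p \<sigma> \<tau> \<mu> \<and>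
      rel_entropy (embed3 (1\<^sub>m dA) VB (1\<^sub>m dC) \<rho>) \<mu> = ereal (- eta \<rho> + min_cost dA dC dB \<rho>)"
proof -
  have dB: "0 < dB" using density_dim_pos[OF \<rho>] by (auto intro: gr0I)
  obtain V where V: "feasible dB V" "total_cost dA dC dB V \<rho> = min_cost dA dC dB \<rho>"
    using min_cost_attained[OF densityD(1)[OF \<rho>] dB] by blast
  obtain VB W p \<sigma> \<tau> \<mu> where *: "isometry dB (dB*dB*(dB*dB)) VB"
    "markov_decomp dA (dB*dB*(dB*dB)) dC (dB*dB) (\<lambda>_. dB) (\<lambda>_. dB) W p \<sigma> \<tau> \<mu>"
    "rel_entropy (embed3 (1\<^sub>m dA) VB (1\<^sub>m dC) \<rho>) \<mu> = ereal (- eta \<rho> + min_cost dA dC dB \<rho>)"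
    by (rule rel_entropy_attained[OF \<rho> V(1), unfolded V(2)], rule that)
  then show "\<exists>VB W p \<sigma> \<tau> \<mu>. isometry dB (dB*dB*(dB*dB)) VB \<and>
      markov_decomp dA (dB*dB*(dB*dB)) dC (dB*dB) (\<lambda>_. dB) (\<lambda>_. dB) W p \<sigma> \<tau> \<mu> \<and>
      rel_entropy (embed3 (1\<^sub>m dA) VB (1\<^sub>m dC) \<rho>) \<mu> = ereal (- eta \<rho> + min_cost dA dC dB \<rho>)" by blast
  have ms: "markov_state dA (dB*dB*(dB*dB)) dC \<mu>" unfolding markov_state_def using *(2) by blast
  show "Delta dA dB dC \<rho> = ereal (- eta \<rho> + min_cost dA dC dB \<rho>)"
    unfolding Delta_def
  proof (rule antisym)
    show "Inf {rel_entropy (embed3 VA VB VC \<rho>) \<mu> | dA' dB' dC' VA VB VC \<mu>.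
      isometry dA dA' VA \<and> isometry dB dB' VB \<and> isometry dC dC' VC \<and> markov_state dA' dB' dC' \<mu>}
      \<le> ereal (- eta \<rho> + min_cost dA dC dB \<rho>)"
      unfolding *(3)[symmetric] using *(1) ms isometry_one by (intro Inf_lower) blast
    show "ereal (- eta \<rho> + min_cost dA dC dB \<rho>) \<le> Inf {rel_entropy (embed3 VA VB VC \<rho>) \<mu> | dA' dB' dC' VA VB VC \<mu>.
      isometry dA dA' VA \<and> isometry dB dB' VB \<and> isometry dC dC' VC \<and> markov_state dA' dB' dC' \<mu>}"
      by (rule Inf_greatest, clarify, rule rel_entropy_lower_bound[OF \<rho>])
  qed
qed

text \<open>Both terms of the formula for \<open>Delta\<close> are real and continuous, and the
  limit passes from the reals to \<open>ereal\<close>.\<close>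

lemma Delta_tendsto:
  assumes \<rho>: "density (dA * dB * dC) \<rho>" and R: "\<And>n. density (dA * dB * dC) (R n)"
    and lim: "\<forall>i < dA * dB * dC. \<forall>j < dA * dB * dC. (\<lambda>n. R n $$ (i,j)) \<longlonglongrightarrow> \<rho> $$ (i,j)"
  shows "(\<lambda>n. Delta dA dB dC (R n)) \<longlonglongrightarrow> Delta dA dB dC \<rho>"
proof -
  have dB: "0 < dB" using density_dim_pos[OF \<rho>] by (auto intro: gr0I)
  note p = densityD(1)[OF R] densityD(1)[OF \<rho>]
  have ml: "mlim (dA * dB * dC) (dA * dB * dC) R \<rho>"
    unfolding mlim_def using psdD(1)[OF p(1)] psdD(1)[OF p(2)] lim by blast
  show ?thesis
    unfolding Delta_eq(1)[OF R] Delta_eq(1)[OF \<rho>]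
    by (intro tendsto_intros tendsto_eta[OF ml p] tendsto_min_cost[OF ml p dB])
qed

text \<open>The minimising family has \<open>dB * dB\<close> blocks with both factors of dimension
  \<open>dB\<close>, which meets the bounds. Continuity is sequential and entrywise, the usual
  topology in fixed finite dimensions.\<close>

theorem theorem2:
  fixes dA dB dC :: nat and \<rho> :: "complex mat"
  assumes "density (dA * dB * dC) \<rho>"
  shows "(\<exists>dB' VB k l r W p \<sigma> \<tau> \<mu>.
            isometry dB dB' VB \<and> markov_decomp dA dB' dC k l r W p \<sigma> \<tau> \<mu> \<and>
            k \<le> dB ^ 2 \<and> (\<forall>j<k. l j \<le> dB \<and> r j \<le> dB) \<and>
            rel_entropy (embed3 (1\<^sub>m dA) VB (1\<^sub>m dC) \<rho>) \<mu> = Delta dA dB dC \<rho>)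
       \<and> (\<forall>\<sigma>s :: nat \<Rightarrow> complex mat.
            (\<forall>n. density (dA * dB * dC) (\<sigma>s n)) \<and>
            (\<forall>i < dA * dB * dC. \<forall>j < dA * dB * dC. (\<lambda>n. \<sigma>s n $$ (i,j)) \<longlonglongrightarrow> \<rho> $$ (i,j))
            \<longrightarrow> (\<lambda>n. Delta dA dB dC (\<sigma>s n)) \<longlonglongrightarrow> Delta dA dB dC \<rho>)"
proof (intro conjI allI impI)
  obtain VB W p \<sigma> \<tau> \<mu> where *: "isometry dB (dB*dB*(dB*dB)) VB"
    "markov_decomp dA (dB*dB*(dB*dB)) dC (dB*dB) (\<lambda>_. dB) (\<lambda>_. dB) W p \<sigma> \<tau> \<mu>"
    "rel_entropy (embed3 (1\<^sub>m dA) VB (1\<^sub>m dC) \<rho>) \<mu> = Delta dA dB dC \<rho>"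
    using Delta_eq(2)[OF assms] unfolding Delta_eq(1)[OF assms] by blast
  show "\<exists>dB' VB k l r W p \<sigma> \<tau> \<mu>.
            isometry dB dB' VB \<and> markov_decomp dA dB' dC k l r W p \<sigma> \<tau> \<mu> \<and>
            k \<le> dB ^ 2 \<and> (\<forall>j<k. l j \<le> dB \<and> r j \<le> dB) \<and>
            rel_entropy (embed3 (1\<^sub>m dA) VB (1\<^sub>m dC) \<rho>) \<mu> = Delta dA dB dC \<rho>"
    by (intro exI conjI, rule *(1), rule *(2)) (use *(3) in \<open>auto simp: power2_eq_square\<close>)
next
  fix \<sigma>s :: "nat \<Rightarrow> complex mat"
  assume "(\<forall>n. density (dA * dB * dC) (\<sigma>s n)) \<and>
    (\<forall>i < dA * dB * dC. \<forall>j < dA * dB * dC. (\<lambda>n. \<sigma>s n $$ (i,j)) \<longlonglongrightarrow> \<rho> $$ (i,j))"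
  then show "(\<lambda>n. Delta dA dB dC (\<sigma>s n)) \<longlonglongrightarrow> Delta dA dB dC \<rho>"
    by (intro Delta_tendsto[OF assms]) auto
qed

end
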